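(* Let $F$ and $G$ satisfy assumptions (F) and (G) stated in the context (with parameters $\delta\in[0,1)$ and $0\le\sigma<\alpha$), let $\mathbf{X}=(X,X^{(2)})$ be an $\alpha$-Hölder rough path, and let $(y,G(y))\in D^{2\alpha}_{X,\gamma}([0,T])$ be the solution of $$\mathrm{d}y_t=[Ay_t+F(y_t)]\,\mathrm{d}t+G(y_t)\,\mathrm{d}\mathbf{X}_t,\qquad y(0)=y_0,$$ on the time interval $[0,T]$ with initial data $y_0\in\mathcal{B}_\gamma$. Then there is a constant $C>0$ (subject to the convention on constants in the context) such that $$\|y,G(y)\|_{X,2\alpha,\gamma}\le C\Big(1+|y_0|_{\mathcal{B}_\gamma}+T^{\eta}\,\|y,G(y)\|_{X,2\alpha,\gamma}\Big),\qquad\eta:=(\alpha-\sigma)\wedge(1-\delta).$$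
   Context: Throughout, $\alpha\in(\frac13,\frac12)$ and $\gamma\in\mathbb{R}$ are fixed. Spaces and semigroup. $(\mathcal{B}_\theta,|\cdot|_\theta)_{\theta\in\mathbb{R}}$ (the norm is also written $|\cdot|_{\mathcal{B}_\theta}$) is a monotone family of interpolation spaces: separable Banach spaces such that for $\beta_1\le\beta_2$ one has $\mathcal{B}_{\beta_2}\subset\mathcal{B}_{\beta_1}$ with dense and continuous embedding, and for $\theta\le\beta\le\kappa$ there is a constant $C$ with $|x|_\beta^{\kappa-\theta}\le C|x|_\theta^{\kappa-\beta}|x|_\kappa^{\beta-\theta}$ for all $x\in\mathcal{B}_\kappa$. $A$ generates an analytic $C_0$-semigroup $(S(t))_{t\ge0}$ which acts consistently as a semigroup of bounded operators on all spaces $\mathcal{B}_\theta$, and for all $\theta\in\mathbb{R}$, $\sigma\in[0,1]$ and $T>0$ there is a constant $C$ such that for $t\in(0,T]$: $|(S(t)-\mathrm{Id})x|_\theta\le Ct^\sigma|x|_{\theta+\sigma}$ for $x\in\mathcal{B}_{\theta+\sigma}$, and $|S(t)x|_{\theta+\sigma}\le Ct^{-\sigma}|x|_\theta$ for $x\in\mathcal{B}_\theta$. Rough paths. An $\alpha$-Hölder rough path on $[0,T]$ (scalar noise, $d=1$) is a pair $\mathbf{X}=(X,X^{(2)})$ with $X\in C^\alpha([0,T];\mathbb{R})$, $X_0=0$, and $X^{(2)}:\{(s,t)\in[0,T]^2:s\le t\}\to\mathbb{R}$ continuous with $\sup_{s<t}|X^{(2)}_{s,t}|/|t-s|^{2\alpha}<\infty$,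 satisfying Chen's relation $X^{(2)}_{s,t}-X^{(2)}_{s,u}-X^{(2)}_{u,t}=(X_u-X_s)(X_t-X_u)$ for $s\le u\le t$. Set $\rho_\alpha(\mathbf{X})=\sup_{s<t}|X_t-X_s|/|t-s|^\alpha+\sup_{s<t}|X^{(2)}_{s,t}|/|t-s|^{2\alpha}$. For a path $f$ write $f_{s,t}=f_t-f_s$. Controlled rough paths. For $\kappa\in\mathbb{R}$, $D^{2\alpha}_{X,\kappa}([0,T])$ is the set of pairs $(y,y')$ with $y\in C([0,T];\mathcal{B}_\kappa)$, $y'\in C([0,T];\mathcal{B}_{\kappa-\alpha})\cap C^\alpha([0,T];\mathcal{B}_{\kappa-2\alpha})$, such that, with the remainder $R^y_{s,t}=y_{s,t}-y'_sX_{s,t}$, the following norm is finite: $$\|y,y'\|_{X,2\alpha,\kappa}=\|y\|_{\infty,\mathcal{B}_\kappa}+\|y'\|_{\infty,\mathcal{B}_{\kappa-\alpha}}+\|y'\|_{\alpha,\mathcal{B}_{\kappa-2\alpha}}+\|R^y\|_{\alpha,\mathcal{B}_{\kappa-\alpha}}+\|R^y\|_{2\alpha,\mathcal{B}_{\kappa-2\alpha}}.$$ Here $\|\cdot\|_{\infty,\mathcal{B}_\theta}$ is the supremum norm on $[0,T]$ and $\|\cdot\|_{\beta,\mathcal{B}_\theta}$ is the $\beta$-Hölder seminorm on $[0,T]$: $\sup_{s<t}|f_{s,t}|_\theta/(t-s)^\beta$ for paths, $\sup_{s<t}|R_{s,t}|_\theta/(t-s)^\beta$ for two-parameter maps. Rough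 integral. For $(v,v')\in D^{2\alpha}_{X,\kappa}([0,T])$, $\int_0^tS(t-r)v_r\,\mathrm{d}\mathbf{X}_r:=\lim_{|\pi|\to0}\sum_{[u,w]\in\pi}S(t-u)[v_uX_{u,w}+v'_uX^{(2)}_{u,w}]$, the limit being taken in $\mathcal{B}_{\kappa-2\alpha}$ along partitions $\pi$ of $[0,t]$ (this limit exists). Assumptions. (F): $F:\mathcal{B}_\gamma\to\mathcal{B}_{\gamma-\delta}$, for some $\delta\in[0,1)$, is locally Lipschitz continuous with linear growth, i.e. $|F(x)|_{\gamma-\delta}\le C(1+|x|_\gamma)$. (G): for some $0\le\sigma<\alpha$ and every $\theta\in\{0,\alpha,2\alpha\}$, $G:\mathcal{B}_{\gamma-\theta}\to\mathcal{B}_{\gamma-\theta-\sigma}$ is three times continuously (Fréchet) differentiable with derivatives $D^kG$, $k\in\{1,2,3\}$, bounded (uniformly over $\mathcal{B}_{\gamma-\theta}$) in $\mathcal{L}(\mathcal{B}_{\gamma-\theta}^{\otimes k},\mathcal{B}_{\gamma-\theta-\sigma})$; moreover the map $x\mapsto DG(x)G(x)$ from $\mathcal{B}_{\gamma-\alpha}$ to $\mathcal{B}_{\gamma-2\alpha-\sigma}$ has bounded derivative. Solution. $(y,y')\in D^{2\alpha}_{X,\gamma}([0,T])$ is a solution on $[0,T]$ if $y'=G(y)$ and $y_t=S(t)y_0+\int_0^tS(t-s)F(y_s)\,\mathrm{d}s+\int_0^tS(t-s)G(y_s)\,\mathrm{d}\mathbf{X}_s$ for $t\in[0,T]$, where the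 integrand $G(y)$ is the controlled rough path $(G(y),DG(y)G(y))\in D^{2\alpha}_{X,\gamma-\sigma}([0,T])$. Convention on constants. $C$ may depend on the fixed spaces and semigroup, on $\alpha,\gamma,\rho_\alpha(\mathbf{X})$ and on $F$ and $G$ and their derivatives (including $\delta,\sigma$), but not on $y_0$ or $y$; it may depend on $T$ but uniformly for $T$ in compact intervals (for each $T_0>0$ the same $C$ can be used for all $T\in(0,T_0]$). *)

theory Defs
  imports "HOL-Analysis.Analysis"
begin

text \<open>
  The scale of spaces is indexed by all real numbers, so its members cannot be types.  Each of them
  is a linear subspace of one ambient real vector space, equipped with its own norm.  The ambient
  space carries no topology (for a given scale it may be taken to be the union of the spaces), so
  that inclusions between members of the scale are literal inclusions of sets.
\<close>

record 'b nspace =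
  car :: "'b set"
  nrm :: "'b \<Rightarrow> real"

definition normed_nspace :: "'b::real_vector nspace \<Rightarrow> bool" where
  "normed_nspace E \<longleftrightarrow> subspace (car E) \<and>
     (\<forall>x\<in>car E. 0 \<le> nrm E x \<and> (nrm E x = 0 \<longleftrightarrow> x = 0)) \<and>
     (\<forall>x\<in>car E. \<forall>c. nrm E (c *\<^sub>R x) = \<bar>c\<bar> * nrm E x) \<and>
     (\<forall>x\<in>car E. \<forall>y\<in>car E. nrm E (x + y) \<le> nrm E x + nrm E y)"

text \<open>
  The locale \<^locale>\<open>Metric_space\<close> asks for nonnegativity and symmetry on the whole type, whereas \<open>nrm E\<close>
  is unconstrained off the carrier; hence the default value.
\<close>

definition ndist :: "'b::real_vector nspace \<Rightarrow> 'b \<Rightarrow> 'b \<Rightarrow> real" where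
  "ndist E x y = (if x \<in> car E \<and> y \<in> car E then nrm E (x - y) else 0)"

lemma Metric_space_ndist:
  assumes "normed_nspace E"
  shows "Metric_space (car E) (ndist E)"
proof
  have diff: "x - y \<in> car E" if "x \<in> car E" "y \<in> car E" for x y
    using assms that by (simp add: normed_nspace_def subspace_diff)
  have pos: "0 \<le> nrm E x" if "x \<in> car E" for x
    using assms that by (simp add: normed_nspace_def)
  have zero: "nrm E x = 0 \<longleftrightarrow> x = 0" if "x \<in> car E" for x
    using assms that by (simp add: normed_nspace_def)
  have scale: "nrm E (c *\<^sub>R x) = \<bar>c\<bar> * nrm E x" if "x \<in> car E" for c x
    using assms that by (simp add: normed_nspace_def)
  have tri: "nrm E (x + y) \<le> nrm E x + nrm E y" if "x \<in> car E" "y \<in> car E" for x y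
    using assms that by (simp add: normed_nspace_def)
  show "0 \<le> ndist E x y" for x y
    unfolding ndist_def using pos[OF diff, of x y] by (cases "x \<in> car E \<and> y \<in> car E") auto
  have commute: "nrm E (x - y) = nrm E (y - x)" if "x \<in> car E" "y \<in> car E" for x y
    using scale[OF diff[OF that(2,1)], of "-1"] by simp
  show "ndist E x y = ndist E y x" for x y
    unfolding ndist_def using commute[of x y] by (cases "x \<in> car E \<and> y \<in> car E") auto
  show "ndist E x y = 0 \<longleftrightarrow> x = y" if "x \<in> car E" "y \<in> car E" for x y
    using zero[OF diff[OF that]] that by (simp add: ndist_def)
  show "ndist E x z \<le> ndist E x y + ndist E y z"
    if "x \<in> car E" "y \<in> car E" "z \<in> car E" for x y z
    using tri[OF diff[OF that(1,2)] diff[OF that(2,3)]] that by (simp add: ndist_def)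
qed

definition ntop :: "'b::real_vector nspace \<Rightarrow> 'b topology" where
  "ntop E = Metric_space.mtopology (car E) (ndist E)"

definition separable_banach :: "'b::real_vector nspace \<Rightarrow> bool" where
  "separable_banach E \<longleftrightarrow> normed_nspace E \<and>
     Metric_space.mcomplete (car E) (ndist E) \<and> separable_space (ntop E)"

definition real_nspace :: "real nspace" where
  "real_nspace = \<lparr>car = UNIV, nrm = abs\<rparr>"

definition bounded_linear_between ::
    "'b::real_vector nspace \<Rightarrow> 'c::real_vector nspace \<Rightarrow> ('b \<Rightarrow> 'c) \<Rightarrow> bool" where
  "bounded_linear_between E E' L \<longleftrightarrow>
     (\<forall>x\<in>car E. L x \<in> car E') \<and>
     (\<forall>x\<in>car E. \<forall>y\<in>car E. L (x + y) = L x + L y) \<and>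
     (\<forall>x\<in>car E. \<forall>c. L (c *\<^sub>R x) = c *\<^sub>R L x) \<and>
     (\<exists>M. \<forall>x\<in>car E. nrm E' (L x) \<le> M * nrm E x)"

definition interpolation_scale :: "(real \<Rightarrow> 'b::real_vector nspace) \<Rightarrow> bool" where
  "interpolation_scale B \<longleftrightarrow>
     (\<forall>\<theta>. separable_banach (B \<theta>)) \<and>
     (\<forall>\<beta>1 \<beta>2. \<beta>1 \<le> \<beta>2 \<longrightarrow>
        car (B \<beta>2) \<subseteq> car (B \<beta>1) \<and>
        ntop (B \<beta>1) closure_of car (B \<beta>2) = car (B \<beta>1) \<and>
        continuous_map (ntop (B \<beta>2)) (ntop (B \<beta>1)) (\<lambda>x. x)) \<and>
     (\<forall>\<theta> \<beta> \<kappa>. \<theta> \<le> \<beta> \<and> \<beta> \<le> \<kappa> \<longrightarrow>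
        (\<exists>C. \<forall>x\<in>car (B \<kappa>).
           nrm (B \<beta>) x powr (\<kappa> - \<theta>)
             \<le> C * nrm (B \<theta>) x powr (\<kappa> - \<beta>) * nrm (B \<kappa>) x powr (\<beta> - \<theta>)))"

definition c0_semigroup :: "'b::real_vector nspace \<Rightarrow> (real \<Rightarrow> 'b \<Rightarrow> 'b) \<Rightarrow> bool" where
  "c0_semigroup E S \<longleftrightarrow>
     (\<forall>t\<ge>0. bounded_linear_between E E (S t)) \<and>
     (\<forall>x\<in>car E. S 0 x = x) \<and>
     (\<forall>s\<ge>0. \<forall>t\<ge>0. \<forall>x\<in>car E. S (s + t) x = S s (S t x)) \<and>
     (\<forall>x\<in>car E. limitin (ntop E) (\<lambda>t. S t x) x (at_right 0))"

text \<open>The operator \<open>A\<close>, with domain \<open>D\<close>, is the infinitesimal generator of \<open>S\<close> on \<open>E\<close>.\<close>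

definition generates ::
    "'b::real_vector nspace \<Rightarrow> 'b set \<Rightarrow> ('b \<Rightarrow> 'b) \<Rightarrow> (real \<Rightarrow> 'b \<Rightarrow> 'b) \<Rightarrow> bool" where
  "generates E D A S \<longleftrightarrow>
     D = {x\<in>car E. \<exists>z. limitin (ntop E) (\<lambda>t. (1 / t) *\<^sub>R (S t x - x)) z (at_right 0)} \<and>
     (\<forall>x\<in>D. limitin (ntop E) (\<lambda>t. (1 / t) *\<^sub>R (S t x - x)) (A x) (at_right 0))"

text \<open>
  The spaces are real, so analyticity is analyticity of the extension to the complexification.
  A pair \<open>(x, y)\<close> stands for \<open>x + \<i> y\<close>.  The norm chosen on the complexification is only real
  homogeneous, but it is equivalent to the usual complex norms, and only the topology and the
  boundedness of operators matter below.
\<close>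

definition complexify :: "'b::real_vector nspace \<Rightarrow> ('b \<times> 'b) nspace" where
  "complexify E = \<lparr>car = car E \<times> car E, nrm = (\<lambda>(x, y). nrm E x + nrm E y)\<rparr>"

definition cscale :: "complex \<Rightarrow> 'b::real_vector \<times> 'b \<Rightarrow> 'b \<times> 'b" where
  "cscale z = (\<lambda>(x, y). (Re z *\<^sub>R x - Im z *\<^sub>R y, Im z *\<^sub>R x + Re z *\<^sub>R y))"

definition sector :: "real \<Rightarrow> complex set" where
  "sector \<phi> = {z. z \<noteq> 0 \<and> \<bar>Arg z\<bar> < \<phi>}"

definition analytic_semigroup :: "'b::real_vector nspace \<Rightarrow> (real \<Rightarrow> 'b \<Rightarrow> 'b) \<Rightarrow> bool" where
  "analytic_semigroup E S \<longleftrightarrow> c0_semigroup E S \<and>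
     (\<exists>\<phi> Z. 0 < \<phi> \<and> \<phi> \<le> pi / 2 \<and>
        (\<forall>z\<in>sector \<phi>. bounded_linear_between (complexify E) (complexify E) (Z z) \<and>
           (\<forall>u\<in>car (complexify E). \<forall>c. Z z (cscale c u) = cscale c (Z z u))) \<and>
        (\<forall>t>0. \<forall>x\<in>car E. Z (of_real t) (x, 0) = (S t x, 0)) \<and>
        (\<forall>z\<in>sector \<phi>. \<forall>w\<in>sector \<phi>. \<forall>u\<in>car (complexify E). Z (z + w) u = Z z (Z w u)) \<and>
        (\<forall>z\<in>sector \<phi>. \<forall>u\<in>car (complexify E). \<exists>d.
           limitin (ntop (complexify E)) (\<lambda>h. cscale (1 / h) (Z (z + h) u - Z z u)) d (at 0)) \<and>
        (\<forall>u\<in>car (complexify E).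
           limitin (ntop (complexify E)) (\<lambda>z. Z z u) u (at 0 within sector \<phi>)))"

definition smoothing :: "(real \<Rightarrow> 'b::real_vector nspace) \<Rightarrow> (real \<Rightarrow> 'b \<Rightarrow> 'b) \<Rightarrow> bool" where
  "smoothing B S \<longleftrightarrow>
     (\<forall>\<theta> \<sigma> T. 0 \<le> \<sigma> \<and> \<sigma> \<le> 1 \<and> 0 < T \<longrightarrow> (\<exists>C. \<forall>t\<in>{0<..T}.
        (\<forall>x\<in>car (B (\<theta> + \<sigma>)). nrm (B \<theta>) (S t x - x) \<le> C * t powr \<sigma> * nrm (B (\<theta> + \<sigma>)) x) \<and>
        (\<forall>x\<in>car (B \<theta>). S t x \<in> car (B (\<theta> + \<sigma>)) \<and>
           nrm (B (\<theta> + \<sigma>)) (S t x) \<le> C * t powr (- \<sigma>) * nrm (B \<theta>) x)))"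

text \<open>
  The semigroup acts consistently on the scale: one and the same map \<open>S t\<close> of the ambient space
  restricts to all spaces, and likewise for its generator \<open>A\<close>, whose domain depends on the space.
\<close>

definition scale_semigroup ::
    "(real \<Rightarrow> 'b::real_vector nspace) \<Rightarrow> (real \<Rightarrow> 'b set) \<Rightarrow> ('b \<Rightarrow> 'b) \<Rightarrow> (real \<Rightarrow> 'b \<Rightarrow> 'b) \<Rightarrow> bool"
  where
  "scale_semigroup B domA A S \<longleftrightarrow>
     (\<forall>\<theta>. analytic_semigroup (B \<theta>) S \<and> generates (B \<theta>) (domA \<theta>) A S) \<and> smoothing B S"

text \<open>
  Suprema are taken in \<^typ>\<open>ennreal\<close>, so that an unbounded quantity has the value \<open>\<infinity>\<close>.
\<close>

definition sup_norm :: "'b::real_vector nspace \<Rightarrow> real \<Rightarrow> (real \<Rightarrow> 'b) \<Rightarrow> ennreal" where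
  "sup_norm E T f = (SUP t\<in>{0..T}. ennreal (nrm E (f t)))"

definition hoelder2 ::
    "'b::real_vector nspace \<Rightarrow> real \<Rightarrow> real \<Rightarrow> (real \<Rightarrow> real \<Rightarrow> 'b) \<Rightarrow> ennreal" where
  "hoelder2 E \<beta> T R =
     (SUP (s, t)\<in>{(s, t). 0 \<le> s \<and> s < t \<and> t \<le> T}. ennreal (nrm E (R s t) / (t - s) powr \<beta>))"

definition hoelder :: "'b::real_vector nspace \<Rightarrow> real \<Rightarrow> real \<Rightarrow> (real \<Rightarrow> 'b) \<Rightarrow> ennreal" where
  "hoelder E \<beta> T f = hoelder2 E \<beta> T (\<lambda>s t. f t - f s)"

definition rough_path :: "real \<Rightarrow> real \<Rightarrow> (real \<Rightarrow> real) \<Rightarrow> (real \<Rightarrow> real \<Rightarrow> real) \<Rightarrow> bool" where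
  "rough_path \<alpha> T X XX \<longleftrightarrow>
     X 0 = 0 \<and> hoelder real_nspace \<alpha> T X < \<infinity> \<and>
     continuous_on {(s, t). 0 \<le> s \<and> s \<le> t \<and> t \<le> T} (\<lambda>(s, t). XX s t) \<and>
     hoelder2 real_nspace (2 * \<alpha>) T XX < \<infinity> \<and>
     (\<forall>s u t. 0 \<le> s \<and> s \<le> u \<and> u \<le> t \<and> t \<le> T \<longrightarrow>
        XX s t - XX s u - XX u t = (X u - X s) * (X t - X u))"

definition rough_norm :: "real \<Rightarrow> real \<Rightarrow> (real \<Rightarrow> real) \<Rightarrow> (real \<Rightarrow> real \<Rightarrow> real) \<Rightarrow> ennreal" where
  "rough_norm \<alpha> T X XX = hoelder real_nspace \<alpha> T X + hoelder2 real_nspace (2 * \<alpha>) T XX"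

definition remainder ::
    "(real \<Rightarrow> real) \<Rightarrow> (real \<Rightarrow> 'b::real_vector) \<Rightarrow> (real \<Rightarrow> 'b) \<Rightarrow> real \<Rightarrow> real \<Rightarrow> 'b" where
  "remainder X y y' s t = y t - y s - (X t - X s) *\<^sub>R y' s"

definition crp_norm ::
    "(real \<Rightarrow> 'b::real_vector nspace) \<Rightarrow> real \<Rightarrow> real \<Rightarrow> (real \<Rightarrow> real) \<Rightarrow> real \<Rightarrow>
      (real \<Rightarrow> 'b) \<Rightarrow> (real \<Rightarrow> 'b) \<Rightarrow> ennreal" where
  "crp_norm B \<alpha> T X \<kappa> y y' =
     sup_norm (B \<kappa>) T y + sup_norm (B (\<kappa> - \<alpha>)) T y' + hoelder (B (\<kappa> - 2 * \<alpha>)) \<alpha> T y'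
     + hoelder2 (B (\<kappa> - \<alpha>)) \<alpha> T (remainder X y y')
     + hoelder2 (B (\<kappa> - 2 * \<alpha>)) (2 * \<alpha>) T (remainder X y y')"

text \<open>
  Finiteness of the norm includes the Hoelder continuity of \<open>y'\<close> in the space of index \<open>\<kappa> - 2\<alpha>\<close>.
\<close>

definition controlled ::
    "(real \<Rightarrow> 'b::real_vector nspace) \<Rightarrow> real \<Rightarrow> real \<Rightarrow> (real \<Rightarrow> real) \<Rightarrow> real \<Rightarrow>
      (real \<Rightarrow> 'b) \<Rightarrow> (real \<Rightarrow> 'b) \<Rightarrow> bool" where
  "controlled B \<alpha> T X \<kappa> y y' \<longleftrightarrow>
     continuous_map (top_of_set {0..T}) (ntop (B \<kappa>)) y \<and>
     continuous_map (top_of_set {0..T}) (ntop (B (\<kappa> - \<alpha>))) y' \<and>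
     crp_norm B \<alpha> T X \<kappa> y y' < \<infinity>"

text \<open>
  Limit in \<open>E\<close> of the compensated Riemann sums over partitions of \<open>[0, t]\<close>.  A \<open>division_of\<close> may
  contain degenerate intervals \<open>[u, u]\<close>; these contribute nothing, as Chen's relation gives
  \<open>XX u u = 0\<close>.
\<close>

definition has_rough_integral ::
    "'b::real_vector nspace \<Rightarrow> (real \<Rightarrow> 'b \<Rightarrow> 'b) \<Rightarrow> (real \<Rightarrow> real) \<Rightarrow> (real \<Rightarrow> real \<Rightarrow> real) \<Rightarrow>
      (real \<Rightarrow> 'b) \<Rightarrow> (real \<Rightarrow> 'b) \<Rightarrow> real \<Rightarrow> 'b \<Rightarrow> bool" where
  "has_rough_integral E S X XX v v' t J \<longleftrightarrow> J \<in> car E \<and>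
     (\<forall>\<epsilon>>0. \<exists>d>0. \<forall>\<pi>. \<pi> division_of {0..t} \<and> (\<forall>K\<in>\<pi>. Sup K - Inf K < d) \<longrightarrow>
        nrm E ((\<Sum>K\<in>\<pi>. let u = Inf K; w = Sup K in
                  S (t - u) ((X w - X u) *\<^sub>R v u + XX u w *\<^sub>R v' u)) - J) < \<epsilon>)"

text \<open>
  The Bochner integral in \<open>E\<close>.  This is \<^const>\<open>has_bochner_integral\<close> word for word, except that
  norm, Borel sets and limits are those of \<open>E\<close> and not those of a type class.
\<close>

definition has_bochner_integral_in ::
    "'b::real_vector nspace \<Rightarrow> 'a measure \<Rightarrow> ('a \<Rightarrow> 'b) \<Rightarrow> 'b \<Rightarrow> bool" where
  "has_bochner_integral_in E M f I \<longleftrightarrow>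
     f \<in> measurable M (sigma (car E) {U. openin (ntop E) U}) \<and>
     (\<exists>s. (\<forall>i. Bochner_Integration.simple_bochner_integrable M (s i) \<and> s i ` space M \<subseteq> car E) \<and>
          (\<lambda>i. \<integral>\<^sup>+x. ennreal (nrm E (f x - s i x)) \<partial>M) \<longlonglongrightarrow> 0 \<and>
          limitin (ntop E) (\<lambda>i. Bochner_Integration.simple_bochner_integral M (s i)) I sequentially)"

definition has_frechet_derivative ::
    "'b::real_vector nspace \<Rightarrow> 'c::real_vector nspace \<Rightarrow> ('b \<Rightarrow> 'c) \<Rightarrow> ('b \<Rightarrow> 'c) \<Rightarrow> 'b \<Rightarrow> bool" where
  "has_frechet_derivative E E' f f' x \<longleftrightarrow> bounded_linear_between E E' f' \<and>
     (\<forall>\<epsilon>>0. \<exists>d>0. \<forall>h\<in>car E. nrm E h < d \<longrightarrow>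
        nrm E' (f (x + h) - f x - f' h) \<le> \<epsilon> * nrm E h)"

text \<open>The values of the derivative on the carrier of \<open>E\<close> are uniquely determined.\<close>

definition frechet_deriv ::
    "'b::real_vector nspace \<Rightarrow> 'c::real_vector nspace \<Rightarrow> ('b \<Rightarrow> 'c) \<Rightarrow> 'b \<Rightarrow> 'b \<Rightarrow> 'c" where
  "frechet_deriv E E' f x = (SOME f'. has_frechet_derivative E E' f f' x)"

text \<open>
  Bounded \<open>k\<close>-linear maps, i.e. bounded linear maps on the \<open>k\<close>-fold projective tensor power, with
  the \<open>k\<close> arguments collected in a list.
\<close>

definition tuples :: "nat \<Rightarrow> 'b nspace \<Rightarrow> 'b list set" where
  "tuples k E = {hs. length hs = k \<and> set hs \<subseteq> car E}"

definition multilinear_between ::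
    "nat \<Rightarrow> 'b::real_vector nspace \<Rightarrow> 'c::real_vector nspace \<Rightarrow> ('b list \<Rightarrow> 'c) \<Rightarrow> bool" where
  "multilinear_between k E E' L \<longleftrightarrow>
     (\<forall>hs\<in>tuples k E. L hs \<in> car E') \<and>
     (\<forall>hs\<in>tuples k E. \<forall>i<k. \<forall>x\<in>car E. \<forall>y\<in>car E.
        L (hs[i := x + y]) = L (hs[i := x]) + L (hs[i := y])) \<and>
     (\<forall>hs\<in>tuples k E. \<forall>i<k. \<forall>x\<in>car E. \<forall>c. L (hs[i := c *\<^sub>R x]) = c *\<^sub>R L (hs[i := x])) \<and>
     (\<exists>M. \<forall>hs\<in>tuples k E. nrm E' (L hs) \<le> M * prod_list (map (nrm E) hs))"

text \<open>
  \<open>D j x\<close> is the \<open>j\<close>-th Frechet derivative of \<open>f\<close> at \<open>x\<close> for all \<open>j \<le> k\<close>, and the last of these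
  is continuous in \<open>x\<close> (the others then are as well).  Differentiability and continuity of
  \<open>x \<mapsto> D j x\<close> refer to the operator norm on bounded \<open>j\<close>-linear maps.
\<close>

definition Ck_derivatives ::
    "nat \<Rightarrow> 'b::real_vector nspace \<Rightarrow> 'c::real_vector nspace \<Rightarrow> ('b \<Rightarrow> 'c) \<Rightarrow>
      (nat \<Rightarrow> 'b \<Rightarrow> 'b list \<Rightarrow> 'c) \<Rightarrow> bool" where
  "Ck_derivatives k E E' f D \<longleftrightarrow>
     (\<forall>x\<in>car E. D 0 x [] = f x) \<and>
     (\<forall>j\<le>k. \<forall>x\<in>car E. multilinear_between j E E' (D j x)) \<and>
     (\<forall>j<k. \<forall>x\<in>car E. \<forall>\<epsilon>>0. \<exists>d>0. \<forall>h\<in>car E. nrm E h < d \<longrightarrow>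
        (\<forall>hs\<in>tuples j E. nrm E' (D j (x + h) hs - D j x hs - D (Suc j) x (h # hs))
                            \<le> \<epsilon> * nrm E h * prod_list (map (nrm E) hs))) \<and>
     (\<forall>x\<in>car E. \<forall>\<epsilon>>0. \<exists>d>0. \<forall>h\<in>car E. nrm E h < d \<longrightarrow>
        (\<forall>hs\<in>tuples k E. nrm E' (D k (x + h) hs - D k x hs) \<le> \<epsilon> * prod_list (map (nrm E) hs)))"

text \<open>\<open>k\<close> times continuously differentiable with bounded derivatives; \<open>f\<close> itself may be unbounded.\<close>

definition Ck_bounded_derivatives ::
    "nat \<Rightarrow> 'b::real_vector nspace \<Rightarrow> 'c::real_vector nspace \<Rightarrow> ('b \<Rightarrow> 'c) \<Rightarrow> bool" where
  "Ck_bounded_derivatives k E E' f \<longleftrightarrow>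
     (\<exists>D. Ck_derivatives k E E' f D \<and>
        (\<forall>j\<in>{1..k}. \<exists>M. \<forall>x\<in>car E. \<forall>hs\<in>tuples j E.
           nrm E' (D j x hs) \<le> M * prod_list (map (nrm E) hs)))"

text \<open>Local Lipschitz continuity: every point has a neighbourhood on which \<open>F\<close> is Lipschitz.\<close>

definition assumption_F ::
    "(real \<Rightarrow> 'b::real_vector nspace) \<Rightarrow> real \<Rightarrow> real \<Rightarrow> ('b \<Rightarrow> 'b) \<Rightarrow> bool" where
  "assumption_F B \<gamma> \<delta> F \<longleftrightarrow>
     (\<forall>x\<in>car (B \<gamma>). F x \<in> car (B (\<gamma> - \<delta>))) \<and>
     (\<forall>x\<in>car (B \<gamma>). \<exists>r>0. \<exists>L. \<forall>u\<in>car (B \<gamma>). \<forall>v\<in>car (B \<gamma>).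
        nrm (B \<gamma>) (u - x) < r \<and> nrm (B \<gamma>) (v - x) < r \<longrightarrow>
        nrm (B (\<gamma> - \<delta>)) (F u - F v) \<le> L * nrm (B \<gamma>) (u - v)) \<and>
     (\<exists>C. \<forall>x\<in>car (B \<gamma>). nrm (B (\<gamma> - \<delta>)) (F x) \<le> C * (1 + nrm (B \<gamma>) x))"

text \<open>
  The map \<open>x \<mapsto> DG(x) G(x)\<close>.  For \<open>x\<close> in the space of index \<open>\<gamma> - \<alpha>\<close> the vector \<open>G x\<close> lies only in
  the space of index \<open>\<gamma> - \<alpha> - \<sigma>\<close>, contained in the one of index \<open>\<gamma> - 2\<alpha>\<close>.  Hence \<open>DG\<close> is taken
  on the latter, where it extends the derivatives on the smaller spaces.
\<close>

definition DGG ::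
    "(real \<Rightarrow> 'b::real_vector nspace) \<Rightarrow> real \<Rightarrow> real \<Rightarrow> real \<Rightarrow> ('b \<Rightarrow> 'b) \<Rightarrow> 'b \<Rightarrow> 'b" where
  "DGG B \<alpha> \<gamma> \<sigma> G x =
     frechet_deriv (B (\<gamma> - 2 * \<alpha>)) (B (\<gamma> - 2 * \<alpha> - \<sigma>)) G x (G x)"

definition assumption_G ::
    "(real \<Rightarrow> 'b::real_vector nspace) \<Rightarrow> real \<Rightarrow> real \<Rightarrow> real \<Rightarrow> ('b \<Rightarrow> 'b) \<Rightarrow> bool" where
  "assumption_G B \<alpha> \<gamma> \<sigma> G \<longleftrightarrow>
     (\<forall>\<theta>\<in>{0, \<alpha>, 2 * \<alpha>}. Ck_bounded_derivatives 3 (B (\<gamma> - \<theta>)) (B (\<gamma> - \<theta> - \<sigma>)) G) \<and>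
     (\<exists>D' M. \<forall>x\<in>car (B (\<gamma> - \<alpha>)).
        has_frechet_derivative (B (\<gamma> - \<alpha>)) (B (\<gamma> - 2 * \<alpha> - \<sigma>)) (DGG B \<alpha> \<gamma> \<sigma> G) (D' x) x \<and>
        (\<forall>h\<in>car (B (\<gamma> - \<alpha>)). nrm (B (\<gamma> - 2 * \<alpha> - \<sigma>)) (D' x h) \<le> M * nrm (B (\<gamma> - \<alpha>)) h))"

text \<open>
  Mild solutions \<open>(y, G(y))\<close>.  The drift is integrated in the space of index \<open>\<gamma> - \<delta>\<close>, where its
  integrand takes values on all of \<open>[0, t]\<close>; the rough integral of a path controlled in the
  space of index \<open>\<kappa> = \<gamma> - \<sigma>\<close> is a limit in the space of index \<open>\<kappa> - 2\<alpha>\<close>.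
\<close>

definition mild_solution ::
    "(real \<Rightarrow> 'b::real_vector nspace) \<Rightarrow> (real \<Rightarrow> 'b \<Rightarrow> 'b) \<Rightarrow> real \<Rightarrow> real \<Rightarrow> real \<Rightarrow> real \<Rightarrow>
      ('b \<Rightarrow> 'b) \<Rightarrow> ('b \<Rightarrow> 'b) \<Rightarrow> real \<Rightarrow> (real \<Rightarrow> real) \<Rightarrow> (real \<Rightarrow> real \<Rightarrow> real) \<Rightarrow>
      'b \<Rightarrow> (real \<Rightarrow> 'b) \<Rightarrow> bool" where
  "mild_solution B S \<alpha> \<gamma> \<delta> \<sigma> F G T X XX y0 y \<longleftrightarrow>
     y 0 = y0 \<and>
     controlled B \<alpha> T X \<gamma> y (\<lambda>t. G (y t)) \<and>
     controlled B \<alpha> T X (\<gamma> - \<sigma>) (\<lambda>t. G (y t)) (\<lambda>t. DGG B \<alpha> \<gamma> \<sigma> G (y t)) \<and>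
     (\<forall>t\<in>{0..T}. \<exists>I J.
        has_bochner_integral_in (B (\<gamma> - \<delta>)) (restrict_space lborel {0..t})
          (\<lambda>s. S (t - s) (F (y s))) I \<and>
        has_rough_integral (B (\<gamma> - \<sigma> - 2 * \<alpha>)) S X XX
          (\<lambda>s. G (y s)) (\<lambda>s. DGG B \<alpha> \<gamma> \<sigma> G (y s)) t J \<and>
        y t = S t y0 + I + J)"

end

theory Submission
  imports Defs
begin

text \<open>
  Let \<open>N\<close> be the norm of the controlled path \<open>(y, G(y))\<close> and \<open>Q = 1 + |y\<^sub>0| + T\<^sup>\<eta> N\<close>.  Each of the five parts of the
  norm has to be bounded by a multiple of \<open>Q\<close>.  From any time \<open>s\<close> on, the solution is again a mild solution:
  \<open>y\<^sub>t\<close> is \<open>S(t - s) y\<^sub>s\<close> plus a convolution with the drift plus a convolution with the noise over \<open>[s, t]\<close>.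
  The latter is \<open>S(t - s)\<close> applied to the germ \<open>G(y\<^sub>s) (X\<^sub>t - X\<^sub>s) + DG(y\<^sub>s) G(y\<^sub>s) XX\<^sub>s\<^sub>t\<close> plus a sewing error.

  Three facts make the bound linear and produce the power of \<open>T\<close>.  First, the integrand \<open>G(y)\<close> is a controlled
  path whose norm is at most a multiple of \<open>1 + N\<close>, not of \<open>1 + N\<^sup>2\<close> (\<open>composition_controlled_bounds\<close>); this is
  where the bounded derivative of \<open>DG G\<close> enters, through \<open>assumption_G_estimates\<close>.  Secondly, in the space of
  index \<open>\<gamma> - \<sigma> - 2 \<alpha>\<close> the sewing error has order \<open>3 \<alpha> > 1\<close> in \<open>t - s\<close>, and this order can be traded for regularity by
  the smoothing of the semigroup: raising the index by \<open>e < 3 \<alpha>\<close> leaves the order \<open>3 \<alpha> - e\<close>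
  (\<open>rough_convolution_bound\<close>; likewise \<open>drift_convolution_bound\<close> with \<open>1\<close> instead of \<open>3 \<alpha>\<close>).  In the space of index \<open>\<gamma>\<close>,
  that is for \<open>e = 2 \<alpha> + \<sigma>\<close>, there remains \<open>\<alpha> - \<sigma>\<close>, and \<open>1 - \<delta>\<close> for the drift.  Thirdly, \<open>G(y)\<close> in
  the space of index \<open>\<gamma> - \<alpha>\<close> gains \<open>T powr (\<alpha> - \<sigma>)\<close> by interpolation between the spaces of
  index \<open>\<gamma> - \<sigma> - \<alpha>\<close> and \<open>\<gamma> - \<sigma>\<close> (\<open>solves_G_bound\<close>).

  The order of the estimates matters.  The expansion on \<open>[0, t]\<close> bounds the supremum of \<open>y\<close>.  In the remainder,
  \<open>(S(t - s) - Id) y\<^sub>s\<close> and the drift are then bounded by that supremum with the right power of \<open>t - s\<close> but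
  without any gain in \<open>T\<close>, and so is the second order term of the germ by the supremum of \<open>G(y)\<close>; since these
  suprema are already bounded by \<open>Q\<close>, no gain is needed.  The Hoelder bound for \<open>G(y)\<close> follows from those for \<open>y\<close>.
\<close>

section \<open>Normed subspaces of a vector space\<close>

lemma normed_nspaceD:
  assumes "normed_nspace E"
  shows car_zero: "0 \<in> car E"
    and car_add: "x \<in> car E \<Longrightarrow> y \<in> car E \<Longrightarrow> x + y \<in> car E"
    and car_diff: "x \<in> car E \<Longrightarrow> y \<in> car E \<Longrightarrow> x - y \<in> car E"
    and car_scaleR: "x \<in> car E \<Longrightarrow> c *\<^sub>R x \<in> car E"
    and nrm_nonneg: "x \<in> car E \<Longrightarrow> 0 \<le> nrm E x"
    and nrm_eq_0: "x \<in> car E \<Longrightarrow> nrm E x = 0 \<longleftrightarrow> x = 0"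
    and nrm_scaleR: "x \<in> car E \<Longrightarrow> nrm E (c *\<^sub>R x) = \<bar>c\<bar> * nrm E x"
    and nrm_add: "x \<in> car E \<Longrightarrow> y \<in> car E \<Longrightarrow> nrm E (x + y) \<le> nrm E x + nrm E y"
  using assms by (auto simp: normed_nspace_def subspace_0 subspace_add subspace_diff subspace_scale)

lemma nrm_0: "normed_nspace E \<Longrightarrow> nrm E 0 = 0"
  using nrm_eq_0 car_zero by blast

lemma nrm_commute:
  assumes "normed_nspace E" "x \<in> car E" "y \<in> car E"
  shows "nrm E (x - y) = nrm E (y - x)"
  using nrm_scaleR[OF assms(1) car_diff[OF assms], of "-1"] by simp

lemma nrm_diff:
  assumes "normed_nspace E" "x \<in> car E" "y \<in> car E"
  shows "nrm E (x - y) \<le> nrm E x + nrm E y"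
  using nrm_add[OF assms(1,2), of "-1 *\<^sub>R y"] nrm_scaleR[OF assms(1,3), of "-1"]
    car_scaleR[OF assms(1,3), of "-1"] by simp

lemma nrm_triangle:
  assumes "normed_nspace E" "x \<in> car E" "y \<in> car E" "z \<in> car E"
  shows "nrm E (x - z) \<le> nrm E (x - y) + nrm E (y - z)"
  using nrm_add[OF assms(1) car_diff[OF assms(1-3)] car_diff[OF assms(1,3,4)]] by simp

lemma car_sum:
  assumes "normed_nspace E" "\<And>i. i \<in> A \<Longrightarrow> f i \<in> car E"
  shows "sum f A \<in> car E"
  using assms by (simp add: normed_nspace_def subspace_sum)

lemma nrm_sum:
  assumes E: "normed_nspace E" and "\<And>i. i \<in> A \<Longrightarrow> f i \<in> car E"
  shows "nrm E (sum f A) \<le> (\<Sum>i\<in>A. nrm E (f i))"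
  using assms(2)
proof (induction A rule: infinite_finite_induct)
  case (insert i A)
  have "nrm E (f i + sum f A) \<le> nrm E (f i) + nrm E (sum f A)"
    using insert.prems by (intro nrm_add[OF E] car_sum[OF E]) auto
  then show ?case
    using insert by fastforce
qed (simp_all add: nrm_0[OF E])

lemma limitin_ntop:
  assumes E: "normed_nspace E"
  shows "limitin (ntop E) f l F \<longleftrightarrow>
    l \<in> car E \<and> (\<forall>\<epsilon>>0. eventually (\<lambda>x. f x \<in> car E \<and> nrm E (f x - l) < \<epsilon>) F)"
proof -
  interpret Metric_space "car E" "ndist E"
    by (rule Metric_space_ndist[OF E])
  show ?thesis
    unfolding ntop_def limitin_metric ndist_def by (auto cong: conj_cong)
qed

lemma topspace_ntop: "normed_nspace E \<Longrightarrow> topspace (ntop E) = car E"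
  by (simp add: ntop_def Metric_space.topspace_mtopology Metric_space_ndist)

lemma openin_ntop_ball:
  assumes "normed_nspace E" "y \<in> car E"
  shows "openin (ntop E) {x \<in> car E. nrm E (x - y) < c}"
proof -
  interpret Metric_space "car E" "ndist E"
    by (rule Metric_space_ndist[OF assms(1)])
  have "mball y c = {x \<in> car E. nrm E (x - y) < c}"
    using assms nrm_commute[OF assms(1)] by (auto simp: mball_def ndist_def)
  then show ?thesis
    using openin_mball[of y c] by (simp add: ntop_def)
qed

lemma continuous_inclusion_bounded:
  assumes E1: "normed_nspace E1" and E2: "normed_nspace E2"
    and cont: "continuous_map (ntop E2) (ntop E1) (\<lambda>x. x)"
  shows "\<exists>C>0. \<forall>x\<in>car E2. nrm E1 x \<le> C * nrm E2 x"
proof -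
  interpret M1: Metric_space "car E1" "ndist E1"
    by (rule Metric_space_ndist[OF E1])
  interpret M2: Metric_space "car E2" "ndist E2"
    by (rule Metric_space_ndist[OF E2])
  have sub: "car E2 \<subseteq> car E1"
    using cont by (simp add: ntop_def M2.metric_continuous_map[OF M1.Metric_space_axioms])
  have "\<forall>\<epsilon>>0. \<exists>\<delta>>0. \<forall>x. x \<in> car E2 \<and> ndist E2 0 x < \<delta> \<longrightarrow> ndist E1 0 x < \<epsilon>"
    using cont car_zero[OF E2]
    by (simp add: ntop_def M2.metric_continuous_map[OF M1.Metric_space_axioms])
  then obtain d where "d > 0" and
    d0: "\<And>x. x \<in> car E2 \<Longrightarrow> ndist E2 0 x < d \<Longrightarrow> ndist E1 0 x < 1"
    by (metis zero_less_one)
  have d: "nrm E1 x < 1" if "x \<in> car E2" "nrm E2 x < d" for x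
    using d0[OF that(1)] that sub car_zero[OF E1] car_zero[OF E2]
      nrm_commute[OF E1, of 0 x] nrm_commute[OF E2, of 0 x]
    by (auto simp: ndist_def)
  have "nrm E1 x \<le> 2 / d * nrm E2 x" if x: "x \<in> car E2" for x
  proof (cases "nrm E2 x = 0")
    case True
    then show ?thesis
      using nrm_eq_0[OF E2 x] nrm_0[OF E1] by simp
  next
    case False
    then have pos: "nrm E2 x > 0"
      using nrm_nonneg[OF E2 x] by simp
    define c where "c = d / (2 * nrm E2 x)"
    have "c > 0"
      using pos \<open>d > 0\<close> by (simp add: c_def)
    have "nrm E2 (c *\<^sub>R x) < d"
      using pos \<open>d > 0\<close> by (simp add: nrm_scaleR[OF E2 x] c_def)
    then have "nrm E1 (c *\<^sub>R x) < 1"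
      using d car_scaleR[OF E2 x] by blast
    then have "c * nrm E1 x < 1"
      using x sub \<open>c > 0\<close> by (simp add: nrm_scaleR[OF E1] subset_iff)
    then show ?thesis
      using pos \<open>d > 0\<close> by (simp add: c_def field_simps)
  qed
  then show ?thesis
    using \<open>d > 0\<close> by (intro exI[of _ "2 / d"]) auto
qed

text \<open>
  A bound in a stronger norm cannot in general be carried over to a limit taken in a weaker norm,
  since norms of non-reflexive spaces need not be lower semicontinuous there.  What works is
  completeness: if the successive steps are summable in \<open>E\<close>, the telescoping series converges in \<open>E\<close>,
  and its limit is identified in the larger space \<open>E'\<close>.  Both the sewing lemma and the gain of
  regularity below rest on this.
\<close>

lemma limit_of_geometric_steps:
  assumes E: "normed_nspace E" and compl: "Metric_space.mcomplete (car E) (ndist E)"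
    and E': "normed_nspace E'" and sub: "car E \<subseteq> car E'"
    and emb: "\<And>x. x \<in> car E \<Longrightarrow> nrm E' x \<le> c * nrm E x"
    and a: "\<And>n. a n \<in> car E'" and a0: "(\<lambda>n. nrm E' (a n)) \<longlonglongrightarrow> 0"
    and step: "\<And>n. a n - a (Suc n) \<in> car E"
    and bound: "\<And>n. nrm E (a n - a (Suc n)) \<le> M * q ^ n" and q: "0 \<le> q" "q < 1"
  shows "a 0 \<in> car E \<and> nrm E (a 0) \<le> M / (1 - q)"
proof -
  interpret Metric_space "car E" "ndist E"
    by (rule Metric_space_ndist[OF E])
  \<comment> \<open>The partial sums of the telescoping series.\<close>
  define P where "P n = a 0 - a n" for n
  have P: "P n \<in> car E" for n
  proof (induction n)
    case (Suc n)
    have "P (Suc n) = P n + (a n - a (Suc n))"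
      by (simp add: P_def)
    then show ?case
      using car_add[OF E Suc step] by metis
  qed (simp add: P_def car_zero[OF E])
  have M: "M \<ge> 0"
    using nrm_nonneg[OF E step, of 0] bound[of 0] by simp
  have tail: "nrm E (P (n + k) - P n) \<le> M * q ^ n / (1 - q)" for n k
  proof -
    have "nrm E (P (n + k) - P n) \<le> (\<Sum>i<k. M * q ^ (n + i))" for k
    proof (induction k)
      case (Suc k)
      have eq: "P (n + Suc k) - P n = (P (n + k) - P n) + (a (n + k) - a (Suc (n + k)))"
        by (simp add: P_def)
      have "nrm E (P (n + Suc k) - P n) \<le> nrm E (P (n + k) - P n) + M * q ^ (n + k)"
        unfolding eq
        using nrm_add[OF E car_diff[OF E P P] step, of "n + k" n "n + k"] bound[of "n + k"] by linarith
      then show ?case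
        using Suc.IH by simp
    qed (simp add: nrm_0[OF E])
    also have "(\<Sum>i<k. M * q ^ (n + i)) = M * q ^ n * (\<Sum>i<k. q ^ i)"
      by (simp add: sum_distrib_left power_add mult.assoc)
    also have "(\<Sum>i<k. q ^ i) \<le> 1 / (1 - q)"
      using q by (simp add: sum_gp_strict divide_right_mono)
    finally show ?thesis
      using M q by (simp add: mult_left_mono)
  qed
  have "MCauchy P"
    unfolding MCauchy_def
  proof (intro conjI strip)
    show "range P \<subseteq> car E"
      using P by blast
    fix \<epsilon> :: real assume "\<epsilon> > 0"
    have "(\<lambda>n. M * q ^ n / (1 - q)) \<longlonglongrightarrow> M * 0 / (1 - q)"
      using q by (intro tendsto_intros LIMSEQ_power_zero) auto
    then have "eventually (\<lambda>n. M * q ^ n / (1 - q) < \<epsilon>) sequentially"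
      using \<open>\<epsilon> > 0\<close> by (intro order_tendstoD(2)) auto
    then obtain N where N: "\<And>n. n \<ge> N \<Longrightarrow> M * q ^ n / (1 - q) < \<epsilon>"
      by (auto simp: eventually_sequentially)
    have "ndist E (P n) (P n') < \<epsilon>" if "N \<le> n" "n \<le> n'" for n n'
      using N[OF that(1)] tail[of n "n' - n"] that(2) nrm_commute[OF E P P, of n n']
      by (simp add: ndist_def P)
    then show "\<exists>N. \<forall>n n'. N \<le> n \<longrightarrow> N \<le> n' \<longrightarrow> ndist E (P n) (P n') < \<epsilon>"
      using commute by (metis nle_le)
  qed
  then obtain l where "limitin mtopology P l sequentially"
    using compl mcomplete_def by blast
  then have l: "l \<in> car E" and lim: "\<And>\<epsilon>. \<epsilon> > 0 \<Longrightarrow> \<exists>N. \<forall>n\<ge>N. ndist E (P n) l < \<epsilon>"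
    unfolding limit_metric_sequentially by blast+
  have Pl: "(\<lambda>n. nrm E (P n - l)) \<longlonglongrightarrow> 0"
    using lim by (simp add: LIMSEQ_iff ndist_def P l nrm_nonneg[OF E car_diff[OF E P l]])
  have l': "l \<in> car E'"
    using l sub by blast
  have "nrm E' (a 0 - l) \<le> nrm E' (a n) + c * nrm E (P n - l)" for n
  proof -
    have "nrm E' (a 0 - l) \<le> nrm E' (a n) + nrm E' (P n - l)"
      using nrm_add[OF E' a, of "P n - l" n] car_diff[OF E P l] sub by (force simp: P_def)
    then show ?thesis
      using emb[OF car_diff[OF E P l], of n] by linarith
  qed
  moreover have "(\<lambda>n. nrm E' (a n) + c * nrm E (P n - l)) \<longlonglongrightarrow> 0 + c * 0"
    by (intro tendsto_intros a0 Pl)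
  ultimately have "nrm E' (a 0 - l) \<le> 0 + c * 0"
    by (intro LIMSEQ_le_const[where X = "\<lambda>n. nrm E' (a n) + c * nrm E (P n - l)"]) auto
  then have eq: "a 0 = l"
    using nrm_eq_0[OF E' car_diff[OF E' a[of 0] l']] nrm_nonneg[OF E' car_diff[OF E' a[of 0] l']]
    by simp
  have "nrm E l \<le> nrm E (P n - l) + M / (1 - q)" for n
  proof -
    have "nrm E l \<le> nrm E (l - P n) + nrm E (P n)"
      using nrm_add[OF E car_diff[OF E l P] P, of n n] by simp
    moreover have "nrm E (P n) \<le> M / (1 - q)"
      using tail[of 0 n] by (simp add: P_def)
    ultimately show ?thesis
      using nrm_commute[OF E P l] by simp
  qed
  moreover have "(\<lambda>n. nrm E (P n - l) + M / (1 - q)) \<longlonglongrightarrow> 0 + M / (1 - q)"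
    by (intro tendsto_intros Pl)
  ultimately have "nrm E l \<le> 0 + M / (1 - q)"
    by (intro LIMSEQ_le_const[where X = "\<lambda>n. nrm E (P n - l) + M / (1 - q)"]) auto
  then show ?thesis
    using l eq by simp
qed

section \<open>Differentiable maps between normed subspaces\<close>

text \<open>
  Having slope at most \<open>K + \<epsilon>\<close> is inherited from two adjacent intervals by their union, and it
  holds on small intervals around each point by differentiability.  Bisection then gives it on the
  whole interval, without any integration of vector valued functions.
\<close>

lemma mean_value_nspace:
  fixes \<phi> :: "real \<Rightarrow> 'b::real_vector"
  assumes E: "normed_nspace E" and \<phi>: "\<And>r. r \<in> {0..1} \<Longrightarrow> \<phi> r \<in> car E"
    and \<phi>': "\<And>r. r \<in> {0..1} \<Longrightarrow> \<phi>' r \<in> car E" "\<And>r. r \<in> {0..1} \<Longrightarrow> nrm E (\<phi>' r) \<le> K"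
    and deriv: "\<And>r \<epsilon>. r \<in> {0..1} \<Longrightarrow> \<epsilon> > 0 \<Longrightarrow> \<exists>d>0. \<forall>r'\<in>{0..1}. \<bar>r' - r\<bar> < d \<longrightarrow>
      nrm E (\<phi> r' - \<phi> r - (r' - r) *\<^sub>R \<phi>' r) \<le> \<epsilon> * \<bar>r' - r\<bar>"
  shows "nrm E (\<phi> 1 - \<phi> 0) \<le> K"
proof (rule field_le_epsilon)
  fix \<epsilon> :: real assume "\<epsilon> > 0"
  define P where "P a b \<longleftrightarrow> (0 \<le> a \<and> b \<le> 1 \<longrightarrow> nrm E (\<phi> b - \<phi> a) \<le> (K + \<epsilon>) * (b - a))" for a b
  have "P 0 1"
  proof (rule Bolzano)
    show "(0::real) \<le> 1"
      by simp
  next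
    fix a b c assume P: "P a b" "P b c" and le: "a \<le> b" "b \<le> c"
    show "P a c"
      unfolding P_def
    proof
      assume ac: "0 \<le> a \<and> c \<le> 1"
      have "nrm E (\<phi> c - \<phi> a) \<le> nrm E (\<phi> c - \<phi> b) + nrm E (\<phi> b - \<phi> a)"
        using ac le by (intro nrm_triangle[OF E] \<phi>) auto
      also have "\<dots> \<le> (K + \<epsilon>) * (c - b) + (K + \<epsilon>) * (b - a)"
        using P ac le by (intro add_mono) (auto simp: P_def)
      finally show "nrm E (\<phi> c - \<phi> a) \<le> (K + \<epsilon>) * (c - a)"
        by (simp add: algebra_simps)
    qed
  next
    fix x :: real assume x: "0 \<le> x" "x \<le> 1"
    obtain d where "d > 0" and
      d: "\<And>r'. r' \<in> {0..1} \<Longrightarrow> \<bar>r' - x\<bar> < d \<Longrightarrow>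
        nrm E (\<phi> r' - \<phi> x - (r' - x) *\<^sub>R \<phi>' x) \<le> \<epsilon> * \<bar>r' - x\<bar>"
      using deriv[of x \<epsilon>] x \<open>\<epsilon> > 0\<close> by auto
    have near: "nrm E (\<phi> r' - \<phi> x) \<le> (K + \<epsilon>) * \<bar>r' - x\<bar>" if r': "r' \<in> {0..1}" "\<bar>r' - x\<bar> < d" for r'
    proof -
      have m: "\<phi> r' - \<phi> x \<in> car E" "(r' - x) *\<^sub>R \<phi>' x \<in> car E"
        using r' x by (auto intro!: car_diff[OF E] car_scaleR[OF E] \<phi> \<phi>')
      have "nrm E (\<phi> r' - \<phi> x)
          \<le> nrm E (\<phi> r' - \<phi> x - (r' - x) *\<^sub>R \<phi>' x) + nrm E ((r' - x) *\<^sub>R \<phi>' x)"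
        using nrm_add[OF E car_diff[OF E m] m(2)] by simp
      also have "nrm E ((r' - x) *\<^sub>R \<phi>' x) \<le> \<bar>r' - x\<bar> * K"
        using x by (simp add: nrm_scaleR[OF E] \<phi>' mult_left_mono)
      finally show ?thesis
        using d[OF r'] by (simp add: algebra_simps)
    qed
    have "P a b" if "a \<le> x" "x \<le> b" "b - a < d" for a b
      unfolding P_def
    proof
      assume ab: "0 \<le> a \<and> b \<le> 1"
      have "nrm E (\<phi> b - \<phi> a) \<le> nrm E (\<phi> b - \<phi> x) + nrm E (\<phi> x - \<phi> a)"
        using ab that x by (intro nrm_triangle[OF E] \<phi>) auto
      also have "nrm E (\<phi> x - \<phi> a) = nrm E (\<phi> a - \<phi> x)"
        using ab that x by (intro nrm_commute[OF E] \<phi>) auto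
      also have "nrm E (\<phi> b - \<phi> x) + nrm E (\<phi> a - \<phi> x) \<le> (K + \<epsilon>) * (b - x) + (K + \<epsilon>) * (x - a)"
        using near[of a] near[of b] ab that x by (intro add_mono) auto
      finally show "nrm E (\<phi> b - \<phi> a) \<le> (K + \<epsilon>) * (b - a)"
        by (simp add: algebra_simps)
    qed
    then show "\<exists>d>0. \<forall>a b. a \<le> x \<and> x \<le> b \<and> b - a < d \<longrightarrow> P a b"
      using \<open>d > 0\<close> by blast
  qed
  then show "nrm E (\<phi> 1 - \<phi> 0) \<le> K + \<epsilon>"
    by (simp add: P_def)
qed

lemma bounded_linear_betweenD:
  assumes "bounded_linear_between E E' L" "x \<in> car E"
  shows "L x \<in> car E'" "y \<in> car E \<Longrightarrow> L (x + y) = L x + L y" "L (c *\<^sub>R x) = c *\<^sub>R L x"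
  using assms by (auto simp: bounded_linear_between_def)

lemma linear_between_diff:
  assumes "bounded_linear_between E E' L" "normed_nspace E" "x \<in> car E" "y \<in> car E"
  shows "L (x - y) = L x - L y"
  using bounded_linear_betweenD(2)[OF assms(1) car_diff[OF assms(2-4)] assms(4)] by simp

lemma linear_between_0:
  assumes "bounded_linear_between E E' L" "normed_nspace E"
  shows "L 0 = 0"
  using linear_between_diff[OF assms, of 0 0] car_zero[OF assms(2)] by simp

lemma linear_between_sum:
  assumes "bounded_linear_between E E' L" "normed_nspace E" "\<And>i. i \<in> A \<Longrightarrow> f i \<in> car E"
  shows "L (sum f A) = (\<Sum>i\<in>A. L (f i))"
  using assms(3)
proof (induction A rule: infinite_finite_induct)
  case (insert i A)
  then show ?case
    using bounded_linear_betweenD(2)[OF assms(1), of "f i" "sum f A"] car_sum[OF assms(2), of A f]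
    by simp
qed (simp_all add: linear_between_0[OF assms(1,2)])

text \<open>
  The constant \<open>c\<close> makes this serve both as a Lipschitz estimate (\<open>c = 0\<close>) and as a Taylor estimate,
  where \<open>c\<close> is the expected first order term.
\<close>

lemma frechet_mean_value:
  assumes E: "normed_nspace E" and E': "normed_nspace E'"
    and f: "\<And>z. z \<in> car E \<Longrightarrow> f z \<in> car E'"
    and f': "\<And>z. z \<in> car E \<Longrightarrow> has_frechet_derivative E E' f (f' z) z"
    and x: "x \<in> car E" and h: "h \<in> car E" and c: "c \<in> car E'"
    and K: "\<And>r. r \<in> {0..1} \<Longrightarrow> nrm E' (f' (x + r *\<^sub>R h) h - c) \<le> K"
  shows "nrm E' (f (x + h) - f x - c) \<le> K"
proof -
  define z where "z r = x + r *\<^sub>R h" for r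
  have z: "z r \<in> car E" for r
    using x h by (simp add: z_def car_add[OF E] car_scaleR[OF E])
  have lin: "bounded_linear_between E E' (f' (z r))" for r
    using f'[OF z] by (simp add: has_frechet_derivative_def)
  define \<phi> where "\<phi> r = f (z r) - r *\<^sub>R c" for r
  have "nrm E' (\<phi> 1 - \<phi> 0) \<le> K"
  proof (rule mean_value_nspace[OF E', where \<phi>' = "\<lambda>r. f' (z r) h - c"])
    show "\<phi> r \<in> car E'" for r
      by (simp add: \<phi>_def f z c car_diff[OF E'] car_scaleR[OF E'])
    show "f' (z r) h - c \<in> car E'" for r
      by (intro car_diff[OF E'] c bounded_linear_betweenD(1)[OF lin h])
    show "nrm E' (f' (z r) h - c) \<le> K" if "r \<in> {0..1}" for r
      using K[OF that] by (simp add: z_def)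
    fix r \<epsilon> :: real assume "\<epsilon> > 0"
    define \<epsilon>' where "\<epsilon>' = \<epsilon> / (1 + nrm E h)"
    have h0: "nrm E h \<ge> 0"
      by (rule nrm_nonneg[OF E h])
    have "\<epsilon>' > 0"
      using \<open>\<epsilon> > 0\<close> h0 by (simp add: \<epsilon>'_def)
    then obtain d where "d > 0" and d: "\<And>k. k \<in> car E \<Longrightarrow> nrm E k < d \<Longrightarrow>
        nrm E' (f (z r + k) - f (z r) - f' (z r) k) \<le> \<epsilon>' * nrm E k"
      using f'[OF z, of r] by (auto simp: has_frechet_derivative_def)
    have "nrm E' (\<phi> r' - \<phi> r - (r' - r) *\<^sub>R (f' (z r) h - c)) \<le> \<epsilon> * \<bar>r' - r\<bar>"
      if "\<bar>r' - r\<bar> < d / (1 + nrm E h)" for r'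
    proof -
      have "\<bar>r' - r\<bar> * nrm E h \<le> \<bar>r' - r\<bar> * (1 + nrm E h)"
        by (simp add: mult_left_mono)
      also have "\<dots> < d"
        using that h0 by (simp add: pos_less_divide_eq)
      finally have small: "nrm E ((r' - r) *\<^sub>R h) < d"
        by (simp add: nrm_scaleR[OF E h])
      have eq: "\<phi> r' - \<phi> r - (r' - r) *\<^sub>R (f' (z r) h - c)
          = f (z r + (r' - r) *\<^sub>R h) - f (z r) - f' (z r) ((r' - r) *\<^sub>R h)"
        unfolding bounded_linear_betweenD(3)[OF lin h] by (simp add: \<phi>_def z_def algebra_simps)
      have "nrm E' (\<phi> r' - \<phi> r - (r' - r) *\<^sub>R (f' (z r) h - c)) \<le> \<epsilon>' * (\<bar>r' - r\<bar> * nrm E h)"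
        using d[OF car_scaleR[OF E h] small] by (simp add: eq nrm_scaleR[OF E h])
      also have "\<dots> \<le> \<epsilon> * \<bar>r' - r\<bar>"
      proof -
        have "\<epsilon>' * nrm E h \<le> \<epsilon>' * (1 + nrm E h)"
          using \<open>\<epsilon>' > 0\<close> by (simp add: mult_left_mono)
        also have "\<dots> = \<epsilon>"
          using h0 by (simp add: \<epsilon>'_def)
        finally show ?thesis
          using mult_right_mono[of "\<epsilon>' * nrm E h" \<epsilon> "\<bar>r' - r\<bar>"] by (simp add: algebra_simps)
      qed
      finally show ?thesis .
    qed
    moreover have "d / (1 + nrm E h) > 0"
      using \<open>d > 0\<close> h0 by simp
    ultimately show "\<exists>d>0. \<forall>r'\<in>{0..1}. \<bar>r' - r\<bar> < d \<longrightarrow>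
        nrm E' (\<phi> r' - \<phi> r - (r' - r) *\<^sub>R (f' (z r) h - c)) \<le> \<epsilon> * \<bar>r' - r\<bar>"
      by blast
  qed
  then show ?thesis
    by (simp add: \<phi>_def z_def algebra_simps)
qed

lemma frechet_lipschitz:
  assumes E: "normed_nspace E" and E': "normed_nspace E'"
    and f: "\<And>z. z \<in> car E \<Longrightarrow> f z \<in> car E'"
    and f': "\<And>z. z \<in> car E \<Longrightarrow> has_frechet_derivative E E' f (f' z) z"
    and M: "\<And>z h. z \<in> car E \<Longrightarrow> h \<in> car E \<Longrightarrow> nrm E' (f' z h) \<le> M * nrm E h"
    and x: "x \<in> car E" and y: "y \<in> car E"
  shows "nrm E' (f y - f x) \<le> M * nrm E (y - x)"
proof -
  have h: "y - x \<in> car E"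
    by (rule car_diff[OF E y x])
  have "nrm E' (f (x + (y - x)) - f x - 0) \<le> M * nrm E (y - x)"
    by (rule frechet_mean_value[OF E E' f f' x h])
      (auto simp: car_zero[OF E'] intro!: M car_add[OF E x] car_scaleR[OF E] h)
  then show ?thesis
    by simp
qed

text \<open>
  Seen from the largest of the spaces both derivatives are the directional derivative of \<open>f\<close>, so
  they agree on the smaller domain.  This is what connects \<open>DG\<close> on the different spaces of the scale.
\<close>

lemma frechet_derivative_unique:
  assumes E1: "normed_nspace E1" and E2: "normed_nspace E2"
    and E1': "normed_nspace E1'" and E2': "normed_nspace E2'"
    and sub: "car E1 \<subseteq> car E2" and sub': "car E1' \<subseteq> car E2'"
    and emb: "\<And>x. x \<in> car E1' \<Longrightarrow> nrm E2' x \<le> c * nrm E1' x"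
    and f: "\<And>z. z \<in> car E1 \<Longrightarrow> f z \<in> car E1'"
    and L1: "has_frechet_derivative E1 E1' f L1 x" and L2: "has_frechet_derivative E2 E2' f L2 x"
    and x: "x \<in> car E1" and h: "h \<in> car E1"
  shows "L1 h = L2 h"
proof -
  have lin1: "bounded_linear_between E1 E1' L1" and lin2: "bounded_linear_between E2 E2' L2"
    using L1 L2 by (simp_all add: has_frechet_derivative_def)
  have h2: "h \<in> car E2"
    using h sub by blast
  have L1h: "L1 h \<in> car E1'" and L2h: "L2 h \<in> car E2'"
    using bounded_linear_betweenD(1)[OF lin1 h] bounded_linear_betweenD(1)[OF lin2 h2] by auto
  have D: "L1 h - L2 h \<in> car E2'"
    using L1h L2h sub' by (intro car_diff[OF E2']) auto
  define n where "n = 1 + nrm E1 h + nrm E2 h"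
  have n: "n \<ge> 1" "nrm E1 h < n" "nrm E2 h < n"
    using nrm_nonneg[OF E1 h] nrm_nonneg[OF E2 h2] by (auto simp: n_def)
  have "nrm E2' (L1 h - L2 h) \<le> 0"
  proof (rule field_le_epsilon)
    fix \<epsilon> :: real assume "\<epsilon> > 0"
    define c' where "c' = 1 + \<bar>c\<bar>"
    define e where "e = \<epsilon> / (c' * n + n)"
    have c': "c' > 0"
      by (simp add: c'_def)
    have "e > 0"
      using \<open>\<epsilon> > 0\<close> n c' by (simp add: e_def add_pos_pos)
    obtain d1 where "d1 > 0" and d1: "\<And>k. k \<in> car E1 \<Longrightarrow> nrm E1 k < d1 \<Longrightarrow>
        nrm E1' (f (x + k) - f x - L1 k) \<le> e * nrm E1 k"
      using L1 \<open>e > 0\<close> by (auto simp: has_frechet_derivative_def)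
    obtain d2 where "d2 > 0" and d2: "\<And>k. k \<in> car E2 \<Longrightarrow> nrm E2 k < d2 \<Longrightarrow>
        nrm E2' (f (x + k) - f x - L2 k) \<le> e * nrm E2 k"
      using L2 \<open>e > 0\<close> by (auto simp: has_frechet_derivative_def)
    \<comment> \<open>The scale \<open>s\<close> makes both error bounds applicable to \<open>s *\<^sub>R h\<close>.\<close>
    define s where "s = min d1 d2 / n"
    have s: "s > 0" "s * n \<le> d1" "s * n \<le> d2"
      using \<open>d1 > 0\<close> \<open>d2 > 0\<close> n by (auto simp: s_def)
    have s1: "s * nrm E1 h < s * n" and s2: "s * nrm E2 h < s * n"
      using s(1) n by auto
    define A where "A = f (x + s *\<^sub>R h) - f x - L1 (s *\<^sub>R h)"
    define R where "R = f (x + s *\<^sub>R h) - f x - L2 (s *\<^sub>R h)"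
    have A: "A \<in> car E1'"
      unfolding A_def using x h
      by (intro car_diff[OF E1'] f bounded_linear_betweenD(1)[OF lin1] car_add[OF E1] car_scaleR[OF E1])
    have "f (x + s *\<^sub>R h) \<in> car E2'" "f x \<in> car E2'"
      using f x h sub' car_add[OF E1] car_scaleR[OF E1] by blast+
    then have R: "R \<in> car E2'"
      unfolding R_def using h2
      by (intro car_diff[OF E2'] bounded_linear_betweenD(1)[OF lin2] car_scaleR[OF E2])
    have A2: "A \<in> car E2'"
      using A sub' by blast
    have "nrm E1' A \<le> e * (s * nrm E1 h)"
      using d1[OF car_scaleR[OF E1 h], of s] s s1 by (simp add: A_def nrm_scaleR[OF E1 h])
    also have "\<dots> \<le> e * (s * n)"
      using s1 \<open>e > 0\<close> by simp
    finally have nA1: "nrm E1' A \<le> e * (s * n)" .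
    have "nrm E2' A \<le> c * nrm E1' A"
      by (rule emb[OF A])
    also have "\<dots> \<le> c' * nrm E1' A"
      using nrm_nonneg[OF E1' A] by (intro mult_right_mono) (auto simp: c'_def)
    also have "\<dots> \<le> c' * (e * (s * n))"
      using nA1 c' by simp
    finally have nA: "nrm E2' A \<le> c' * (e * (s * n))" .
    have "nrm E2' R \<le> e * (s * nrm E2 h)"
      using d2[OF car_scaleR[OF E2 h2], of s] s s2 by (simp add: R_def nrm_scaleR[OF E2 h2])
    also have "\<dots> \<le> e * (s * n)"
      using s2 \<open>e > 0\<close> by simp
    finally have nR: "nrm E2' R \<le> e * (s * n)" .
    have "R - A = s *\<^sub>R (L1 h - L2 h)"
      by (simp add: A_def R_def bounded_linear_betweenD(3)[OF lin1 h]
          bounded_linear_betweenD(3)[OF lin2 h2] algebra_simps)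
    then have "s * nrm E2' (L1 h - L2 h) = nrm E2' (R - A)"
      using s by (simp add: nrm_scaleR[OF E2' D])
    also have "\<dots> \<le> e * (s * n) + c' * (e * (s * n))"
      using nrm_diff[OF E2' R A2] nA nR by linarith
    also have "\<dots> = s * (e * (c' * n + n))"
      by (simp add: algebra_simps)
    also have "e * (c' * n + n) = \<epsilon>"
      using n c' by (simp add: e_def add_pos_pos pos_add_strict less_imp_neq[symmetric])
    finally show "nrm E2' (L1 h - L2 h) \<le> 0 + \<epsilon>"
      using s by simp
  qed
  then show ?thesis
    using nrm_eq_0[OF E2' D] nrm_nonneg[OF E2' D] by simp
qed

lemma frechet_deriv_eq:
  assumes E: "normed_nspace E" and E': "normed_nspace E'"
    and f: "\<And>z. z \<in> car E \<Longrightarrow> f z \<in> car E'"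
    and L: "has_frechet_derivative E E' f L x" and x: "x \<in> car E" and h: "h \<in> car E"
  shows "frechet_deriv E E' f x h = L h"
proof -
  have "has_frechet_derivative E E' f (frechet_deriv E E' f x) x"
    unfolding frechet_deriv_def using L
    by (rule someI[where P = "\<lambda>L. has_frechet_derivative E E' f L x"])
  then show ?thesis
    using frechet_derivative_unique[OF E E E' E' _ _ _ f _ L x h, of 1] by simp
qed

lemma Ck_bounded_frechet:
  assumes "Ck_bounded_derivatives k E E' f" "0 < k" and E: "normed_nspace E"
  obtains f' M where "\<And>x. x \<in> car E \<Longrightarrow> f x \<in> car E'" "0 \<le> M"
    "\<And>x. x \<in> car E \<Longrightarrow> has_frechet_derivative E E' f (f' x) x"
    "\<And>x h. x \<in> car E \<Longrightarrow> h \<in> car E \<Longrightarrow> nrm E' (f' x h) \<le> M * nrm E h"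
proof -
  obtain D where D: "Ck_derivatives k E E' f D" and
    bdd: "\<exists>M. \<forall>x\<in>car E. \<forall>hs\<in>tuples 1 E. nrm E' (D 1 x hs) \<le> M * prod_list (map (nrm E) hs)"
    using assms unfolding Ck_bounded_derivatives_def
    by (metis One_nat_def Suc_leI atLeastAtMost_iff order_refl)
  have D0: "D 0 x [] = f x" and ml: "multilinear_between 1 E E' (D 1 x)"
    and ml0: "multilinear_between 0 E E' (D 0 x)" if "x \<in> car E" for x
    using D assms(2) that by (auto simp: Ck_derivatives_def)
  have ders: "\<forall>j<k. \<forall>x\<in>car E. \<forall>\<epsilon>>0. \<exists>d>0. \<forall>h\<in>car E. nrm E h < d \<longrightarrow>
        (\<forall>hs\<in>tuples j E. nrm E' (D j (x + h) hs - D j x hs - D (Suc j) x (h # hs))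
                            \<le> \<epsilon> * nrm E h * prod_list (map (nrm E) hs))"
    using D by (simp add: Ck_derivatives_def)
  have one: "[h] \<in> tuples 1 E" if "h \<in> car E" for h
    using that by (simp add: tuples_def)
  have zero: "[] \<in> tuples 0 E"
    by (simp add: tuples_def)
  obtain M where M: "\<And>x h. x \<in> car E \<Longrightarrow> h \<in> car E \<Longrightarrow> nrm E' (D 1 x [h]) \<le> M * nrm E h"
    using bdd one by fastforce
  have fmap: "f x \<in> car E'" if "x \<in> car E" for x
    using ml0[OF that] D0[OF that] zero by (auto simp: multilinear_between_def)
  have "has_frechet_derivative E E' f (\<lambda>h. D 1 x [h]) x" if x: "x \<in> car E" for x
    unfolding has_frechet_derivative_def
  proof (intro conjI strip)
    show "bounded_linear_between E E' (\<lambda>h. D 1 x [h])"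
      unfolding bounded_linear_between_def
    proof (intro conjI ballI allI)
      fix h assume h: "h \<in> car E"
      show "D 1 x [h] \<in> car E'"
        using ml[OF x] one[OF h] by (simp add: multilinear_between_def)
      have "\<forall>i<1. \<forall>x'\<in>car E. \<forall>y\<in>car E. D 1 x ([h][i := x' + y]) = D 1 x ([h][i := x']) + D 1 x ([h][i := y])"
        using ml[OF x] one[OF h] unfolding multilinear_between_def by blast
      then show "D 1 x [h + h'] = D 1 x [h] + D 1 x [h']" if "h' \<in> car E" for h'
        using h that by simp
      have "\<forall>i<1. \<forall>x'\<in>car E. \<forall>c. D 1 x ([h][i := c *\<^sub>R x']) = c *\<^sub>R D 1 x ([h][i := x'])"
        using ml[OF x] one[OF h] unfolding multilinear_between_def by blast
      then show "D 1 x [c *\<^sub>R h] = c *\<^sub>R D 1 x [h]" for c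
        using h by simp
    next
      show "\<exists>M. \<forall>h\<in>car E. nrm E' (D 1 x [h]) \<le> M * nrm E h"
        using M[OF x] by blast
    qed
  next
    fix \<epsilon> :: real assume "\<epsilon> > 0"
    then obtain d where "d > 0" and d: "\<And>h. h \<in> car E \<Longrightarrow> nrm E h < d \<Longrightarrow>
        nrm E' (D 0 (x + h) [] - D 0 x [] - D 1 x [h]) \<le> \<epsilon> * nrm E h"
      using ders[rule_format, of 0 x \<epsilon>] assms(2) x zero by force
    have "nrm E' (f (x + h) - f x - D 1 x [h]) \<le> \<epsilon> * nrm E h" if "h \<in> car E" "nrm E h < d" for h
      using d[OF that] D0[OF x] D0[OF car_add[OF E x that(1)]] by simp
    then show "\<exists>d>0. \<forall>h\<in>car E. nrm E h < d \<longrightarrow> nrm E' (f (x + h) - f x - D 1 x [h]) \<le> \<epsilon> * nrm E h"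
      using \<open>d > 0\<close> by blast
  qed
  moreover have "nrm E' (D 1 x [h]) \<le> max 0 M * nrm E h" if "x \<in> car E" "h \<in> car E" for x h
    using M[OF that] mult_right_mono[OF max.cobounded2[of M 0] nrm_nonneg[OF E that(2)]] by linarith
  ultimately show thesis
    using that[of "max 0 M" "\<lambda>x h. D 1 x [h]"] fmap by auto
qed

section \<open>Smoothing semigroups on a scale of spaces\<close>

locale smoothing_scale =
  fixes B :: "real \<Rightarrow> 'b::real_vector nspace"
    and domA :: "real \<Rightarrow> 'b set" and A :: "'b \<Rightarrow> 'b" and S :: "real \<Rightarrow> 'b \<Rightarrow> 'b"
  assumes scale: "interpolation_scale B" and semigroup: "scale_semigroup B domA A S"
begin

lemma nsp: "normed_nspace (B \<theta>)" and mcomplete: "Metric_space.mcomplete (car (B \<theta>)) (ndist (B \<theta>))"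
  using scale by (auto simp: interpolation_scale_def separable_banach_def)

lemmas ns_zero [simp, intro] = car_zero[OF nsp]
  and ns_add [simp, intro] = car_add[OF nsp]
  and ns_diff [simp, intro] = car_diff[OF nsp]
  and ns_scaleR [simp, intro] = car_scaleR[OF nsp]
  and ns_nonneg [simp] = nrm_nonneg[OF nsp]

lemma scale_subset: "\<theta> \<le> \<theta>' \<Longrightarrow> car (B \<theta>') \<subseteq> car (B \<theta>)"
  using scale by (auto simp: interpolation_scale_def)

lemma scale_mem: "x \<in> car (B \<theta>') \<Longrightarrow> \<theta> \<le> \<theta>' \<Longrightarrow> x \<in> car (B \<theta>)"
  using scale_subset by blast

lemma scale_embedding:
  assumes "\<theta> \<le> \<theta>'"
  shows "\<exists>C>0. \<forall>x\<in>car (B \<theta>'). nrm (B \<theta>) x \<le> C * nrm (B \<theta>') x"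
  using assms scale
  by (intro continuous_inclusion_bounded[OF nsp nsp]) (auto simp: interpolation_scale_def)

lemma S_linear: "0 \<le> t \<Longrightarrow> bounded_linear_between (B \<theta>) (B \<theta>) (S t)"
  and S_0: "x \<in> car (B \<theta>) \<Longrightarrow> S 0 x = x"
  and S_plus: "0 \<le> s \<Longrightarrow> 0 \<le> t \<Longrightarrow> x \<in> car (B \<theta>) \<Longrightarrow> S (s + t) x = S s (S t x)"
  using semigroup by (auto simp: scale_semigroup_def analytic_semigroup_def c0_semigroup_def)

lemma S_mem [simp, intro]: "0 \<le> t \<Longrightarrow> x \<in> car (B \<theta>) \<Longrightarrow> S t x \<in> car (B \<theta>)"
  using bounded_linear_betweenD(1)[OF S_linear] .

lemma S_add: "0 \<le> t \<Longrightarrow> x \<in> car (B \<theta>) \<Longrightarrow> y \<in> car (B \<theta>) \<Longrightarrow> S t (x + y) = S t x + S t y"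
  using bounded_linear_betweenD(2)[OF S_linear] .

lemma S_diff: "0 \<le> t \<Longrightarrow> x \<in> car (B \<theta>) \<Longrightarrow> y \<in> car (B \<theta>) \<Longrightarrow> S t (x - y) = S t x - S t y"
  using linear_between_diff[OF S_linear nsp] .

lemma S_scaleR: "0 \<le> t \<Longrightarrow> x \<in> car (B \<theta>) \<Longrightarrow> S t (c *\<^sub>R x) = c *\<^sub>R S t x"
  using bounded_linear_betweenD(3)[OF S_linear] .

lemma S_sum:
  assumes "0 \<le> t" "\<And>i. i \<in> I \<Longrightarrow> f i \<in> car (B \<theta>)"
  shows "S t (sum f I) = (\<Sum>i\<in>I. S t (f i))"
  using linear_between_sum[OF S_linear[OF assms(1)] nsp assms(2)] .

lemma S_comp: "0 \<le> s \<Longrightarrow> 0 \<le> t \<Longrightarrow> s + t = r \<Longrightarrow> x \<in> car (B \<theta>) \<Longrightarrow> S s (S t x) = S r x"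
  using S_plus by auto

lemma S_minus_id_bound:
  assumes "0 \<le> e" "e \<le> 1" "0 < T"
  shows "\<exists>C>0. \<forall>t\<in>{0<..T}. \<forall>x\<in>car (B (\<theta> + e)).
    nrm (B \<theta>) (S t x - x) \<le> C * t powr e * nrm (B (\<theta> + e)) x"
proof -
  obtain C where C: "\<And>t x. t \<in> {0<..T} \<Longrightarrow> x \<in> car (B (\<theta> + e)) \<Longrightarrow>
      nrm (B \<theta>) (S t x - x) \<le> C * t powr e * nrm (B (\<theta> + e)) x"
    using semigroup assms unfolding scale_semigroup_def smoothing_def by metis
  have "nrm (B \<theta>) (S t x - x) \<le> (1 + \<bar>C\<bar>) * t powr e * nrm (B (\<theta> + e)) x"
    if "t \<in> {0<..T}" "x \<in> car (B (\<theta> + e))" for t x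
  proof -
    have "C * (t powr e * nrm (B (\<theta> + e)) x) \<le> (1 + \<bar>C\<bar>) * (t powr e * nrm (B (\<theta> + e)) x)"
      using that by (intro mult_right_mono) auto
    then show ?thesis
      using C[OF that] by (simp add: mult.assoc)
  qed
  then show ?thesis
    by (intro exI[of _ "1 + \<bar>C\<bar>"]) auto
qed

lemma S_smoothing_1:
  assumes "0 \<le> e" "e \<le> 1" "0 < T"
  shows "\<exists>C>0. \<forall>t\<in>{0<..T}. \<forall>x\<in>car (B \<theta>). S t x \<in> car (B (\<theta> + e)) \<and>
    nrm (B (\<theta> + e)) (S t x) \<le> C * t powr (- e) * nrm (B \<theta>) x"
proof -
  obtain C where mem: "\<And>t x. t \<in> {0<..T} \<Longrightarrow> x \<in> car (B \<theta>) \<Longrightarrow> S t x \<in> car (B (\<theta> + e))"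
    and C: "\<And>t x. t \<in> {0<..T} \<Longrightarrow> x \<in> car (B \<theta>) \<Longrightarrow>
      nrm (B (\<theta> + e)) (S t x) \<le> C * t powr (- e) * nrm (B \<theta>) x"
    using semigroup assms unfolding scale_semigroup_def smoothing_def by metis
  have "nrm (B (\<theta> + e)) (S t x) \<le> (1 + \<bar>C\<bar>) * t powr (- e) * nrm (B \<theta>) x"
    if "t \<in> {0<..T}" "x \<in> car (B \<theta>)" for t x
  proof -
    have "C * (t powr (- e) * nrm (B \<theta>) x) \<le> (1 + \<bar>C\<bar>) * (t powr (- e) * nrm (B \<theta>) x)"
      using that by (intro mult_right_mono) auto
    then show ?thesis
      using C[OF that] by (simp add: mult.assoc)
  qed
  then show ?thesis
    using mem by (intro exI[of _ "1 + \<bar>C\<bar>"]) auto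
qed

text \<open>
  Splitting \<open>S t\<close> into two half steps gains up to two units of regularity.  More than one is
  needed because the sewing error is first estimated in a space that is up to \<open>2 \<alpha> + \<sigma>\<close> below the target.
\<close>

lemma S_smoothing:
  assumes "0 \<le> e" "e \<le> 2" "0 < T"
  shows "\<exists>C>0. \<forall>t\<in>{0<..T}. \<forall>x\<in>car (B \<theta>). S t x \<in> car (B (\<theta> + e)) \<and>
    nrm (B (\<theta> + e)) (S t x) \<le> C * t powr (- e) * nrm (B \<theta>) x"
proof -
  have half: "0 \<le> e / 2" "e / 2 \<le> 1"
    using assms by auto
  obtain C1 where "C1 > 0" and C1: "\<And>t x. t \<in> {0<..T} \<Longrightarrow> x \<in> car (B \<theta>) \<Longrightarrow>
      S t x \<in> car (B (\<theta> + e / 2)) \<and> nrm (B (\<theta> + e / 2)) (S t x) \<le> C1 * t powr (- (e / 2)) * nrm (B \<theta>) x"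
    using S_smoothing_1[OF half assms(3)] by meson
  obtain C2 where "C2 > 0" and C2: "\<And>t x. t \<in> {0<..T} \<Longrightarrow> x \<in> car (B (\<theta> + e / 2)) \<Longrightarrow>
      S t x \<in> car (B (\<theta> + e / 2 + e / 2)) \<and>
      nrm (B (\<theta> + e / 2 + e / 2)) (S t x) \<le> C2 * t powr (- (e / 2)) * nrm (B (\<theta> + e / 2)) x"
    using S_smoothing_1[OF half assms(3), of "\<theta> + e / 2"] by meson
  have sum: "\<theta> + e / 2 + e / 2 = \<theta> + e"
    by simp
  have "S t x \<in> car (B (\<theta> + e)) \<and>
      nrm (B (\<theta> + e)) (S t x) \<le> (C1 * C2 * 2 powr e) * t powr (- e) * nrm (B \<theta>) x"
    if t: "t \<in> {0<..T}" and x: "x \<in> car (B \<theta>)" for t x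
  proof -
    have t2: "t / 2 \<in> {0<..T}"
      using t by auto
    have eq: "S t x = S (t / 2) (S (t / 2) x)"
      using S_plus[of "t / 2" "t / 2" x \<theta>] t x by simp
    have "nrm (B (\<theta> + e)) (S t x) \<le> C2 * (t / 2) powr (- (e / 2)) * nrm (B (\<theta> + e / 2)) (S (t / 2) x)"
      using C2[OF t2, of "S (t / 2) x"] C1[OF t2 x] by (simp add: eq sum)
    also have "\<dots> \<le> C2 * (t / 2) powr (- (e / 2)) * (C1 * (t / 2) powr (- (e / 2)) * nrm (B \<theta>) x)"
      using \<open>C2 > 0\<close> C1[OF t2 x] by (intro mult_left_mono) auto
    also have "\<dots> = C1 * C2 * ((t / 2) powr (- (e / 2)) * (t / 2) powr (- (e / 2))) * nrm (B \<theta>) x"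
      by (simp add: algebra_simps)
    also have "(t / 2) powr (- (e / 2)) * (t / 2) powr (- (e / 2)) = (t / 2) powr (- e)"
      by (simp flip: powr_add)
    also have "(t / 2) powr (- e) = 2 powr e * t powr (- e)"
      using t by (simp add: powr_divide powr_minus field_simps)
    finally show ?thesis
      using C2[OF t2, of "S (t / 2) x"] C1[OF t2 x] by (simp add: eq sum algebra_simps)
  qed
  moreover have "C1 * C2 * 2 powr e > 0"
    using \<open>C1 > 0\<close> \<open>C2 > 0\<close> by simp
  ultimately show ?thesis
    by blast
qed

lemma S_bounded:
  assumes "0 < T"
  shows "\<exists>C>0. \<forall>t\<in>{0..T}. \<forall>x\<in>car (B \<theta>). nrm (B \<theta>) (S t x) \<le> C * nrm (B \<theta>) x"
proof -
  obtain C where "C > 0" and C: "\<And>t x. t \<in> {0<..T} \<Longrightarrow> x \<in> car (B \<theta>) \<Longrightarrow>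
      nrm (B (\<theta> + 0)) (S t x) \<le> C * t powr (- 0) * nrm (B \<theta>) x"
    using S_smoothing[of 0 T \<theta>] assms by auto
  have "nrm (B \<theta>) (S t x) \<le> (1 + C) * nrm (B \<theta>) x" if "t \<in> {0..T}" "x \<in> car (B \<theta>)" for t x
  proof (cases "t = 0")
    case True
    then show ?thesis
      using that \<open>C > 0\<close> by (simp add: S_0 algebra_simps)
  next
    case False
    then have "nrm (B \<theta>) (S t x) \<le> C * nrm (B \<theta>) x"
      using C[of t x] that by simp
    also have "\<dots> \<le> (1 + C) * nrm (B \<theta>) x"
      using that by (intro mult_right_mono) auto
    finally show ?thesis .
  qed
  then show ?thesis
    using \<open>C > 0\<close> by (intro exI[of _ "1 + C"]) auto
qed

text \<open>
  The error of a local approximation on \<open>[s, t]\<close>, as a function of the left end point \<open>s\<close>: moving \<open>s\<close>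
  to the midpoint changes it by something to which the semigroup has been applied for the time
  that remains.
\<close>

definition halving_decay where
  "halving_decay \<theta> p K s\<^sub>0 t W \<longleftrightarrow>
    (\<forall>s\<in>{s\<^sub>0..<t}. W s \<in> car (B \<theta>) \<and> nrm (B \<theta>) (W s) \<le> K * (t - s) powr p \<and>
       (\<exists>g\<in>car (B \<theta>). W s = W ((s + t) / 2) + S ((t - s) / 2) g \<and>
          nrm (B \<theta>) g \<le> K * (t - s) powr p))"

text \<open>
  Iterating the halving writes \<open>W s\<^sub>0\<close> as a series of terms \<open>S (h / 2 ^ (n + 1)) g\<close> with \<open>h = t - s\<^sub>0\<close> and
  \<open>g\<close> of order \<open>(h / 2 ^ n) powr p\<close>.  Smoothing costs a factor \<open>(h / 2 ^ n) powr (- e)\<close> in each of them, and the series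
  still converges geometrically because \<open>e < p\<close>.  So decay of order \<open>p\<close> in a weak space is turned into
  decay of order \<open>p - e\<close> in the space that is better by \<open>e\<close>.
\<close>

lemma smoothing_gain:
  assumes e: "0 \<le> e" "e \<le> 2" "e < p" and T: "0 < T"
  shows "\<exists>C>0. \<forall>t\<in>{0..T}. \<forall>K\<ge>0. \<forall>s\<^sub>0\<in>{0..<t}. \<forall>W.
    halving_decay \<theta> p K s\<^sub>0 t W \<longrightarrow>
    W s\<^sub>0 \<in> car (B (\<theta> + e)) \<and> nrm (B (\<theta> + e)) (W s\<^sub>0) \<le> C * K * (t - s\<^sub>0) powr (p - e)"
proof -
  obtain C where "C > 0" and C: "\<And>t x. t \<in> {0<..T} \<Longrightarrow> x \<in> car (B \<theta>) \<Longrightarrow>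
      S t x \<in> car (B (\<theta> + e)) \<and> nrm (B (\<theta> + e)) (S t x) \<le> C * t powr (- e) * nrm (B \<theta>) x"
    using S_smoothing[OF e(1,2) T] by meson
  obtain c where "c > 0" and c: "\<And>x. x \<in> car (B (\<theta> + e)) \<Longrightarrow> nrm (B \<theta>) x \<le> c * nrm (B (\<theta> + e)) x"
    using scale_embedding[of \<theta> "\<theta> + e"] e by auto
  define q :: real where "q = 2 powr (e - p)"
  have q: "0 \<le> q" "q < 1"
    using e powr_less_mono[of "e - p" 0 2] by (auto simp: q_def)
  have "W s\<^sub>0 \<in> car (B (\<theta> + e)) \<and>
      nrm (B (\<theta> + e)) (W s\<^sub>0) \<le> (C * 2 powr e / (1 - q)) * K * (t - s\<^sub>0) powr (p - e)"
    if t: "t \<in> {0..T}" and K: "K \<ge> 0" and s\<^sub>0: "s\<^sub>0 \<in> {0..<t}"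
    and "halving_decay \<theta> p K s\<^sub>0 t W" for t K s\<^sub>0 W
  proof -
    note W = that(4)[unfolded halving_decay_def]
    define h where "h = t - s\<^sub>0"
    have h: "h > 0"
      using s\<^sub>0 by (simp add: h_def)
    define r where "r n = t - h / 2 ^ n" for n :: nat
    have r: "r n \<in> {s\<^sub>0..<t}" and tr: "t - r n = h / 2 ^ n" and pos: "h / 2 ^ n > 0" for n
    proof -
      have "h / 2 ^ n \<le> h / 1"
        using h by (intro divide_left_mono) auto
      then show "r n \<in> {s\<^sub>0..<t}"
        using h by (auto simp: r_def h_def)
    qed (use h in \<open>auto simp: r_def\<close>)
    have mid: "(r n + t) / 2 = r (Suc n)" for n
      by (simp add: r_def field_simps)
    have pw: "(h / 2 ^ n) powr a = h powr a * (2 powr (- a)) ^ n" for a and n :: nat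
    proof -
      have "(2 ^ n :: real) powr a = (2 powr a) ^ n"
        by (simp add: powr_powr mult.commute flip: powr_realpow)
      then show ?thesis
        using h by (simp add: powr_divide powr_minus) (simp add: power_inverse divide_inverse)
    qed
    have half_powr: "(x / 2) powr (- e) = 2 powr e * x powr (- e)" if "x > 0" for x :: real
      using that by (simp add: powr_divide powr_minus field_simps)
    define a where "a n = W (r n)" for n
    have step: "a n - a (Suc n) \<in> car (B (\<theta> + e)) \<and>
        nrm (B (\<theta> + e)) (a n - a (Suc n)) \<le> (C * 2 powr e * K * h powr (p - e)) * q ^ n" for n
    proof -
      obtain g where g: "g \<in> car (B \<theta>)" "a n = a (Suc n) + S (h / 2 ^ n / 2) g"
        and ng: "nrm (B \<theta>) g \<le> K * (h / 2 ^ n) powr p"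
        using W r[of n] unfolding a_def mid[symmetric] tr[symmetric] by blast
      have t': "h / 2 ^ n / 2 \<in> {0<..T}"
      proof -
        have "h / 2 ^ n \<le> t"
          using r[of n] tr[of n] s\<^sub>0 by auto
        then show ?thesis
          using pos[of n] t by auto
      qed
      have "nrm (B (\<theta> + e)) (S (h / 2 ^ n / 2) g) \<le> C * (h / 2 ^ n / 2) powr (- e) * nrm (B \<theta>) g"
        using C[OF t' g(1)] by blast
      also have "\<dots> \<le> C * (h / 2 ^ n / 2) powr (- e) * (K * (h / 2 ^ n) powr p)"
        using ng \<open>C > 0\<close> by (intro mult_left_mono) auto
      also have "(h / 2 ^ n / 2) powr (- e) = 2 powr e * (h / 2 ^ n) powr (- e)"
        by (rule half_powr[OF pos])
      also have "C * (2 powr e * (h / 2 ^ n) powr (- e)) * (K * (h / 2 ^ n) powr p)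
          = C * 2 powr e * K * (h / 2 ^ n) powr (p - e)"
        by (simp add: powr_diff powr_minus field_simps)
      also have "(h / 2 ^ n) powr (p - e) = h powr (p - e) * q ^ n"
        by (simp add: pw q_def)
      finally show ?thesis
        using C[OF t' g(1)] g(2) by (simp add: algebra_simps)
    qed
    have lim: "(\<lambda>n. nrm (B \<theta>) (a n)) \<longlonglongrightarrow> 0"
    proof (rule tendsto_sandwich)
      show "\<forall>\<^sub>F n in sequentially. 0 \<le> nrm (B \<theta>) (a n)"
        using W r unfolding a_def by (intro always_eventually) auto
      have "p > 0"
        using e by simp
      then have "(2::real) powr (- p) < 1"
        using powr_less_mono[of "- p" 0 2] by simp
      then have "(\<lambda>n. K * (h powr p * (2 powr (- p)) ^ n)) \<longlonglongrightarrow> K * (h powr p * 0)"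
        by (intro tendsto_intros LIMSEQ_power_zero) auto
      then show "(\<lambda>n. K * (h powr p * (2 powr (- p)) ^ n)) \<longlonglongrightarrow> 0"
        by simp
      show "\<forall>\<^sub>F n in sequentially. nrm (B \<theta>) (a n) \<le> K * (h powr p * (2 powr (- p)) ^ n)"
        using W r unfolding a_def by (intro always_eventually) (metis pw tr)
    qed auto
    have mem: "a n \<in> car (B \<theta>)" for n
      using W r by (auto simp: a_def)
    have "a 0 \<in> car (B (\<theta> + e)) \<and>
        nrm (B (\<theta> + e)) (a 0) \<le> C * 2 powr e * K * h powr (p - e) / (1 - q)"
    proof (rule limit_of_geometric_steps[OF nsp mcomplete nsp _ _ _ lim _ _ q])
      show "car (B (\<theta> + e)) \<subseteq> car (B \<theta>)"
        using e by (intro scale_subset) simp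
      show "nrm (B \<theta>) x \<le> c * nrm (B (\<theta> + e)) x" if "x \<in> car (B (\<theta> + e))" for x
        by (rule c[OF that])
    qed (use step mem in auto)
    moreover have "a 0 = W s\<^sub>0"
      by (simp add: a_def r_def h_def)
    ultimately show ?thesis
      by (simp add: h_def)
  qed
  moreover have "C * 2 powr e / (1 - q) > 0"
    using \<open>C > 0\<close> q by simp
  ultimately show ?thesis
    by blast
qed

end

section \<open>Sewing along dyadic partitions\<close>

definition grid :: "real \<Rightarrow> real \<Rightarrow> nat \<Rightarrow> nat \<Rightarrow> real" where
  "grid a b n i = a + (b - a) * (real i / real n)"

lemma grid_0 [simp]: "grid a b n 0 = a"
  by (simp add: grid_def)

lemma grid_last [simp]: "0 < n \<Longrightarrow> grid a b n n = b"
  by (simp add: grid_def)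

lemma grid_step: "0 < n \<Longrightarrow> grid a b n (Suc i) - grid a b n i = (b - a) / n"
  by (simp add: grid_def field_simps)

lemma grid_less: "a < b \<Longrightarrow> 0 < n \<Longrightarrow> i < j \<Longrightarrow> grid a b n i < grid a b n j"
  by (simp add: grid_def divide_strict_right_mono)

lemma grid_le: "a \<le> b \<Longrightarrow> i \<le> j \<Longrightarrow> grid a b n i \<le> grid a b n j"
  by (simp add: grid_def divide_right_mono mult_left_mono)

lemma grid_bounds:
  assumes "a \<le> b" "i \<le> n" "0 < n"
  shows "a \<le> grid a b n i" "grid a b n i \<le> b"
  using grid_le[OF assms(1), of 0 i n] grid_le[OF assms(1,2), of n] assms by auto

lemma grid_refine: "grid a b (2 * n) (2 * i) = grid a b n i"
  by (simp add: grid_def)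

text \<open>
  For \<open>a < b\<close> the cells of the grid are pairwise distinct, so a sum over the set of cells is a sum over
  their numbers.
\<close>

lemma uniform_division:
  assumes "a < b" "0 < n"
  defines "\<pi> \<equiv> (\<lambda>i. {grid a b n i..grid a b n (Suc i)}) ` {..<n}"
  shows "\<pi> division_of {a..b}"
    and "K \<in> \<pi> \<Longrightarrow> Sup K - Inf K = (b - a) / n"
    and "K \<in> \<pi> \<Longrightarrow> interior K \<noteq> {}"
    and "(\<Sum>K\<in>\<pi>. f (Inf K) (Sup K)) = (\<Sum>i<n. f (grid a b n i) (grid a b n (Suc i)))"
proof -
  let ?p = "grid a b n"
  have less: "?p i < ?p (Suc i)" for i
    using assms by (intro grid_less) auto
  have Inf: "Inf {?p i..?p (Suc i)} = ?p i" and Sup: "Sup {?p i..?p (Suc i)} = ?p (Suc i)" for i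
    using less[of i] by (auto intro: cInf_atLeastAtMost)
  have union: "(\<Union>i<k. {?p i..?p (Suc i)}) = (if k = 0 then {} else {a..?p k})" for k
  proof (induction k)
    case (Suc k)
    have "a \<le> ?p k"
      using grid_le[of a b 0 k n] assms by simp
    then show ?case
      using Suc less[of k] by (auto simp: lessThan_Suc ivl_disj_un_two_touch)
  qed simp
  show "\<pi> division_of {a..b}"
  proof (rule division_ofI)
    show "finite \<pi>"
      by (simp add: \<pi>_def)
    fix K assume "K \<in> \<pi>"
    then obtain i where i: "i < n" "K = {?p i..?p (Suc i)}"
      by (auto simp: \<pi>_def)
    show "K \<subseteq> {a..b}"
      using grid_bounds[of a b i n] grid_bounds[of a b "Suc i" n] i assms by auto
    show "K \<noteq> {}"
      using i less[of i] by auto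
    show "\<exists>c d. K = cbox c d"
      using i by auto
    fix K' assume "K' \<in> \<pi>" "K \<noteq> K'"
    then obtain j where j: "j < n" "K' = {?p j..?p (Suc j)}" "i \<noteq> j"
      using i by (auto simp: \<pi>_def)
    then consider "Suc i \<le> j" | "Suc j \<le> i"
      by linarith
    then show "interior K \<inter> interior K' = {}"
      using grid_le[of a b "Suc i" j n] grid_le[of a b "Suc j" i n] assms i j by cases auto
  next
    show "\<Union> \<pi> = {a..b}"
      using union[of n] assms by (simp add: \<pi>_def)
  qed
  show "Sup K - Inf K = (b - a) / n" if "K \<in> \<pi>"
    using that assms(2) by (auto simp: \<pi>_def Inf Sup grid_step)
  show "interior K \<noteq> {}" if "K \<in> \<pi>"
  proof -
    obtain i where "K = {?p i..?p (Suc i)}"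
      using \<open>K \<in> \<pi>\<close> by (auto simp: \<pi>_def)
    then show ?thesis
      using less[of i] by simp
  qed
  have "inj_on (\<lambda>i. {?p i..?p (Suc i)}) {..<n}"
  proof (rule inj_onI)
    fix i j assume "{?p i..?p (Suc i)} = {?p j..?p (Suc j)}"
    then have "?p i = ?p j"
      by (metis Inf)
    then show "i = j"
      using grid_less[OF assms(1,2), of i j] grid_less[OF assms(1,2), of j i]
      by (metis less_irrefl linorder_neqE_nat)
  qed
  then show "(\<Sum>K\<in>\<pi>. f (Inf K) (Sup K)) = (\<Sum>i<n. f (?p i) (?p (Suc i)))"
    by (simp add: \<pi>_def sum.reindex Inf Sup)
qed

definition grid_sum ::
    "(real \<Rightarrow> 'b \<Rightarrow> 'b::real_vector) \<Rightarrow> (real \<Rightarrow> real \<Rightarrow> 'b) \<Rightarrow> real \<Rightarrow> real \<Rightarrow> nat \<Rightarrow> 'b" where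
  "grid_sum S \<xi> s t n = (\<Sum>i<n. S (t - grid s t n i) (\<xi> (grid s t n i) (grid s t n (Suc i))))"

text \<open>
  The local approximation of the rough integral, often called its germ.
\<close>

definition compensated_increment ::
    "(real \<Rightarrow> real) \<Rightarrow> (real \<Rightarrow> real \<Rightarrow> real) \<Rightarrow> (real \<Rightarrow> 'b::real_vector) \<Rightarrow> (real \<Rightarrow> 'b) \<Rightarrow>
      real \<Rightarrow> real \<Rightarrow> 'b" where
  "compensated_increment X XX v v' u w = (X w - X u) *\<^sub>R v u + XX u w *\<^sub>R v' u"

lemma has_rough_integralD:
  assumes "has_rough_integral E S X XX v v' t J" "\<epsilon> > 0"
  shows "\<exists>d>0. \<forall>\<pi>. \<pi> division_of {0..t} \<and> (\<forall>K\<in>\<pi>. Sup K - Inf K < d) \<longrightarrow>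
    nrm E ((\<Sum>K\<in>\<pi>. S (t - Inf K) (compensated_increment X XX v v' (Inf K) (Sup K))) - J) < \<epsilon>"
  using assms by (simp add: has_rough_integral_def compensated_increment_def Let_def)

context smoothing_scale
begin

lemma grid_sum_mem:
  assumes "s < t" "0 < n" "\<And>u w. s \<le> u \<Longrightarrow> u \<le> w \<Longrightarrow> w \<le> t \<Longrightarrow> \<xi> u w \<in> car (B \<theta>)"
  shows "grid_sum S \<xi> s t n \<in> car (B \<theta>)"
  unfolding grid_sum_def
proof (rule car_sum[OF nsp])
  fix i assume "i \<in> {..<n}"
  then show "S (t - grid s t n i) (\<xi> (grid s t n i) (grid s t n (Suc i))) \<in> car (B \<theta>)"
    using assms grid_bounds[of s t i n] grid_bounds[of s t "Suc i" n] grid_le[of s t i "Suc i" n]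
    by (intro S_mem assms(3)) auto
qed

text \<open>
  The only cell of a partition of the degenerate interval contributes nothing.
\<close>

lemma rough_integral_0:
  assumes J: "has_rough_integral (B \<theta>) S X XX v v' 0 J" and XX: "XX 0 0 = 0"
  shows "J = 0"
proof -
  have mem: "J \<in> car (B \<theta>)"
    using J by (simp add: has_rough_integral_def)
  have "nrm (B \<theta>) J \<le> 0 + \<epsilon>" if \<epsilon>: "\<epsilon> > 0" for \<epsilon>
  proof -
    obtain d where "d > 0" and d: "\<And>\<pi>. \<pi> division_of {0..0} \<Longrightarrow> (\<forall>K\<in>\<pi>. Sup K - Inf K < d) \<Longrightarrow>
        nrm (B \<theta>) ((\<Sum>K\<in>\<pi>. S (0 - Inf K) (compensated_increment X XX v v' (Inf K) (Sup K))) - J) < \<epsilon>"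
      using has_rough_integralD[OF J \<epsilon>] by blast
    have "{{0::real}} division_of {0..0}"
      using division_of_self[of "0::real" 0] by simp
    from d[OF this] \<open>d > 0\<close> have "nrm (B \<theta>) (0 - J) < \<epsilon>"
      using XX linear_between_0[OF S_linear[OF order_refl] nsp[of \<theta>]]
      by (simp add: compensated_increment_def)
    then show ?thesis
      using nrm_commute[OF nsp mem ns_zero] by simp
  qed
  then have "nrm (B \<theta>) J \<le> 0"
    by (rule field_le_epsilon)
  then show ?thesis
    using nrm_eq_0[OF nsp mem] ns_nonneg[OF mem] by simp
qed

text \<open>
  A partition of \<open>[0, s]\<close> together with one of \<open>[s, t]\<close> partitions \<open>[0, t]\<close>, and \<open>S (t - u)\<close> factors
  through \<open>S (t - s)\<close> for \<open>u \<le> s\<close>.  Hence the sums over \<open>[s, t]\<close> alone converge to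
  \<open>Jt - S (t - s) Js\<close>, the part of the convolution that has accumulated since time \<open>s\<close>.
\<close>

lemma rough_integral_grid_sum:
  fixes v v' :: "real \<Rightarrow> 'b"
  assumes Js: "has_rough_integral (B \<theta>) S X XX v v' s Js" and Jt: "has_rough_integral (B \<theta>) S X XX v v' t Jt"
    and st: "0 \<le> s" "s < t" and XX: "XX 0 0 = 0"
    and mem: "\<And>u. 0 \<le> u \<Longrightarrow> u \<le> t \<Longrightarrow> v u \<in> car (B \<theta>) \<and> v' u \<in> car (B \<theta>)"
  shows "(\<lambda>n. nrm (B \<theta>) (grid_sum S (compensated_increment X XX v v') s t (2 ^ n)
    - (Jt - S (t - s) Js))) \<longlonglongrightarrow> 0"
proof -
  let ?\<xi> = "compensated_increment X XX v v'"
  have \<xi>: "?\<xi> u w \<in> car (B \<theta>)" if "0 \<le> u" "u \<le> w" "w \<le> t" for u w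
    using mem[of u] that by (simp add: compensated_increment_def)
  have J: "Js \<in> car (B \<theta>)" "Jt \<in> car (B \<theta>)"
    using Js Jt by (simp_all add: has_rough_integral_def)
  have R: "grid_sum S ?\<xi> s t (2 ^ n) \<in> car (B \<theta>)" for n
    using st by (intro grid_sum_mem \<xi>) auto
  obtain C where "C > 0" and C: "\<And>x. x \<in> car (B \<theta>) \<Longrightarrow> nrm (B \<theta>) (S (t - s) x) \<le> C * nrm (B \<theta>) x"
    using S_bounded[of "t - s" \<theta>] st by auto
  show ?thesis
    unfolding LIMSEQ_iff
  proof (intro allI impI)
    fix \<epsilon> :: real assume "\<epsilon> > 0"
    obtain d1 where "d1 > 0" and d1: "\<And>\<pi>. \<pi> division_of {0..s} \<Longrightarrow> (\<forall>K\<in>\<pi>. Sup K - Inf K < d1) \<Longrightarrow>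
        nrm (B \<theta>) ((\<Sum>K\<in>\<pi>. S (s - Inf K) (?\<xi> (Inf K) (Sup K))) - Js) < \<epsilon> / (2 * C)"
      using has_rough_integralD[OF Js, of "\<epsilon> / (2 * C)"] \<open>\<epsilon> > 0\<close> \<open>C > 0\<close> by auto
    obtain d2 where "d2 > 0" and d2: "\<And>\<pi>. \<pi> division_of {0..t} \<Longrightarrow> (\<forall>K\<in>\<pi>. Sup K - Inf K < d2) \<Longrightarrow>
        nrm (B \<theta>) ((\<Sum>K\<in>\<pi>. S (t - Inf K) (?\<xi> (Inf K) (Sup K))) - Jt) < \<epsilon> / 2"
      using has_rough_integralD[OF Jt, of "\<epsilon> / 2"] \<open>\<epsilon> > 0\<close> by auto
    have "(\<lambda>n. t * (1 / 2) ^ n) \<longlonglongrightarrow> t * 0"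
      by (intro tendsto_intros LIMSEQ_power_zero) auto
    then have "eventually (\<lambda>n. t * (1 / 2) ^ n < min d1 d2) sequentially"
      using \<open>d1 > 0\<close> \<open>d2 > 0\<close> by (intro order_tendstoD(2)) auto
    then obtain N where N: "\<And>n. n \<ge> N \<Longrightarrow> t * (1 / 2) ^ n < min d1 d2"
      by (auto simp: eventually_sequentially)
    have "nrm (B \<theta>) (grid_sum S ?\<xi> s t (2 ^ n) - (Jt - S (t - s) Js)) < \<epsilon>" if "n \<ge> N" for n
    proof -
      let ?m = "2 ^ n :: nat"
      have small: "t / real ?m < min d1 d2"
        using N[OF that] by (simp add: power_divide)
      define \<pi>2 where "\<pi>2 = (\<lambda>i. {grid s t ?m i..grid s t ?m (Suc i)}) ` {..<?m}"
      note uni2 = uniform_division[of s t ?m, folded \<pi>2_def, OF st(2)]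
      have mesh2: "Sup K - Inf K < d2" if "K \<in> \<pi>2" for K
        using uni2(2)[OF _ that] small st divide_right_mono[of "t - s" t "real ?m"] by simp
      have sum2: "(\<Sum>K\<in>\<pi>2. S (t - Inf K) (?\<xi> (Inf K) (Sup K))) = grid_sum S ?\<xi> s t ?m"
        using uni2(4)[of "\<lambda>u w. S (t - u) (?\<xi> u w)"] by (simp add: grid_sum_def)
      obtain R1 where R1: "R1 \<in> car (B \<theta>)" "nrm (B \<theta>) (R1 - Js) < \<epsilon> / (2 * C)"
        and total: "nrm (B \<theta>) (S (t - s) R1 + grid_sum S ?\<xi> s t ?m - Jt) < \<epsilon> / 2"
      proof (cases "s = 0")
        case True
        have "Js = 0"
          using rough_integral_0 Js XX True by blast
        moreover have "nrm (B \<theta>) (grid_sum S ?\<xi> s t ?m - Jt) < \<epsilon> / 2"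
          using d2[of \<pi>2] uni2(1) mesh2 True by (simp add: sum2)
        ultimately show thesis
          using that[of 0] \<open>\<epsilon> > 0\<close> \<open>C > 0\<close> linear_between_0[OF S_linear nsp[of \<theta>], of "t - s"] st
          by (simp add: nrm_0[OF nsp])
      next
        case False
        then have s: "0 < s"
          using st by simp
        define \<pi>1 where "\<pi>1 = (\<lambda>i. {grid 0 s ?m i..grid 0 s ?m (Suc i)}) ` {..<?m}"
        note uni1 = uniform_division[of 0 s ?m, folded \<pi>1_def, OF s]
        have mesh1: "Sup K - Inf K < d1" "Sup K - Inf K < d2" if "K \<in> \<pi>1" for K
          using uni1(2)[OF _ that] small st divide_right_mono[of s t "real ?m"] by simp_all
        define R1 where "R1 = grid_sum S ?\<xi> 0 s ?m"
        have sum1: "(\<Sum>K\<in>\<pi>1. S (s - Inf K) (?\<xi> (Inf K) (Sup K))) = R1"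
          using uni1(4)[of "\<lambda>u w. S (s - u) (?\<xi> u w)"] by (simp add: R1_def grid_sum_def)
        have R1: "R1 \<in> car (B \<theta>)"
          using s st unfolding R1_def by (intro grid_sum_mem \<xi>) auto
        have pts: "0 \<le> grid 0 s ?m i" "grid 0 s ?m i \<le> grid 0 s ?m (Suc i)"
            "grid 0 s ?m i \<le> s" "grid 0 s ?m (Suc i) \<le> t" if "i \<in> {..<?m}" for i
          using that st s grid_bounds[of 0 s i ?m] grid_bounds[of 0 s "Suc i" ?m] grid_le[of 0 s i "Suc i" ?m]
          by auto
        have "S (t - s) R1 = (\<Sum>i<?m. S (t - s) (S (s
            - grid 0 s ?m i) (?\<xi> (grid 0 s ?m i) (grid 0 s ?m (Suc i)))))"
          unfolding R1_def grid_sum_def using st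
          by (intro S_sum[of _ _ _ \<theta>] S_mem \<xi>) (simp_all add: pts)
        also have "\<dots> = (\<Sum>i<?m. S (t - grid 0 s ?m i) (?\<xi> (grid 0 s ?m i) (grid 0 s ?m (Suc i))))"
          using st by (intro sum.cong S_comp[of _ _ _ _ \<theta>] \<xi>) (simp_all add: pts)
        also have "\<dots> = (\<Sum>K\<in>\<pi>1. S (t - Inf K) (?\<xi> (Inf K) (Sup K)))"
          using uni1(4)[of "\<lambda>u w. S (t - u) (?\<xi> u w)"] by simp
        finally have SR1: "S (t - s) R1 = (\<Sum>K\<in>\<pi>1. S (t - Inf K) (?\<xi> (Inf K) (Sup K)))" .
        have "(\<pi>1 \<union> \<pi>2) division_of ({0..s} \<union> {s..t})"
          by (rule division_disjoint_union) (use uni1(1) uni2(1) in auto)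
        moreover have "{0..s} \<union> {s..t} = {0..t}"
          using st s by auto
        ultimately have div: "(\<pi>1 \<union> \<pi>2) division_of {0..t}"
          by simp
        have "\<pi>1 \<inter> \<pi>2 = {}"
        proof (rule ccontr)
          assume "\<pi>1 \<inter> \<pi>2 \<noteq> {}"
          then obtain K where K: "K \<in> \<pi>1" "K \<in> \<pi>2"
            by blast
          have "K \<subseteq> {s}"
            using division_ofD(2)[OF uni1(1) K(1)] division_ofD(2)[OF uni2(1) K(2)] by force
          then have "interior K \<subseteq> interior {s}"
            by (rule interior_mono)
          then show False
            using uni1(3)[OF _ K(1)] by simp
        qed
        then have "(\<Sum>K\<in>\<pi>1 \<union> \<pi>2. S (t - Inf K) (?\<xi> (Inf K) (Sup K))) = S (t - s) R1 + grid_sum S ?\<xi> s t ?m"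
          unfolding SR1 sum2[symmetric] by (intro sum.union_disjoint) (auto simp: \<pi>1_def \<pi>2_def)
        then have "nrm (B \<theta>) (S (t - s) R1 + grid_sum S ?\<xi> s t ?m - Jt) < \<epsilon> / 2"
          using d2[OF div] mesh1 mesh2 by auto
        moreover have "nrm (B \<theta>) (R1 - Js) < \<epsilon> / (2 * C)"
          using d1[of \<pi>1] uni1(1) mesh1 sum1 by simp
        ultimately show thesis
          using that R1 by blast
      qed
      have m: "S (t - s) R1 + grid_sum S ?\<xi> s t ?m - Jt \<in> car (B \<theta>)" "S (t - s) (R1 - Js) \<in> car (B \<theta>)"
        using R1 J R st by (auto intro!: ns_add ns_diff S_mem)
      have eq: "grid_sum S ?\<xi> s t ?m - (Jt - S (t - s) Js)
          = (S (t - s) R1 + grid_sum S ?\<xi> s t ?m - Jt) - S (t - s) (R1 - Js)"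
        using S_diff[OF _ R1(1) J(1), of "t - s"] st by simp
      have "nrm (B \<theta>) (grid_sum S ?\<xi> s t ?m - (Jt - S (t - s) Js))
          \<le> nrm (B \<theta>) (S (t - s) R1 + grid_sum S ?\<xi> s t ?m - Jt) + nrm (B \<theta>) (S (t - s) (R1 - Js))"
        unfolding eq by (rule nrm_diff[OF nsp m])
      also have "nrm (B \<theta>) (S (t - s) (R1 - Js)) \<le> C * nrm (B \<theta>) (R1 - Js)"
        using C R1 J by auto
      also have "\<dots> < C * (\<epsilon> / (2 * C))"
        using R1 \<open>C > 0\<close> by (intro mult_strict_left_mono)
      finally show ?thesis
        using total \<open>C > 0\<close> by (simp add: field_simps)
    qed
    then show "\<exists>N. \<forall>n\<ge>N. norm (nrm (B \<theta>) (grid_sum S ?\<xi> s t (2 ^ n) - (Jt - S (t - s) Js)) - 0) < \<epsilon>"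
      using R J st by (auto intro!: exI[of _ N])
  qed
qed

text \<open>
  The hypothesis of the sewing lemma, with additivity twisted by the semigroup: the second clause
  bounds the change of a Riemann sum when the point \<open>m\<close> is inserted between \<open>u\<close> and \<open>w\<close>, as seen at time \<open>m\<close>.
\<close>

definition almost_additive where
  "almost_additive \<theta> p K a b \<xi> \<longleftrightarrow>
    (\<forall>u w. a \<le> u \<and> u \<le> w \<and> w \<le> b \<longrightarrow> \<xi> u w \<in> car (B \<theta>)) \<and>
    (\<forall>u m w. a \<le> u \<and> u < m \<and> m < w \<and> w \<le> b \<longrightarrow>
       nrm (B \<theta>) (S (m - u) (\<xi> u w - \<xi> u m) - \<xi> m w) \<le> K * (w - u) powr p)"

lemma almost_additive_subinterval:
  "almost_additive \<theta> p K a b \<xi> \<Longrightarrow> a \<le> a' \<Longrightarrow> b' \<le> b \<Longrightarrow> almost_additive \<theta> p K a' b' \<xi>"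
  unfolding almost_additive_def by (meson order_trans)

definition mild_integral_of where
  "mild_integral_of \<theta> T \<xi> J \<longleftrightarrow> (\<forall>t\<in>{0..T}. J t \<in> car (B \<theta>)) \<and>
    (\<forall>s t. 0 \<le> s \<and> s < t \<and> t \<le> T \<longrightarrow>
       (\<lambda>n. nrm (B \<theta>) (grid_sum S \<xi> s t (2 ^ n) - (J t - S (t - s) (J s)))) \<longlonglongrightarrow> 0)"

text \<open>
  Passing from the grid with \<open>2 ^ n\<close> cells to the next one inserts \<open>2 ^ n\<close> midpoints, each changing the
  sum by at most a multiple of \<open>(h / 2 ^ n) powr p\<close>, where \<open>h = t - s\<close>.  As \<open>p > 1\<close>, these changes are summable, and the limit
  stays close to the sum over the trivial grid.
\<close>

lemma sewing:
  assumes p: "1 < p" and T: "0 < T"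
  shows "\<exists>C>0. \<forall>s t \<xi> z K. 0 \<le> s \<and> s < t \<and> t \<le> T \<and> 0 \<le> K \<and> z \<in> car (B \<theta>) \<and>
    almost_additive \<theta> p K s t \<xi> \<and>
    (\<lambda>n. nrm (B \<theta>) (grid_sum S \<xi> s t (2 ^ n) - z)) \<longlonglongrightarrow> 0 \<longrightarrow>
    nrm (B \<theta>) (z - S (t - s) (\<xi> s t)) \<le> C * K * (t - s) powr p"
proof -
  obtain C where "C > 0" and C: "\<And>t x. t \<in> {0..T} \<Longrightarrow> x \<in> car (B \<theta>) \<Longrightarrow>
      nrm (B \<theta>) (S t x) \<le> C * nrm (B \<theta>) x"
    using S_bounded[OF T, of \<theta>] by meson
  define q :: real where "q = 2 powr (1 - p)"
  have q: "0 \<le> q" "q < 1"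
    using p powr_less_mono[of "1 - p" 0 2] by (auto simp: q_def)
  have "nrm (B \<theta>) (z - S (t - s) (\<xi> s t)) \<le> (C / (1 - q)) * K * (t - s) powr p"
    if st: "0 \<le> s" "s < t" "t \<le> T" and K: "0 \<le> K" and z: "z \<in> car (B \<theta>)"
    and add: "almost_additive \<theta> p K s t \<xi>"
    and lim: "(\<lambda>n. nrm (B \<theta>) (grid_sum S \<xi> s t (2 ^ n) - z)) \<longlonglongrightarrow> 0" for s t \<xi> z K
  proof -
    have \<xi>: "\<xi> u w \<in> car (B \<theta>)" if "s \<le> u" "u \<le> w" "w \<le> t" for u w
      using add that by (simp add: almost_additive_def)
    have defect: "nrm (B \<theta>) (S (m - u) (\<xi> u w - \<xi> u m) - \<xi> m w) \<le> K * (w - u) powr p"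
      if "s \<le> u" "u < m" "m < w" "w \<le> t" for u m w
      using add that by (simp add: almost_additive_def)
    define P where "P n = grid_sum S \<xi> s t (2 ^ n)" for n
    have P: "P n \<in> car (B \<theta>)" for n
      unfolding P_def using st by (intro grid_sum_mem \<xi>) auto
    have step: "nrm (B \<theta>) (P n - P (Suc n)) \<le> C * K * (t - s) powr p * q ^ n" for n
    proof -
      define k where "k = (2 ^ n :: nat)"
      have k: "k > 0"
        by (simp add: k_def)
      let ?f = "\<lambda>i. S (t - grid s t (2 * k) i) (\<xi> (grid s t (2 * k) i) (grid s t (2 * k) (Suc i)))"
      define D where "D j = S (t - grid s t k j) (\<xi> (grid s t k j) (grid s t k (Suc j)))
        - (?f (2 * j) + ?f (Suc (2 * j)))" for j
      have "P (Suc n) = (\<Sum>i<k * 2. ?f i)"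
        by (simp add: P_def grid_sum_def k_def mult.commute)
      also have "\<dots> = (\<Sum>j<k. \<Sum>i\<in>{j * 2..<j * 2 + 2}. ?f i)"
        by (rule sum.nat_group[symmetric])
      also have "\<dots> = (\<Sum>j<k. ?f (2 * j) + ?f (Suc (2 * j)))"
        by (intro sum.cong refl) (simp add: numeral_2_eq_2 mult.commute)
      finally have "P n - P (Suc n) = (\<Sum>j<k. D j)"
        by (simp add: P_def grid_sum_def D_def sum_subtractf k_def)
      moreover have "D j \<in> car (B \<theta>) \<and> nrm (B \<theta>) (D j) \<le> C * (K * ((t - s) / k) powr p)" if j: "j < k" for j
      proof -
        define u where "u = grid s t k j"
        define m where "m = grid s t (2 * k) (Suc (2 * j))"
        define w where "w = grid s t k (Suc j)"
        have u2: "u = grid s t (2 * k) (2 * j)" and w2: "w = grid s t (2 * k) (Suc (Suc (2 * j)))"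
          using grid_refine[of s t k j] grid_refine[of s t k "Suc j"] by (simp_all add: u_def w_def)
        have um: "u < m" and mw: "m < w"
          unfolding u2 w2 m_def using st k by (auto intro!: grid_less)
        have su: "s \<le> u" and wt: "w \<le> t"
          using grid_bounds[of s t j k] grid_bounds[of s t "Suc j" k] st j k by (auto simp: u_def w_def)
        have mem: "\<xi> u w \<in> car (B \<theta>)" "\<xi> u m \<in> car (B \<theta>)" "\<xi> m w \<in> car (B \<theta>)"
          using su um mw wt by (auto intro!: \<xi>)
        have "D j = S (t - u) (\<xi> u w) - (S (t - u) (\<xi> u m) + S (t - m) (\<xi> m w))"
          by (simp add: D_def u_def w_def m_def grid_refine grid_refine[of s t k "Suc j", simplified])
        also have "\<dots> = S (t - u) (\<xi> u w - \<xi> u m) - S (t - m) (\<xi> m w)"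
          using S_diff[OF _ mem(1,2), of "t - u"] su um mw wt by simp
        also have "S (t - u) (\<xi> u w - \<xi> u m) = S (t - m) (S (m - u) (\<xi> u w - \<xi> u m))"
          using um mw wt mem by (intro S_comp[of _ _ _ _ \<theta>, symmetric]) auto
        also have "\<dots> - S (t - m) (\<xi> m w) = S (t - m) (S (m - u) (\<xi> u w - \<xi> u m) - \<xi> m w)"
          using um mw wt mem by (intro S_diff[of _ _ \<theta>, symmetric]) auto
        finally have D: "D j = S (t - m) (S (m - u) (\<xi> u w - \<xi> u m) - \<xi> m w)" .
        have mem': "S (m - u) (\<xi> u w - \<xi> u m) - \<xi> m w \<in> car (B \<theta>)"
          using um mem by auto
        have "nrm (B \<theta>) (D j) \<le> C * nrm (B \<theta>) (S (m - u) (\<xi> u w - \<xi> u m) - \<xi> m w)"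
          unfolding D using st su um mw wt by (intro C mem') auto
        also have "\<dots> \<le> C * (K * (w - u) powr p)"
          using defect[OF su um mw wt] \<open>C > 0\<close> by simp
        also have "w - u = (t - s) / k"
          using grid_step[OF k] by (simp add: u_def w_def)
        finally show ?thesis
          using mem' um mw wt by (simp add: D)
      qed
      ultimately have "nrm (B \<theta>) (P n - P (Suc n)) \<le> (\<Sum>j<k. C * (K * ((t - s) / k) powr p))"
        using nrm_sum[OF nsp[of \<theta>], of "{..<k}" D] sum_mono[of "{..<k}" "\<lambda>j. nrm (B \<theta>) (D j)"
          "\<lambda>j. C * (K * ((t - s) / k) powr p)"] by fastforce
      also have "\<dots> = C * K * (t - s) powr p * (real k * (1 / real k powr p))"
        using st k by (simp add: powr_divide)
      also have "real k * (1 / real k powr p) = q ^ n"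
      proof -
        have "real k = 2 powr n"
          by (simp add: k_def powr_realpow)
        then have "real k * (1 / real k powr p) = 2 powr (n * (1 - p))"
          by (simp add: powr_powr powr_diff algebra_simps flip: powr_add)
        also have "\<dots> = q ^ n"
          by (simp add: q_def powr_powr mult.commute flip: powr_realpow)
        finally show ?thesis .
      qed
      finally show ?thesis .
    qed
    have "P 0 - z \<in> car (B \<theta>) \<and> nrm (B \<theta>) (P 0 - z) \<le> C * K * (t - s) powr p / (1 - q)"
    proof (rule limit_of_geometric_steps[OF nsp mcomplete nsp _ _ _ _ _ _ q])
      show "nrm (B \<theta>) x \<le> 1 * nrm (B \<theta>) x" for x
        by simp
      show "(\<lambda>n. nrm (B \<theta>) (P n - z)) \<longlonglongrightarrow> 0"
        using lim by (simp add: P_def)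
    qed (use P z step in auto)
    moreover have "P 0 = S (t - s) (\<xi> s t)"
      by (simp add: P_def grid_sum_def)
    ultimately show ?thesis
      using nrm_commute[OF nsp P[of 0] z] by simp
  qed
  moreover have "C / (1 - q) > 0"
    using \<open>C > 0\<close> q by simp
  ultimately show ?thesis
    by blast
qed

text \<open>
  The sewing error on \<open>[s, t]\<close> differs from that on \<open>[m, t]\<close> by \<open>S (t - m)\<close> applied to the sewing error
  on \<open>[s, m]\<close> minus the defect of additivity at \<open>m\<close>.  Therefore it has the halving property, and its order
  of decay can be traded for regularity.
\<close>

lemma sewing_gain:
  assumes p: "1 < p" and e: "0 \<le> e" "e \<le> 2" "e < p" and T\<^sub>0: "0 < T\<^sub>0"
  shows "\<exists>C>0. \<forall>T \<xi> J K s t. T \<le> T\<^sub>0 \<and> 0 \<le> K \<and>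
    almost_additive \<theta> p K 0 T \<xi> \<and> mild_integral_of \<theta> T \<xi> J \<and> 0 \<le> s \<and> s < t \<and> t \<le> T \<longrightarrow>
    J t - S (t - s) (J s) - S (t - s) (\<xi> s t) \<in> car (B (\<theta> + e)) \<and>
    nrm (B (\<theta> + e)) (J t - S (t - s) (J s) - S (t - s) (\<xi> s t)) \<le> C * K * (t - s) powr (p - e)"
proof -
  obtain C1 where "C1 > 0" and C1: "\<And>s t \<xi> z K. \<lbrakk>0 \<le> s; s < t; t \<le> T\<^sub>0; 0 \<le> K; z \<in> car (B \<theta>);
    almost_additive \<theta> p K s t \<xi>;
    (\<lambda>n. nrm (B \<theta>) (grid_sum S \<xi> s t (2 ^ n) - z)) \<longlonglongrightarrow> 0\<rbrakk> \<Longrightarrow>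
    nrm (B \<theta>) (z - S (t - s) (\<xi> s t)) \<le> C1 * K * (t - s) powr p"
    using sewing[OF p T\<^sub>0, of \<theta>] by metis
  obtain C2 where "C2 > 0" and C2: "\<And>t K s\<^sub>0 W. \<lbrakk>t \<in> {0..T\<^sub>0}; K \<ge> 0; s\<^sub>0 \<in> {0..<t};
    halving_decay \<theta> p K s\<^sub>0 t W\<rbrakk> \<Longrightarrow>
    W s\<^sub>0 \<in> car (B (\<theta> + e)) \<and> nrm (B (\<theta> + e)) (W s\<^sub>0) \<le> C2 * K * (t - s\<^sub>0) powr (p - e)"
    using smoothing_gain[OF e T\<^sub>0, of \<theta>] by metis
  have "J t - S (t - s) (J s) - S (t - s) (\<xi> s t) \<in> car (B (\<theta> + e)) \<and>
      nrm (B (\<theta> + e)) (J t - S (t - s) (J s) - S (t - s) (\<xi> s t))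
        \<le> (C2 * (C1 + 1)) * K * (t - s) powr (p - e)"
    if T: "T \<le> T\<^sub>0" and K: "0 \<le> K" and add: "almost_additive \<theta> p K 0 T \<xi>"
    and int: "mild_integral_of \<theta> T \<xi> J" and st: "0 \<le> s" "s < t" "t \<le> T" for T \<xi> J K s t
  proof -
    have \<xi>: "\<xi> u w \<in> car (B \<theta>)" if "0 \<le> u" "u \<le> w" "w \<le> T" for u w
      using add that by (simp add: almost_additive_def)
    have defect: "nrm (B \<theta>) (S (m - u) (\<xi> u w - \<xi> u m) - \<xi> m w) \<le> K * (w - u) powr p"
      if "0 \<le> u" "u < m" "m < w" "w \<le> T" for u m w
      using add that by (simp add: almost_additive_def)
    have J: "J t \<in> car (B \<theta>)" if "t \<in> {0..T}" for t
      using int that by (simp add: mild_integral_of_def)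
    have lim: "(\<lambda>n. nrm (B \<theta>) (grid_sum S \<xi> s t (2 ^ n) - (J t - S (t - s) (J s)))) \<longlonglongrightarrow> 0"
      if "0 \<le> s" "s < t" "t \<le> T" for s t
      using int that by (simp add: mild_integral_of_def)
    define W where "W r u = J u - S (u - r) (J r) - S (u - r) (\<xi> r u)" for r u
    have W: "W r u \<in> car (B \<theta>)" and nW: "nrm (B \<theta>) (W r u) \<le> C1 * K * (u - r) powr p"
      if "0 \<le> r" "r < u" "u \<le> T" for r u
    proof -
      have m: "J u - S (u - r) (J r) \<in> car (B \<theta>)" "S (u - r) (\<xi> r u) \<in> car (B \<theta>)"
        using that by (auto intro!: ns_diff S_mem J \<xi>)
      then show "W r u \<in> car (B \<theta>)"
        by (simp add: W_def)
      show "nrm (B \<theta>) (W r u) \<le> C1 * K * (u - r) powr p"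
        unfolding W_def using that T K m lim[OF that] by (intro C1 almost_additive_subinterval[OF add]) auto
    qed
    have "W s t \<in> car (B (\<theta> + e)) \<and> nrm (B (\<theta> + e)) (W s t) \<le> C2 * ((C1 + 1) * K) * (t - s) powr (p - e)"
    proof (rule C2[where W = "\<lambda>r. W r t"])
      show "halving_decay \<theta> p ((C1 + 1) * K) s t (\<lambda>r. W r t)"
        unfolding halving_decay_def
      proof
        fix r assume r: "r \<in> {s..<t}"
        define m where "m = (r + t) / 2"
        have m: "0 \<le> r" "r < m" "m < t" "m \<le> T" "r < t"
          using r st by (auto simp: m_def)
        define g where "g = W r m - (S (m - r) (\<xi> r t - \<xi> r m) - \<xi> m t)"
        have mem: "J r \<in> car (B \<theta>)" "J m \<in> car (B \<theta>)" "\<xi> r t \<in> car (B \<theta>)" "\<xi> r m \<in> car (B \<theta>)"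
            "\<xi> m t \<in> car (B \<theta>)"
          using m st by (auto intro!: J \<xi>)
        have d: "S (m - r) (\<xi> r t - \<xi> r m) - \<xi> m t \<in> car (B \<theta>)"
          using m mem by auto
        have g: "g \<in> car (B \<theta>)"
          unfolding g_def using W[of r m] d m by auto
        have g': "g = J m - S (m - r) (J r) - S (m - r) (\<xi> r t) + \<xi> m t"
          using S_diff[OF _ mem(3,4), of "m - r"] m by (simp add: g_def W_def)
        have "S (t - m) g = S (t - m) (J m) - S (t - m) (S (m - r) (J r))
            - S (t - m) (S (m - r) (\<xi> r t)) + S (t - m) (\<xi> m t)"
          unfolding g' using m mem S_add[of "t - m" _ \<theta>] S_diff[of "t - m" _ \<theta>] by simp
        moreover have "S (t - m) (S (m - r) x) = S (t - r) x" if "x \<in> car (B \<theta>)" for x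
          using m that by (intro S_comp) auto
        ultimately have "W r t = W m t + S (t - m) g"
          using mem by (simp add: W_def)
        moreover have "t - m = (t - r) / 2"
          by (simp add: m_def field_simps)
        moreover have "nrm (B \<theta>) g \<le> (C1 + 1) * K * (t - r) powr p"
        proof -
          have "nrm (B \<theta>) g \<le> C1 * K * (m - r) powr p + K * (t - r) powr p"
            unfolding g_def using nrm_diff[OF nsp W[of r m] d] nW[of r m] defect[of r m t] m st by linarith
          moreover have "C1 * K * (m - r) powr p \<le> C1 * K * (t - r) powr p"
            using m p K \<open>C1 > 0\<close> by (intro mult_left_mono powr_mono2) auto
          ultimately show ?thesis
            by (simp add: algebra_simps)
        qed
        moreover have "nrm (B \<theta>) (W r t) \<le> (C1 + 1) * K * (t - r) powr p"
        proof -
          have "C1 * (K * (t - r) powr p) \<le> (C1 + 1) * (K * (t - r) powr p)"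
            using K by (intro mult_right_mono) auto
          then show ?thesis
            using nW[of r t] m st by (simp add: mult.assoc)
        qed
        ultimately show "W r t \<in> car (B \<theta>) \<and> nrm (B \<theta>) (W r t) \<le> (C1 + 1) * K * (t - r) powr p \<and>
            (\<exists>g\<in>car (B \<theta>). W r t = W ((r + t) / 2) t + S ((t - r) / 2) g \<and>
              nrm (B \<theta>) g \<le> (C1 + 1) * K * (t - r) powr p)"
          using g W[of r t] m st by (metis m_def)
      qed
      show "t \<in> {0..T\<^sub>0}" "(C1 + 1) * K \<ge> 0" "s \<in> {0..<t}"
        using st T K \<open>C1 > 0\<close> by auto
    qed
    then show ?thesis
      by (simp add: W_def mult.assoc)
  qed
  moreover have "C2 * (C1 + 1) > 0"
    using \<open>C1 > 0\<close> \<open>C2 > 0\<close> by simp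
  ultimately show ?thesis
    by (intro exI[of _ "C2 * (C1 + 1)"]) auto
qed

end

section \<open>Rough convolutions\<close>

text \<open>
  The quantitative content of being a rough path: the two Hoelder bounds and Chen's relation.
\<close>

definition rough_bounds ::
    "real \<Rightarrow> real \<Rightarrow> real \<Rightarrow> (real \<Rightarrow> real) \<Rightarrow> (real \<Rightarrow> real \<Rightarrow> real) \<Rightarrow> bool" where
  "rough_bounds \<alpha> r T X XX \<longleftrightarrow>
     (\<forall>s t. 0 \<le> s \<and> s < t \<and> t \<le> T \<longrightarrow>
        \<bar>X t - X s\<bar> \<le> r * (t - s) powr \<alpha> \<and> \<bar>XX s t\<bar> \<le> r * (t - s) powr (2 * \<alpha>)) \<and>
     (\<forall>s u t. 0 \<le> s \<and> s \<le> u \<and> u \<le> t \<and> t \<le> T \<longrightarrow>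
        XX s t - XX s u - XX u t = (X u - X s) * (X t - X u))"

lemma rough_bounds_diagonal: "rough_bounds \<alpha> r T X XX \<Longrightarrow> 0 \<le> u \<Longrightarrow> u \<le> T \<Longrightarrow> XX u u = 0"
  by (force simp: rough_bounds_def)

context smoothing_scale
begin

text \<open>
  Real-valued bounds for the five parts of the norm of a controlled path, and membership in the spaces
  in which these parts are measured.
\<close>

definition controlled_bounds where
  "controlled_bounds \<alpha> \<kappa> N T X v v' \<longleftrightarrow>
     (\<forall>t. 0 \<le> t \<and> t \<le> T \<longrightarrow> v t \<in> car (B \<kappa>) \<and> nrm (B \<kappa>) (v t) \<le> N \<and>
        v' t \<in> car (B (\<kappa> - \<alpha>)) \<and> nrm (B (\<kappa> - \<alpha>)) (v' t) \<le> N) \<and>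
     (\<forall>s t. 0 \<le> s \<and> s < t \<and> t \<le> T \<longrightarrow>
        nrm (B (\<kappa> - 2 * \<alpha>)) (v' t - v' s) \<le> N * (t - s) powr \<alpha> \<and>
        nrm (B (\<kappa> - \<alpha>)) (remainder X v v' s t) \<le> N * (t - s) powr \<alpha> \<and>
        nrm (B (\<kappa> - 2 * \<alpha>)) (remainder X v v' s t) \<le> N * (t - s) powr (2 * \<alpha>))"

text \<open>
  By Chen's relation, inserting \<open>m\<close> into \<open>[u, w]\<close> leaves the remainder of \<open>v\<close> times an increment of \<open>X\<close>,
  an increment of \<open>v'\<close> times \<open>XX\<close>, and the effect of \<open>S (m - u) - Id\<close> on the germ of \<open>[m, w]\<close>.  In the space of
  index \<open>\<kappa> - 2 \<alpha>\<close> each of these has order \<open>3 \<alpha>\<close>, the last one because \<open>v\<close> and \<open>v'\<close> take values in spaces that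
  are better by \<open>2 \<alpha>\<close> and by \<open>\<alpha>\<close>.
\<close>

lemma compensated_increment_almost_additive:
  assumes \<alpha>: "0 < \<alpha>" "\<alpha> < 1 / 2" and r: "0 \<le> r" and T\<^sub>0: "0 < T\<^sub>0"
  shows "\<exists>C>0. \<forall>T X XX v v' N. T \<le> T\<^sub>0 \<and> rough_bounds \<alpha> r T X XX \<and> 0 \<le> N \<and>
    controlled_bounds \<alpha> \<kappa> N T X v v' \<longrightarrow>
    almost_additive (\<kappa> - 2 * \<alpha>) (3 * \<alpha>) (C * N) 0 T (compensated_increment X XX v v')"
proof -
  let ?\<theta> = "\<kappa> - 2 * \<alpha>"
  obtain c0 where "c0 > 0" and c0: "\<And>t x. t \<in> {0..T\<^sub>0} \<Longrightarrow> x \<in> car (B ?\<theta>) \<Longrightarrow>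
      nrm (B ?\<theta>) (S t x) \<le> c0 * nrm (B ?\<theta>) x"
    using S_bounded[OF T\<^sub>0, of ?\<theta>] by meson
  obtain c1 where "c1 > 0" and "\<forall>t\<in>{0<..T\<^sub>0}. \<forall>x\<in>car (B (?\<theta> + 2 * \<alpha>)).
      nrm (B ?\<theta>) (S t x - x) \<le> c1 * t powr (2 * \<alpha>) * nrm (B (?\<theta> + 2 * \<alpha>)) x"
    using S_minus_id_bound[OF _ _ T\<^sub>0, of "2 * \<alpha>" ?\<theta>] \<alpha> by auto
  then have c1: "\<And>t x. t \<in> {0<..T\<^sub>0} \<Longrightarrow> x \<in> car (B \<kappa>) \<Longrightarrow>
      nrm (B ?\<theta>) (S t x - x) \<le> c1 * t powr (2 * \<alpha>) * nrm (B \<kappa>) x"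
    by simp
  obtain c2 where "c2 > 0" and c2': "\<forall>t\<in>{0<..T\<^sub>0}. \<forall>x\<in>car (B (?\<theta> + \<alpha>)).
      nrm (B ?\<theta>) (S t x - x) \<le> c2 * t powr \<alpha> * nrm (B (?\<theta> + \<alpha>)) x"
    using S_minus_id_bound[OF _ _ T\<^sub>0, of "\<alpha>" ?\<theta>] \<alpha> by auto
  have "?\<theta> + \<alpha> = \<kappa> - \<alpha>"
    by simp
  with c2' have c2: "\<And>t x. t \<in> {0<..T\<^sub>0} \<Longrightarrow> x \<in> car (B (\<kappa> - \<alpha>)) \<Longrightarrow>
      nrm (B ?\<theta>) (S t x - x) \<le> c2 * t powr \<alpha> * nrm (B (\<kappa> - \<alpha>)) x"
    by simp
  define C where "C = (r + 1) * (c1 + c2 + 2 * c0)"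
  have "almost_additive ?\<theta> (3 * \<alpha>) (C * N) 0 T (compensated_increment X XX v v')"
    if T: "T \<le> T\<^sub>0" and X: "rough_bounds \<alpha> r T X XX" and N: "0 \<le> N"
    and v: "controlled_bounds \<alpha> \<kappa> N T X v v'" for T X XX v v' N
    unfolding almost_additive_def
  proof (intro conjI allI impI; elim conjE)
    have mem: "v t \<in> car (B \<kappa>)" "v' t \<in> car (B (\<kappa> - \<alpha>))" "v t \<in> car (B ?\<theta>)" "v' t \<in> car (B ?\<theta>)"
      if "0 \<le> t" "t \<le> T" for t
      using v that \<alpha> scale_mem[of _ \<kappa> ?\<theta>] scale_mem[of _ "\<kappa> - \<alpha>" ?\<theta>]
      by (auto simp: controlled_bounds_def)
    show "compensated_increment X XX v v' u w \<in> car (B ?\<theta>)" if "0 \<le> u" "u \<le> w" "w \<le> T" for u w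
      using that mem[of u] by (simp add: compensated_increment_def)
    fix u m w assume umw: "0 \<le> u" "u < m" "m < w" "w \<le> T"
    define a b h where "a = m - u" and "b = w - m" and "h = w - u"
    have abh: "0 < a" "0 < b" "a \<le> h" "b \<le> h" "a \<le> T\<^sub>0"
      using umw T by (auto simp: a_def b_def h_def)
    define x q where "x = X w - X m" and "q = XX m w"
    define R D where "R = remainder X v v' u m" and "D = v' m - v' u"
    have x: "\<bar>x\<bar> \<le> r * b powr \<alpha>" and q: "\<bar>q\<bar> \<le> r * b powr (2 * \<alpha>)"
      using X umw by (auto simp: rough_bounds_def x_def q_def b_def)
    have chen: "XX u w - XX u m - q = (X m - X u) * x"
      using X umw by (simp add: rough_bounds_def x_def q_def)
    have Rm: "R \<in> car (B ?\<theta>)" and Dm: "D \<in> car (B ?\<theta>)"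
      using mem[of u] mem[of m] umw by (auto simp: R_def D_def remainder_def)
    have nR: "nrm (B ?\<theta>) R \<le> N * a powr (2 * \<alpha>)" and nD: "nrm (B ?\<theta>) D \<le> N * a powr \<alpha>"
      using v umw by (auto simp: controlled_bounds_def R_def D_def a_def)
    have nv: "nrm (B \<kappa>) (v m) \<le> N" and nv': "nrm (B (\<kappa> - \<alpha>)) (v' m) \<le> N"
      using v umw by (auto simp: controlled_bounds_def)
    let ?\<xi> = "compensated_increment X XX v v'"
    have XXuw: "XX u w = XX u m + q + (X m - X u) * x"
      using chen by simp
    \<comment> \<open>Chen's relation together with the expansion of \<open>v m\<close> around \<open>u\<close>.\<close>
    have diff: "?\<xi> u w - ?\<xi> u m = ?\<xi> m w - (x *\<^sub>R R + q *\<^sub>R D)"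
      unfolding compensated_increment_def R_def D_def remainder_def XXuw
      by (simp add: q_def[symmetric] x_def algebra_simps)
    have mw: "?\<xi> m w = x *\<^sub>R v m + q *\<^sub>R v' m"
      by (simp add: compensated_increment_def x_def q_def)
    define E1 E2 E3 where "E1 = x *\<^sub>R (S a (v m) - v m)" and "E2 = q *\<^sub>R (S a (v' m) - v' m)"
      and "E3 = S a (x *\<^sub>R R + q *\<^sub>R D)"
    have vm: "v m \<in> car (B ?\<theta>)" "v' m \<in> car (B ?\<theta>)"
      using mem[of m] umw by auto
    have E: "E1 \<in> car (B ?\<theta>)" "E2 \<in> car (B ?\<theta>)" "E3 \<in> car (B ?\<theta>)"
      using vm Rm Dm abh by (auto simp: E1_def E2_def E3_def)
    have "S a (?\<xi> m w - (x *\<^sub>R R + q *\<^sub>R D)) = S a (?\<xi> m w) - E3"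
      unfolding E3_def mw using abh vm Rm Dm by (intro S_diff[of _ _ ?\<theta>]) auto
    moreover have "S a (?\<xi> m w) = x *\<^sub>R S a (v m) + q *\<^sub>R S a (v' m)"
      unfolding mw using abh vm S_add[of a "x *\<^sub>R v m" ?\<theta> "q *\<^sub>R v' m"] S_scaleR[of a _ ?\<theta>] by auto
    ultimately have split: "S a (?\<xi> u w - ?\<xi> u m) - ?\<xi> m w = E1 + E2 - E3"
      unfolding diff by (simp add: E1_def E2_def mw algebra_simps)
    have pw1: "b powr \<alpha> * a powr (2 * \<alpha>) \<le> h powr (3 * \<alpha>)"
    proof -
      have "b powr \<alpha> * a powr (2 * \<alpha>) \<le> h powr \<alpha> * h powr (2 * \<alpha>)"
        using abh \<alpha> by (intro mult_mono powr_mono2) auto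
      then show ?thesis
        by (simp flip: powr_add)
    qed
    have pw2: "b powr (2 * \<alpha>) * a powr \<alpha> \<le> h powr (3 * \<alpha>)"
    proof -
      have "b powr (2 * \<alpha>) * a powr \<alpha> \<le> h powr (2 * \<alpha>) * h powr \<alpha>"
        using abh \<alpha> by (intro mult_mono powr_mono2) auto
      then show ?thesis
        by (simp flip: powr_add)
    qed
    have scale_le: "r * A * (c * A' * N) \<le> r * c * N * h powr (3 * \<alpha>)"
      if "A * A' \<le> h powr (3 * \<alpha>)" "0 < c" for A A' c
    proof -
      have "r * A * (c * A' * N) = r * c * N * (A * A')"
        by (simp add: algebra_simps)
      also have "\<dots> \<le> r * c * N * h powr (3 * \<alpha>)"
        using that r N by (intro mult_left_mono) auto
      finally show ?thesis .
    qed
    have nE1: "nrm (B ?\<theta>) E1 \<le> r * c1 * N * h powr (3 * \<alpha>)"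
    proof -
      have "nrm (B ?\<theta>) (S a (v m) - v m) \<le> c1 * a powr (2 * \<alpha>) * nrm (B \<kappa>) (v m)"
        using abh mem[of m] umw by (intro c1) auto
      also have "\<dots> \<le> c1 * a powr (2 * \<alpha>) * N"
        using nv \<open>c1 > 0\<close> by (intro mult_left_mono) auto
      finally have "nrm (B ?\<theta>) E1 \<le> r * b powr \<alpha> * (c1 * a powr (2 * \<alpha>) * N)"
        using x vm abh r N \<open>c1 > 0\<close> by (auto simp: E1_def nrm_scaleR[OF nsp] intro!: mult_mono)
      also note scale_le[OF pw1 \<open>c1 > 0\<close>]
      finally show ?thesis .
    qed
    have nE2: "nrm (B ?\<theta>) E2 \<le> r * c2 * N * h powr (3 * \<alpha>)"
    proof -
      have "nrm (B ?\<theta>) (S a (v' m) - v' m) \<le> c2 * a powr \<alpha> * nrm (B (\<kappa> - \<alpha>)) (v' m)"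
        using abh mem[of m] umw by (intro c2) auto
      also have "\<dots> \<le> c2 * a powr \<alpha> * N"
        using nv' \<open>c2 > 0\<close> by (intro mult_left_mono) auto
      finally have "nrm (B ?\<theta>) E2 \<le> r * b powr (2 * \<alpha>) * (c2 * a powr \<alpha> * N)"
        using q vm abh r N \<open>c2 > 0\<close> by (auto simp: E2_def nrm_scaleR[OF nsp] intro!: mult_mono)
      also note scale_le[OF pw2 \<open>c2 > 0\<close>]
      finally show ?thesis .
    qed
    have nE3: "nrm (B ?\<theta>) E3 \<le> r * (2 * c0) * N * h powr (3 * \<alpha>)"
    proof -
      have "nrm (B ?\<theta>) E3 \<le> c0 * nrm (B ?\<theta>) (x *\<^sub>R R + q *\<^sub>R D)"
        unfolding E3_def using abh Rm Dm by (intro c0) auto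
      also have "\<dots> \<le> c0 * (\<bar>x\<bar> * nrm (B ?\<theta>) R + \<bar>q\<bar> * nrm (B ?\<theta>) D)"
        using nrm_add[OF nsp, of "x *\<^sub>R R" ?\<theta> "q *\<^sub>R D"] Rm Dm \<open>c0 > 0\<close>
        by (intro mult_left_mono) (auto simp: nrm_scaleR[OF nsp])
      also have "\<dots> \<le> c0 * (r * b powr \<alpha> * (N * a powr (2 * \<alpha>)) + r * b powr (2 * \<alpha>) * (N * a powr \<alpha>))"
        using x q nR nD Rm Dm r N \<open>c0 > 0\<close> by (intro mult_left_mono add_mono mult_mono) auto
      also have "\<dots> = r * b powr \<alpha> * (c0 * a powr (2 * \<alpha>) * N) + r * b powr (2 * \<alpha>) * (c0 * a powr \<alpha> * N)"
        by (simp add: algebra_simps)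
      also have "\<dots> \<le> r * c0 * N * h powr (3 * \<alpha>) + r * c0 * N * h powr (3 * \<alpha>)"
        by (intro add_mono scale_le pw1 pw2 \<open>c0 > 0\<close>)
      finally show ?thesis
        by (simp add: algebra_simps)
    qed
    have "nrm (B ?\<theta>) (E1 + E2 - E3) \<le> nrm (B ?\<theta>) E1 + nrm (B ?\<theta>) E2 + nrm (B ?\<theta>) E3"
      using nrm_diff[OF nsp ns_add[OF E(1,2)] E(3)] nrm_add[OF nsp E(1,2)] by linarith
    also have "\<dots> \<le> r * ((c1 + c2 + 2 * c0) * N * h powr (3 * \<alpha>))"
      using nE1 nE2 nE3 by (simp add: algebra_simps)
    also have "\<dots> \<le> (r + 1) * ((c1 + c2 + 2 * c0) * N * h powr (3 * \<alpha>))"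
      using N \<open>c0 > 0\<close> \<open>c1 > 0\<close> \<open>c2 > 0\<close> by (intro mult_right_mono) auto
    finally show "nrm (B ?\<theta>) (S (m - u) (?\<xi> u w - ?\<xi> u m) - ?\<xi> m w) \<le> C * N * (w - u) powr (3 * \<alpha>)"
      using split by (simp add: C_def a_def h_def mult.assoc)
  qed
  moreover have "C > 0"
    using \<open>c0 > 0\<close> \<open>c1 > 0\<close> \<open>c2 > 0\<close> r by (simp add: C_def)
  ultimately show ?thesis
    by blast
qed

lemma rough_convolution_bound:
  assumes \<alpha>: "1 / 3 < \<alpha>" "\<alpha> < 1 / 2" and r: "0 \<le> r" and T\<^sub>0: "0 < T\<^sub>0"
    and e: "0 \<le> e" "e < 3 * \<alpha>"
  shows "\<exists>C>0. \<forall>T X XX v v' N J s t. T \<le> T\<^sub>0 \<and> rough_bounds \<alpha> r T X XX \<and> 0 \<le> N \<and>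
    controlled_bounds \<alpha> \<kappa> N T X v v' \<and>
    (\<forall>t\<in>{0..T}. has_rough_integral (B (\<kappa> - 2 * \<alpha>)) S X XX v v' t (J t)) \<and>
    0 \<le> s \<and> s < t \<and> t \<le> T \<longrightarrow>
    J t - S (t - s) (J s) - S (t - s) (compensated_increment X XX v v' s t) \<in> car (B (\<kappa> - 2 * \<alpha> + e)) \<and>
    nrm (B (\<kappa> - 2 * \<alpha> + e)) (J t - S (t - s) (J s) - S (t - s) (compensated_increment X XX v v' s t))
      \<le> C * N * (t - s) powr (3 * \<alpha> - e)"
proof -
  let ?\<theta> = "\<kappa> - 2 * \<alpha>"
  obtain C1 where "C1 > 0" and C1: "\<And>T X XX v v' N. T \<le> T\<^sub>0 \<Longrightarrow> rough_bounds \<alpha> r T X XX \<Longrightarrow> 0 \<le> N \<Longrightarrow>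
    controlled_bounds \<alpha> \<kappa> N T X v v' \<Longrightarrow>
    almost_additive ?\<theta> (3 * \<alpha>) (C1 * N) 0 T (compensated_increment X XX v v')"
  proof -
    have "0 < \<alpha>"
      using \<alpha> by simp
    from compensated_increment_almost_additive[OF this \<alpha>(2) r T\<^sub>0, of \<kappa>] show thesis
      using that by metis
  qed
  obtain C2 where "C2 > 0" and C2: "\<And>T \<xi> J K s t. T \<le> T\<^sub>0 \<Longrightarrow> 0 \<le> K \<Longrightarrow>
    almost_additive ?\<theta> (3 * \<alpha>) K 0 T \<xi> \<Longrightarrow> mild_integral_of ?\<theta> T \<xi> J \<Longrightarrow> 0 \<le> s \<Longrightarrow> s < t \<Longrightarrow> t \<le> T \<Longrightarrow>
    J t - S (t - s) (J s) - S (t - s) (\<xi> s t) \<in> car (B (?\<theta> + e)) \<and>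
    nrm (B (?\<theta> + e)) (J t - S (t - s) (J s) - S (t - s) (\<xi> s t)) \<le> C2 * K * (t - s) powr (3 * \<alpha> - e)"
  proof -
    have "1 < 3 * \<alpha>" "e \<le> 2"
      using \<alpha> e by auto
    from sewing_gain[OF this(1) e(1) this(2) e(2) T\<^sub>0, of ?\<theta>] show thesis
      using that by metis
  qed
  have "J t - S (t - s) (J s) - S (t - s) (compensated_increment X XX v v' s t) \<in> car (B (?\<theta> + e)) \<and>
      nrm (B (?\<theta> + e)) (J t - S (t - s) (J s) - S (t - s) (compensated_increment X XX v v' s t))
      \<le> C2 * C1 * N * (t - s) powr (3 * \<alpha> - e)"
    if T: "T \<le> T\<^sub>0" and X: "rough_bounds \<alpha> r T X XX" and N: "0 \<le> N"
    and v: "controlled_bounds \<alpha> \<kappa> N T X v v'"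
    and J: "\<forall>t\<in>{0..T}. has_rough_integral (B ?\<theta>) S X XX v v' t (J t)"
    and st: "0 \<le> s" "s < t" "t \<le> T" for T X XX v v' N J s t
  proof -
    have mem: "v t \<in> car (B ?\<theta>) \<and> v' t \<in> car (B ?\<theta>)" if "0 \<le> t" "t \<le> T" for t
      using v that \<alpha> scale_mem[of _ \<kappa> ?\<theta>] scale_mem[of _ "\<kappa> - \<alpha>" ?\<theta>]
      by (auto simp: controlled_bounds_def)
    have "XX 0 0 = 0"
      using rough_bounds_diagonal[OF X] st by simp
    then have "mild_integral_of ?\<theta> T (compensated_increment X XX v v') J"
      unfolding mild_integral_of_def using J mem
      by (auto simp: has_rough_integral_def[of "B ?\<theta>"] intro!: rough_integral_grid_sum)
    moreover have "0 \<le> C1 * N"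
      using N \<open>C1 > 0\<close> by simp
    ultimately show ?thesis
      using C2[OF T _ C1[OF T X N v] _ st] by (simp add: mult.assoc)
  qed
  moreover have "C2 * C1 > 0"
    using \<open>C1 > 0\<close> \<open>C2 > 0\<close> by simp
  ultimately show ?thesis
    by (intro exI[of _ "C2 * C1"]) auto
qed

end

section \<open>Deterministic convolutions\<close>

lemma sets_restrict_lborel_Icc:
  "A \<in> sets (restrict_space lborel {a..b::real}) \<longleftrightarrow> A \<subseteq> {a..b} \<and> A \<in> sets borel"
  by (subst sets_restrict_space_iff) auto

lemma measure_restrict_lborel_Icc:
  "A \<subseteq> {a..b::real} \<Longrightarrow> measure (restrict_space lborel {a..b}) A = measure lborel A"
  by (subst measure_restrict_space) auto

lemma simple_bochner_integrable_Icc: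
  assumes "simple_function (restrict_space lborel {a..b::real}) f"
  shows "Bochner_Integration.simple_bochner_integrable (restrict_space lborel {a..b}) f"
proof (rule simple_bochner_integrable.intros[OF assms])
  let ?M = "restrict_space lborel {a..b}"
  have "emeasure ?M {y \<in> space ?M. f y \<noteq> 0} \<le> emeasure ?M (space ?M)"
    by (rule emeasure_space)
  also have "\<dots> < \<infinity>"
    by (cases "a \<le> b") (simp_all add: emeasure_restrict_space space_restrict_space)
  finally show "emeasure ?M {y \<in> space ?M. f y \<noteq> 0} \<noteq> \<infinity>"
    by simp
qed

text \<open>
  The triangle inequality for the integral of a simple function, in a norm that is only defined on a
  subspace.
\<close>

lemma simple_bochner_integral_nspace:
  assumes E: "normed_nspace E" and h: "Bochner_Integration.simple_bochner_integrable M h"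
    and mem: "h ` space M \<subseteq> car E"
  shows "Bochner_Integration.simple_bochner_integral M h \<in> car E"
    and "ennreal (nrm E (Bochner_Integration.simple_bochner_integral M h))
      \<le> (\<integral>\<^sup>+x. ennreal (nrm E (h x)) \<partial>M)"
proof -
  let ?m = "\<lambda>y. measure M {x \<in> space M. h x = y}"
  have scaled: "?m y *\<^sub>R y \<in> car E" if "y \<in> h ` space M" for y
    using mem that by (intro car_scaleR[OF E]) auto
  show "Bochner_Integration.simple_bochner_integral M h \<in> car E"
    unfolding simple_bochner_integral_def by (rule car_sum[OF E scaled])
  \<comment> \<open>The norm is arbitrary off the carrier; \<open>c\<close> is nonnegative everywhere and vanishes at \<open>0\<close>.\<close>
  define c where "c y = (if y = 0 then 0 else \<bar>nrm E y\<bar>)" for y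
  have c: "c y = nrm E y" if "y \<in> car E" for y
    using that nrm_nonneg[OF E that] nrm_0[OF E] by (simp add: c_def)
  have ch: "Bochner_Integration.simple_bochner_integrable M (\<lambda>x. c (h x))"
    using simple_bochner_integrable_compose2[of "\<lambda>x y. c x" M h h] h by (simp add: c_def)
  have "nrm E (Bochner_Integration.simple_bochner_integral M h) \<le> (\<Sum>y\<in>h ` space M. nrm E (?m y *\<^sub>R y))"
    unfolding simple_bochner_integral_def by (rule nrm_sum[OF E scaled])
  also have "\<dots> = (\<Sum>y\<in>h ` space M. ?m y *\<^sub>R c y)"
    using mem by (intro sum.cong refl) (auto simp: nrm_scaleR[OF E] c subset_iff)
  also have "\<dots> = Bochner_Integration.simple_bochner_integral M (\<lambda>x. c (h x))"
    using h by (intro simple_bochner_integral_partition[symmetric] ch)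
      (auto elim: simple_bochner_integrable.cases)
  finally have "ennreal (nrm E (Bochner_Integration.simple_bochner_integral M h))
      \<le> ennreal (Bochner_Integration.simple_bochner_integral M (\<lambda>x. c (h x)))"
    by (rule ennreal_leI)
  also have "\<dots> = (\<integral>\<^sup>+x. ennreal (c (h x)) \<partial>M)"
    by (intro simple_bochner_integral_eq_nn_integral ch) (simp add: c_def)
  also have "\<dots> = (\<integral>\<^sup>+x. ennreal (nrm E (h x)) \<partial>M)"
    using mem by (intro nn_integral_cong) (auto simp: c)
  finally show "ennreal (nrm E (Bochner_Integration.simple_bochner_integral M h))
      \<le> (\<integral>\<^sup>+x. ennreal (nrm E (h x)) \<partial>M)" .
qed

text \<open>
  On each of the finitely many sets where \<open>a\<close> is constant, a sublevel set of this function is the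
  preimage of a ball under \<open>f\<close>.
\<close>

lemma nrm_diff_simple_measurable:
  assumes E: "normed_nspace E"
    and f: "f \<in> measurable M (sigma (car E) {U. openin (ntop E) U})"
    and a: "simple_function M a" "a ` space M \<subseteq> car E"
  shows "(\<lambda>x. nrm E (f x - a x)) \<in> borel_measurable M"
proof -
  have Pow: "{U. openin (ntop E) U} \<subseteq> Pow (car E)"
    using topspace_ntop[OF E] openin_subset by fastforce
  have space: "f x \<in> car E" if "x \<in> space M" for x
    using measurable_space[OF f that] Pow by (simp add: space_measure_of)
  have "{x \<in> space M. nrm E (f x - a x) < c} \<in> sets M" for c
  proof -
    have eq: "{x \<in> space M. nrm E (f x - a x) < c}
        = (\<Union>y\<in>a ` space M. (f -` {z \<in> car E. nrm E (z - y) < c} \<inter> space M) \<inter> (a -` {y} \<inter> space M))"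
      using space by auto
    show ?thesis
      unfolding eq
    proof (rule sets.finite_UN)
      show "finite (a ` space M)"
        using a(1) by (simp add: simple_function_def)
      fix y assume y: "y \<in> a ` space M"
      then have "a -` {y} \<inter> space M \<in> sets M"
        using a(1) by (auto simp: simple_function_def)
      moreover have "f -` {z \<in> car E. nrm E (z - y) < c} \<inter> space M \<in> sets M"
        using openin_ntop_ball[OF E, of y c] Pow y a(2)
        by (intro measurable_sets[OF f]) (auto simp: sets_measure_of)
      ultimately show "(f -` {z \<in> car E. nrm E (z - y) < c} \<inter> space M) \<inter> (a -` {y} \<inter> space M) \<in> sets M"
        by (rule sets.Int[rotated])
    qed
  qed
  then show ?thesis
    by (simp add: borel_measurable_iff_less)
qed

context smoothing_scale
begin

lemma simple_bochner_integral_extend: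
  fixes s t \<tau> :: real
  assumes s: "0 \<le> s" "s \<le> t" and \<tau>: "0 \<le> \<tau>"
    and b: "simple_function (restrict_space lborel {0..s}) b" "b ` {0..s} \<subseteq> car (B \<theta>)"
  defines "g \<equiv> (\<lambda>r. if r \<le> s then S \<tau> (b r) else 0)"
  shows "simple_function (restrict_space lborel {0..t}) g"
    and "Bochner_Integration.simple_bochner_integral (restrict_space lborel {0..t}) g
      = S \<tau> (Bochner_Integration.simple_bochner_integral (restrict_space lborel {0..s}) b)"
proof -
  let ?M = "\<lambda>t. restrict_space lborel {0..t::real}"
  \<comment> \<open>\<open>None\<close> marks the added interval, so that it is not confused with a set where \<open>b\<close> is zero.\<close>
  define \<phi> where "\<phi> r = (if r \<le> s then Some (b r) else None)" for r
  define v where "v z = (case z of None \<Rightarrow> 0 | Some y \<Rightarrow> S \<tau> y)" for z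
  have g: "g = (\<lambda>r. v (\<phi> r))"
    by (auto simp: g_def v_def \<phi>_def)
  have space: "space (?M t) = {0..t}" for t
    by (simp add: space_restrict_space)
  have pre: "b -` {y} \<inter> {0..s} \<in> sets borel" for y
  proof (cases "y \<in> b ` {0..s}")
    case True
    then show ?thesis
      using b(1) unfolding simple_function_def space by (auto simp: sets_restrict_lborel_Icc)
  next
    case False
    then have "b -` {y} \<inter> {0..s} = {}"
      by auto
    then show ?thesis
      by simp
  qed
  have fin: "finite (b ` {0..s})"
    using b(1) unfolding simple_function_def space by auto
  have preSome: "{r \<in> {0..t}. \<phi> r = Some y} = b -` {y} \<inter> {0..s}" for y
    using s by (auto simp: \<phi>_def)
  have preNone: "{r \<in> {0..t}. \<phi> r = None} = {s<..t}"
    using s by (auto simp: \<phi>_def)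
  have img: "\<phi> ` {0..t} = Some ` b ` {0..s} \<union> (if s < t then {None} else {})"
  proof -
    have "\<phi> ` {0..s} = Some ` b ` {0..s}"
      unfolding image_image by (rule image_cong) (auto simp: \<phi>_def)
    moreover have "\<phi> ` {s<..t} = (if s < t then {None} else {})"
      by (auto simp: \<phi>_def image_iff)
    moreover have "{0..t} = {0..s} \<union> {s<..t}"
      using s by auto
    ultimately show ?thesis
      by (simp only: image_Un)
  qed
  have \<phi>: "simple_function (?M t) \<phi>"
    unfolding simple_function_def space
  proof (intro conjI ballI)
    show "finite (\<phi> ` {0..t})"
      using fin by (simp add: img)
    fix z
    show "\<phi> -` {z} \<inter> {0..t} \<in> sets (?M t)"
    proof (cases z)
      case None
      then have "\<phi> -` {z} \<inter> {0..t} = {s<..t}"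
        unfolding preNone[symmetric] by auto
      then show ?thesis
        using s by (auto simp: sets_restrict_lborel_Icc)
    next
      case (Some y)
      then have "\<phi> -` {z} \<inter> {0..t} = b -` {y} \<inter> {0..s}"
        unfolding preSome[symmetric] by auto
      then show ?thesis
        using s pre[of y] by (auto simp: sets_restrict_lborel_Icc)
    qed
  qed
  show gs: "simple_function (?M t) g"
    unfolding g by (rule simple_function_compose1[OF \<phi>])
  have "Bochner_Integration.simple_bochner_integral (?M t) g
      = (\<Sum>z\<in>\<phi> ` space (?M t). measure (?M t) {r \<in> space (?M t). \<phi> r = z} *\<^sub>R v z)"
    by (rule simple_bochner_integral_partition[OF simple_bochner_integrable_Icc[OF gs] \<phi>])
      (unfold g, simp_all)
  also have "\<dots> = (\<Sum>z\<in>\<phi> ` {0..t}. measure (?M t) {r \<in> {0..t}. \<phi> r = z} *\<^sub>R v z)"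
    by (simp only: space)
  also have "\<dots> = (\<Sum>z\<in>Some ` b ` {0..s}. measure (?M t) {r \<in> {0..t}. \<phi> r = z} *\<^sub>R v z)"
  proof (rule sum.mono_neutral_right)
    show "finite (\<phi> ` {0..t})"
      using \<phi> unfolding simple_function_def space by blast
    show "Some ` b ` {0..s} \<subseteq> \<phi> ` {0..t}"
      unfolding img by blast
    have "v z = 0" if "z \<in> \<phi> ` {0..t} - Some ` b ` {0..s}" for z
      using that unfolding img v_def by (cases "s < t") auto
    then show "\<forall>z\<in>\<phi> ` {0..t} - Some ` b ` {0..s}. measure (?M t) {r \<in> {0..t}. \<phi> r = z} *\<^sub>R v z = 0"
      by (metis scaleR_zero_right)
  qed
  also have "\<dots> = (\<Sum>y\<in>b ` {0..s}. measure (?M t) (b -` {y} \<inter> {0..s}) *\<^sub>R S \<tau> y)"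
    by (subst sum.reindex) (simp_all add: v_def preSome del: mem_Collect_eq atLeastAtMost_iff)
  also have "\<dots> = (\<Sum>y\<in>b ` {0..s}. S \<tau> (measure (?M s) {r \<in> {0..s}. b r = y} *\<^sub>R y))"
  proof (rule sum.cong[OF refl])
    fix y assume "y \<in> b ` {0..s}"
    moreover have "{r \<in> {0..s}. b r = y} = b -` {y} \<inter> {0..s}"
      by auto
    moreover have "b -` {y} \<inter> {0..s} \<subseteq> {0..t}"
      using s by auto
    ultimately show "measure (?M t) (b -` {y} \<inter> {0..s}) *\<^sub>R S \<tau> y
        = S \<tau> (measure (?M s) {r \<in> {0..s}. b r = y} *\<^sub>R y)"
      using b(2) \<tau> by (subst S_scaleR[of _ _ \<theta>]) (auto simp: measure_restrict_lborel_Icc)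
  qed
  also have "\<dots> = S \<tau> (Bochner_Integration.simple_bochner_integral (?M s) b)"
    unfolding simple_bochner_integral_def space using b(2) \<tau>
    by (intro S_sum[of _ _ _ \<theta>, symmetric]) auto
  finally show "Bochner_Integration.simple_bochner_integral (?M t) g
      = S \<tau> (Bochner_Integration.simple_bochner_integral (?M s) b)" .
qed

text \<open>
  On \<open>[0, s]\<close> the integrand of \<open>It\<close> is \<open>S (t - s)\<close> applied to that of \<open>Is\<close>, so only the integral over \<open>[s, t]\<close>
  remains.  The comparison is made for the approximating simple functions; \<open>S (t - s)\<close> commutes
  with the integrals of those for \<open>Is\<close> because it is linear on the carrier.
\<close>

lemma bochner_convolution_increment:
  assumes It: "has_bochner_integral_in (B \<theta>) (restrict_space lborel {0..t}) (\<lambda>r. S (t - r) (f r)) It"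
    and Is: "has_bochner_integral_in (B \<theta>) (restrict_space lborel {0..s}) (\<lambda>r. S (s - r) (f r)) Is"
    and st: "0 \<le> s" "s < t" and f: "\<And>r. 0 \<le> r \<Longrightarrow> r \<le> t \<Longrightarrow> f r \<in> car (B \<theta>)"
    and K: "\<And>r. s \<le> r \<Longrightarrow> r \<le> t \<Longrightarrow> nrm (B \<theta>) (S (t - r) (f r)) \<le> K"
  shows "nrm (B \<theta>) (It - S (t - s) Is) \<le> K * (t - s)"
proof -
  let ?M = "\<lambda>t. restrict_space lborel {0..t::real}" and ?E = "B \<theta>"
  let ?I = "\<lambda>t. Bochner_Integration.simple_bochner_integral (?M t)"
  have space: "space (?M t) = {0..t}" for t
    by (simp add: space_restrict_space)
  have K0: "0 \<le> K"
    using K[of t] f[of t] st nrm_nonneg[OF nsp, of "S (t - t) (f t)" \<theta>] S_mem[of "t - t" "f t" \<theta>] by linarith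
  obtain a where a: "\<And>i. Bochner_Integration.simple_bochner_integrable (?M t) (a i)" "\<And>i. a i ` {0..t} \<subseteq> car ?E"
    and a0: "(\<lambda>i. \<integral>\<^sup>+r. ennreal (nrm ?E (S (t - r) (f r) - a i r)) \<partial>?M t) \<longlonglongrightarrow> 0"
    and aI: "limitin (ntop ?E) (\<lambda>i. ?I t (a i)) It sequentially"
    using It unfolding has_bochner_integral_in_def space by blast
  obtain b where b: "\<And>i. Bochner_Integration.simple_bochner_integrable (?M s) (b i)" "\<And>i. b i ` {0..s} \<subseteq> car ?E"
    and b0: "(\<lambda>i. \<integral>\<^sup>+r. ennreal (nrm ?E (S (s - r) (f r) - b i r)) \<partial>?M s) \<longlonglongrightarrow> 0"
    and bI: "limitin (ntop ?E) (\<lambda>i. ?I s (b i)) Is sequentially"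
    using Is unfolding has_bochner_integral_in_def space by blast
  have as: "simple_function (?M t) (a i)" and bs: "simple_function (?M s) (b i)" for i
    using a(1)[of i] b(1)[of i] by (auto elim: simple_bochner_integrable.cases)
  have mem: "It \<in> car ?E" "Is \<in> car ?E" "?I t (a i) \<in> car ?E" "?I s (b i) \<in> car ?E" for i
    using aI bI simple_bochner_integral_nspace(1)[OF nsp a(1)[of i]] simple_bochner_integral_nspace(1)[OF nsp b(1)[of i]]
      a(2)[of i] b(2)[of i] by (auto simp: limitin_ntop[OF nsp] space)
  obtain c where "c > 0" and c: "\<And>x. x \<in> car ?E \<Longrightarrow> nrm ?E (S (t - s) x) \<le> c * nrm ?E x"
    using S_bounded[of "t - s" \<theta>] st by auto
  have meas: "(\<lambda>r. ennreal (nrm ?E (S (t - r) (f r) - a i r))) \<in> borel_measurable (?M t)"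
      "(\<lambda>r. ennreal (nrm ?E (S (s - r) (f r) - b i r))) \<in> borel_measurable (?M s)" for i
    using nrm_diff_simple_measurable[OF nsp _ as] nrm_diff_simple_measurable[OF nsp _ bs] a(2) b(2) It Is
    unfolding has_bochner_integral_in_def space by (auto intro!: measurable_compose[OF _ measurable_ennreal])
  have main: "ennreal (nrm ?E (?I t (a i) - S (t - s) (?I s (b i))))
      \<le> (\<integral>\<^sup>+r. ennreal (nrm ?E (S (t - r) (f r) - a i r)) \<partial>?M t)
        + ennreal c * (\<integral>\<^sup>+r. ennreal (nrm ?E (S (s - r) (f r) - b i r)) \<partial>?M s) + ennreal (K * (t - s))" for i
  proof -
    define g where "g r = (if r \<le> s then S (t - s) (b i r) else 0)" for r
    have gs: "simple_function (?M t) g" and gI: "?I t g = S (t - s) (?I s (b i))"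
      unfolding g_def using st by (intro simple_bochner_integral_extend[OF _ _ _ bs b(2)]; simp)+
    have gm: "g r \<in> car ?E" if "r \<in> {0..t}" for r
      using that b(2)[of i] st by (auto simp: g_def image_subset_iff)
    define h where "h r = a i r - g r" for r
    have hs: "Bochner_Integration.simple_bochner_integrable (?M t) h"
      unfolding h_def by (intro simple_bochner_integrable_Icc simple_function_compose2[OF as gs])
    have hI: "?I t h = ?I t (a i) - S (t - s) (?I s (b i))"
      unfolding h_def gI[symmetric] by (intro simple_bochner_integral_diff a simple_bochner_integrable_Icc gs)
    have hm: "h ` {0..t} \<subseteq> car ?E"
      using gm a(2)[of i] by (auto simp: h_def)
    define u where "u r = ennreal (nrm ?E (S (t - r) (f r) - a i r))" for r
    define w where "w r = ennreal (nrm ?E (S (s - r) (f r) - b i r)) * indicator {0..s} r" for r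
    have u: "u \<in> borel_measurable (?M t)"
      unfolding u_def by (rule meas)
    have "w \<in> borel_measurable lborel"
      unfolding w_def using meas(2)[of i]
      by (subst (asm) borel_measurable_restrict_space_iff_ennreal) simp_all
    then have w: "w \<in> borel_measurable (?M t)"
      by (rule measurable_restrict_space1)
    have point: "ennreal (nrm ?E (h r)) \<le> u r + ennreal c * w r + ennreal K * indicator {s<..t} r"
      if r: "r \<in> {0..t}" for r
    proof (cases "r \<le> s")
      case True
      have bm: "b i r \<in> car ?E" and am: "a i r \<in> car ?E" and fr: "f r \<in> car ?E"
        using b(2)[of i] a(2)[of i] r True f by auto
      have "S (t - r) (f r) = S (t - s) (S (s - r) (f r))"
        using st r True fr by (intro S_comp[symmetric, of _ _ _ _ \<theta>]) auto
      then have "h r = S (t - s) (S (s - r) (f r) - b i r) - (S (t - r) (f r) - a i r)"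
        using True S_diff[of "t - s" "S (s - r) (f r)" \<theta> "b i r"] st bm fr by (simp add: h_def g_def)
      then have "nrm ?E (h r) \<le> nrm ?E (S (t - s) (S (s - r) (f r) - b i r)) + nrm ?E (S (t - r) (f r) - a i r)"
        using nrm_diff[OF nsp, of "S (t - s) (S (s - r) (f r) - b i r)" \<theta> "S (t - r) (f r) - a i r"]
          st True r bm am fr by auto
      also have "nrm ?E (S (t - s) (S (s - r) (f r) - b i r)) \<le> c * nrm ?E (S (s - r) (f r) - b i r)"
        using True bm fr by (intro c) auto
      finally have "ennreal (nrm ?E (h r))
          \<le> ennreal (c * nrm ?E (S (s - r) (f r) - b i r) + nrm ?E (S (t - r) (f r) - a i r))"
        by (rule ennreal_leI) simp
      also have "\<dots> = u r + ennreal c * w r"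
        using True r bm am fr \<open>c > 0\<close> by (simp add: u_def w_def ennreal_plus ennreal_mult add.commute)
      finally show ?thesis
        using True by simp
    next
      case False
      then have "nrm ?E (h r) = nrm ?E (S (t - r) (f r) - (S (t - r) (f r) - a i r))"
        by (simp add: h_def g_def)
      also have "\<dots> \<le> nrm ?E (S (t - r) (f r)) + nrm ?E (S (t - r) (f r) - a i r)"
        using r a(2)[of i] f[of r] by (intro nrm_diff[OF nsp]) (auto simp: image_subset_iff)
      also have "\<dots> \<le> K + nrm ?E (S (t - r) (f r) - a i r)"
        using K[of r] False r by simp
      finally have "ennreal (nrm ?E (h r)) \<le> ennreal (K + nrm ?E (S (t - r) (f r) - a i r))"
        by (rule ennreal_leI)
      also have "\<dots> = ennreal K + u r"
        using r a(2)[of i] f[of r] K0 by (auto simp: u_def image_subset_iff intro!: ennreal_plus ns_nonneg)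
      finally show ?thesis
        using False r by (simp add: w_def add.commute)
    qed
    have "ennreal (nrm ?E (?I t h)) \<le> (\<integral>\<^sup>+r. ennreal (nrm ?E (h r)) \<partial>?M t)"
      using hm by (intro simple_bochner_integral_nspace(2)[OF nsp hs]) (simp add: space)
    also have "\<dots> \<le> (\<integral>\<^sup>+r. u r + ennreal c * w r + ennreal K * indicator {s<..t} r \<partial>?M t)"
      by (intro nn_integral_mono point) (simp add: space)
    also have "\<dots> = (\<integral>\<^sup>+r. u r \<partial>?M t) + ennreal c * (\<integral>\<^sup>+r. w r \<partial>?M t)
        + ennreal K * (\<integral>\<^sup>+r. indicator {s<..t} r \<partial>?M t)"
      using u w by (simp add: nn_integral_add nn_integral_cmult measurable_restrict_space1)
    also have "(\<integral>\<^sup>+r. w r \<partial>?M t) = (\<integral>\<^sup>+r. ennreal (nrm ?E (S (s - r) (f r) - b i r)) \<partial>?M s)"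
    proof -
      have "(\<integral>\<^sup>+r. w r \<partial>?M t) = (\<integral>\<^sup>+r. w r * indicator {0..t} r \<partial>lborel)"
        by (simp add: nn_integral_restrict_space)
      also have "\<dots> = (\<integral>\<^sup>+r. ennreal (nrm ?E (S (s - r) (f r) - b i r)) * indicator {0..s} r \<partial>lborel)"
        using st by (intro nn_integral_cong) (auto simp: w_def indicator_def)
      finally show ?thesis
        by (simp add: nn_integral_restrict_space)
    qed
    also have "(\<integral>\<^sup>+r. indicator {s<..t} r \<partial>?M t) = ennreal (t - s)"
    proof -
      have "(\<integral>\<^sup>+r. indicator {s<..t} r \<partial>?M t) = (\<integral>\<^sup>+r. indicator {s<..t} r * indicator {0..t} r \<partial>lborel)"
        by (rule nn_integral_restrict_space) simp
      also have "\<dots> = (\<integral>\<^sup>+r. indicator {s<..t} r \<partial>lborel)"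
        using st by (intro nn_integral_cong) (auto simp: indicator_def)
      finally have "(\<integral>\<^sup>+r. indicator {s<..t} r \<partial>?M t) = (\<integral>\<^sup>+r. indicator {s<..t} r \<partial>lborel)" .
      then show ?thesis
        using st by simp
    qed
    finally show ?thesis
      using K0 st by (simp add: hI u_def ennreal_mult)
  qed
  show ?thesis
  proof (rule field_le_epsilon)
    fix \<epsilon> :: real assume "\<epsilon> > 0"
    define \<epsilon>' where "\<epsilon>' = \<epsilon> / (2 + 2 * c)"
    have \<epsilon>': "\<epsilon>' > 0" "(2 + 2 * c) * \<epsilon>' = \<epsilon>"
      using \<open>\<epsilon> > 0\<close> \<open>c > 0\<close> by (auto simp: \<epsilon>'_def)
    have "eventually (\<lambda>i. (\<integral>\<^sup>+r. ennreal (nrm ?E (S (t - r) (f r) - a i r)) \<partial>?M t) < ennreal \<epsilon>') sequentially"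
      using order_tendstoD(2)[OF a0, of "ennreal \<epsilon>'"] \<epsilon>' by simp
    moreover have "eventually (\<lambda>i. (\<integral>\<^sup>+r. ennreal (nrm ?E (S (s - r) (f r)
        - b i r)) \<partial>?M s) < ennreal \<epsilon>') sequentially"
      using order_tendstoD(2)[OF b0, of "ennreal \<epsilon>'"] \<epsilon>' by simp
    moreover have "eventually (\<lambda>i. nrm ?E (?I t (a i) - It) < \<epsilon>') sequentially"
      using aI \<epsilon>' by (auto simp: limitin_ntop[OF nsp] elim: eventually_mono)
    moreover have "eventually (\<lambda>i. nrm ?E (?I s (b i) - Is) < \<epsilon>') sequentially"
      using bI \<epsilon>' by (auto simp: limitin_ntop[OF nsp] elim: eventually_mono)
    ultimately have "eventually (\<lambda>i. nrm ?E (It - S (t - s) Is) \<le> K * (t - s) + \<epsilon>) sequentially"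
    proof eventually_elim
      case (elim i)
      let ?A = "?I t (a i)" and ?Sb = "S (t - s) (?I s (b i))"
      have m: "?A - ?Sb \<in> car ?E"
        using mem st by auto
      have "ennreal (nrm ?E (?A - ?Sb)) \<le> ennreal \<epsilon>' + ennreal c * ennreal \<epsilon>' + ennreal (K * (t - s))"
        using elim by (intro order_trans[OF main] add_mono mult_left_mono) auto
      also have "\<dots> = ennreal (\<epsilon>' + c * \<epsilon>' + K * (t - s))"
        using \<epsilon>' \<open>c > 0\<close> K0 st by (simp add: ennreal_plus ennreal_mult)
      finally have 1: "nrm ?E (?A - ?Sb) \<le> \<epsilon>' + c * \<epsilon>' + K * (t - s)"
        using \<epsilon>' \<open>c > 0\<close> K0 st by (subst (asm) ennreal_le_iff) auto
      have 2: "nrm ?E (S (t - s) (?I s (b i) - Is)) \<le> c * \<epsilon>'"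
        using c[of "?I s (b i) - Is"] mem elim \<open>c > 0\<close> mult_left_mono[of "nrm ?E (?I s (b i) - Is)" \<epsilon>' c]
        by (auto intro: order_trans)
      have eq: "It - S (t - s) Is = (?A - ?Sb) + S (t - s) (?I s (b i) - Is) - (?A - It)"
        using S_diff[of "t - s" "?I s (b i)" \<theta> Is] mem st by simp
      have m2: "S (t - s) (?I s (b i) - Is) \<in> car ?E" "?A - It \<in> car ?E"
        using mem st by auto
      have "nrm ?E (It - S (t - s) Is)
          \<le> nrm ?E (?A - ?Sb) + nrm ?E (S (t - s) (?I s (b i) - Is)) + nrm ?E (?A - It)"
        unfolding eq using nrm_diff[OF nsp ns_add[OF m m2(1)] m2(2)] nrm_add[OF nsp m m2(1)] by linarith
      also have "\<dots> \<le> K * (t - s) + (2 + 2 * c) * \<epsilon>'"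
        using 1 2 elim by (simp add: algebra_simps)
      finally show ?case
        by (simp add: \<epsilon>')
    qed
    then show "nrm ?E (It - S (t - s) Is) \<le> K * (t - s) + \<epsilon>"
      by simp
  qed
qed

definition drift_integral_of where
  "drift_integral_of \<theta> T f I \<longleftrightarrow> (\<forall>t\<in>{0..T}. has_bochner_integral_in (B \<theta>)
     (restrict_space lborel {0..t}) (\<lambda>r. S (t - r) (f r)) (I t))"

text \<open>
  The increment over \<open>[s, t]\<close> is the one over \<open>[m, t]\<close> plus \<open>S (t - m)\<close> of the one over \<open>[s, m]\<close>.  This
  is the halving property with \<open>p = 1\<close>, so the same argument as for the rough convolution raises the
  regularity, and the integrand need not be estimated in the better space.
\<close>

lemma drift_convolution_bound:
  assumes e: "0 \<le> e" "e < 1" and T\<^sub>0: "0 < T\<^sub>0"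
  shows "\<exists>C>0. \<forall>T f I K s t. T \<le> T\<^sub>0 \<and> 0 \<le> K \<and>
    (\<forall>r\<in>{0..T}. f r \<in> car (B \<theta>) \<and> nrm (B \<theta>) (f r) \<le> K) \<and>
    drift_integral_of \<theta> T f I \<and> 0 \<le> s \<and> s < t \<and> t \<le> T \<longrightarrow>
    I t - S (t - s) (I s) \<in> car (B (\<theta> + e)) \<and>
    nrm (B (\<theta> + e)) (I t - S (t - s) (I s)) \<le> C * K * (t - s) powr (1 - e)"
proof -
  obtain C1 where "C1 > 0" and C1: "\<And>t x. t \<in> {0..T\<^sub>0} \<Longrightarrow> x \<in> car (B \<theta>) \<Longrightarrow>
      nrm (B \<theta>) (S t x) \<le> C1 * nrm (B \<theta>) x"
    using S_bounded[OF T\<^sub>0, of \<theta>] by meson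
  obtain C2 where "C2 > 0" and C2: "\<And>t K s\<^sub>0 W. \<lbrakk>t \<in> {0..T\<^sub>0}; K \<ge> 0; s\<^sub>0 \<in> {0..<t};
    halving_decay \<theta> 1 K s\<^sub>0 t W\<rbrakk> \<Longrightarrow>
    W s\<^sub>0 \<in> car (B (\<theta> + e)) \<and> nrm (B (\<theta> + e)) (W s\<^sub>0) \<le> C2 * K * (t - s\<^sub>0) powr (1 - e)"
  proof -
    have "e \<le> 2"
      using e by simp
    from smoothing_gain[OF e(1) this e(2) T\<^sub>0, of \<theta>] show thesis
      using that by metis
  qed
  have "I t - S (t - s) (I s) \<in> car (B (\<theta> + e)) \<and>
      nrm (B (\<theta> + e)) (I t - S (t - s) (I s)) \<le> C2 * C1 * K * (t - s) powr (1 - e)"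
    if T: "T \<le> T\<^sub>0" and K: "0 \<le> K" and f: "\<forall>r\<in>{0..T}. f r \<in> car (B \<theta>) \<and> nrm (B \<theta>) (f r) \<le> K"
    and int: "drift_integral_of \<theta> T f I" and st: "0 \<le> s" "s < t" "t \<le> T" for T f I K s t
  proof -
    note I = int[unfolded drift_integral_of_def]
    have Imem: "I r \<in> car (B \<theta>)" if "r \<in> {0..T}" for r
      using I that by (auto simp: has_bochner_integral_in_def limitin_ntop[OF nsp])
    have inc: "nrm (B \<theta>) (I w - S (w - u) (I u)) \<le> C1 * K * (w - u)" if "0 \<le> u" "u < w" "w \<le> T" for u w
    proof (rule bochner_convolution_increment[of \<theta> w f "I w" u "I u"])
      fix r assume r: "u \<le> r" "r \<le> w"
      then have "nrm (B \<theta>) (S (w - r) (f r)) \<le> C1 * nrm (B \<theta>) (f r)"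
        using that T f by (intro C1) auto
      also have "\<dots> \<le> C1 * K"
        using f r that \<open>C1 > 0\<close> by simp
      finally show "nrm (B \<theta>) (S (w - r) (f r)) \<le> C1 * K" .
    qed (use that I f in auto)
    have "I t - S (t - s) (I s) \<in> car (B (\<theta> + e)) \<and>
        nrm (B (\<theta> + e)) (I t - S (t - s) (I s)) \<le> C2 * (C1 * K) * (t - s) powr (1 - e)"
    proof (rule C2[where W = "\<lambda>r. I t - S (t - r) (I r)"])
      show "halving_decay \<theta> 1 (C1 * K) s t (\<lambda>r. I t - S (t - r) (I r))"
        unfolding halving_decay_def
      proof
        fix r assume r: "r \<in> {s..<t}"
        define m where "m = (r + t) / 2"
        have m: "0 \<le> r" "r < m" "m < t" "m \<le> T" "r < t" "t - m = (t - r) / 2"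
          using r st by (auto simp: m_def field_simps)
        have mem: "I r \<in> car (B \<theta>)" "I m \<in> car (B \<theta>)" "I t \<in> car (B \<theta>)"
          using m st by (auto intro!: Imem)
        define g where "g = I m - S (m - r) (I r)"
        have g: "g \<in> car (B \<theta>)"
          using mem m by (auto simp: g_def)
        have "S (t - m) g = S (t - m) (I m) - S (t - r) (I r)"
          unfolding g_def using m mem S_diff[of "t - m" "I m" \<theta> "S (m - r) (I r)"]
            S_comp[of "t - m" "m - r" "t - r" "I r" \<theta>] by auto
        then have "I t - S (t - r) (I r) = (I t - S (t - m) (I m)) + S ((t - r) / 2) g"
          by (simp flip: m(6))
        moreover have "nrm (B \<theta>) g \<le> C1 * K * (t - r) powr 1"
        proof -
          have "nrm (B \<theta>) g \<le> C1 * K * (m - r)"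
            unfolding g_def using m by (intro inc) auto
          also have "\<dots> \<le> C1 * K * (t - r)"
            using m K \<open>C1 > 0\<close> by (intro mult_left_mono) auto
          finally show ?thesis
            using m by simp
        qed
        moreover have "nrm (B \<theta>) (I t - S (t - r) (I r)) \<le> C1 * K * (t - r) powr 1"
          using inc[of r t] m st by simp
        moreover have "I t - S (t - r) (I r) \<in> car (B \<theta>)"
          using mem m by auto
        ultimately show "I t - S (t - r) (I r) \<in> car (B \<theta>) \<and>
            nrm (B \<theta>) (I t - S (t - r) (I r)) \<le> C1 * K * (t - r) powr 1 \<and>
            (\<exists>g\<in>car (B \<theta>). I t - S (t - r) (I r)
                = I t - S (t - (r + t) / 2) (I ((r + t) / 2)) + S ((t - r) / 2) g \<and>
              nrm (B \<theta>) g \<le> C1 * K * (t - r) powr 1)"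
          using g unfolding m_def by blast
      qed
      show "t \<in> {0..T\<^sub>0}" "C1 * K \<ge> 0" "s \<in> {0..<t}"
        using st T K \<open>C1 > 0\<close> by auto
    qed
    then show ?thesis
      by (simp add: mult.assoc)
  qed
  moreover have "C2 * C1 > 0"
    using \<open>C1 > 0\<close> \<open>C2 > 0\<close> by simp
  ultimately show ?thesis
    by (intro exI[of _ "C2 * C1"]) auto
qed

end

section \<open>Linear growth of the nonlinearity on controlled paths\<close>

context smoothing_scale
begin

text \<open>
  The last estimate is the decisive one.  A second order Taylor expansion of \<open>G\<close> would bound the
  remainder by the square of the increment \<open>h\<close>.  Instead, along the segment \<open>z = x + r h\<close> one writes
  \<open>DG(z) h - c DG(x) G(x) = DG(z) (h - c G(x)) + c (DG(z) G(x) - DG(x) G(x))\<close> and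
  \<open>DG(z) G(x) - DG(x) G(x) = (DG(z) G(z) - DG(x) G(x)) - DG(z) (G(z) - G(x))\<close>.
  Both differences on the right are Lipschitz in \<open>z - x\<close>, the first one because \<open>DG G\<close> has bounded derivative.
  So the bound is linear in \<open>h - c G(x)\<close> and in \<open>h\<close>; with \<open>h\<close> an increment of the path and \<open>c\<close> the
  increment of \<open>X\<close> these are its remainder and its increment.
\<close>

lemma assumption_G_estimates:
  assumes G: "assumption_G B \<alpha> \<gamma> \<sigma> G" and \<sigma>: "0 \<le> \<sigma>" "\<sigma> < \<alpha>"
  shows "\<exists>M>0.
    (\<forall>\<theta>\<in>{0, \<alpha>, 2 * \<alpha>}. \<forall>x\<in>car (B (\<gamma> - \<theta>)). G x \<in> car (B (\<gamma> - \<sigma> - \<theta>)) \<and>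
       (\<forall>y\<in>car (B (\<gamma> - \<theta>)). nrm (B (\<gamma> - \<sigma> - \<theta>)) (G y - G x) \<le> M * nrm (B (\<gamma> - \<theta>)) (y - x))) \<and>
    (\<forall>x\<in>car (B (\<gamma> - \<alpha>)). G x \<in> car (B (\<gamma> - \<alpha>)) \<longrightarrow> DGG B \<alpha> \<gamma> \<sigma> G x \<in> car (B (\<gamma> - \<sigma> - \<alpha>)) \<and>
       nrm (B (\<gamma> - \<sigma> - \<alpha>)) (DGG B \<alpha> \<gamma> \<sigma> G x) \<le> M * nrm (B (\<gamma> - \<alpha>)) (G x)) \<and>
    (\<forall>x\<in>car (B (\<gamma> - \<alpha>)). \<forall>y\<in>car (B (\<gamma> - \<alpha>)).
       nrm (B (\<gamma> - \<sigma> - 2 * \<alpha>)) (DGG B \<alpha> \<gamma> \<sigma> G y - DGG B \<alpha> \<gamma> \<sigma> G x) \<le> M * nrm (B (\<gamma> - \<alpha>)) (y - x)) \<and>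
    (\<forall>x\<in>car (B (\<gamma> - \<alpha>)). \<forall>h\<in>car (B (\<gamma> - \<alpha>)). \<forall>c.
       nrm (B (\<gamma> - \<sigma> - 2 * \<alpha>)) (G (x + h) - G x - c *\<^sub>R DGG B \<alpha> \<gamma> \<sigma> G x)
         \<le> M * (nrm (B (\<gamma> - 2 * \<alpha>)) (h - c *\<^sub>R G x) + \<bar>c\<bar> * nrm (B (\<gamma> - \<alpha>)) h))"
proof -
  let ?DG = "DGG B \<alpha> \<gamma> \<sigma> G"
  have idx: "\<gamma> - \<theta> - \<sigma> = \<gamma> - \<sigma> - \<theta>" for \<theta>
    by simp
  have \<alpha>: "0 < \<alpha>"
    using \<sigma> by simp
  have Ck: "Ck_bounded_derivatives 3 (B (\<gamma> - \<theta>)) (B (\<gamma> - \<sigma> - \<theta>)) G" if "\<theta> \<in> {0, \<alpha>, 2 * \<alpha>}" for \<theta>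
    using G that unfolding assumption_G_def idx by blast
  have "\<forall>\<theta>\<in>{0, \<alpha>, 2 * \<alpha>}. \<exists>D M. 0 \<le> M \<and> (\<forall>x\<in>car (B (\<gamma> - \<theta>)). G x \<in> car (B (\<gamma> - \<sigma> - \<theta>)) \<and>
      has_frechet_derivative (B (\<gamma> - \<theta>)) (B (\<gamma> - \<sigma> - \<theta>)) G (D x) x \<and>
      (\<forall>h\<in>car (B (\<gamma> - \<theta>)). nrm (B (\<gamma> - \<sigma> - \<theta>)) (D x h) \<le> M * nrm (B (\<gamma> - \<theta>)) h))"
    using Ck_bounded_frechet[OF Ck _ nsp] by (metis zero_less_numeral)
  then obtain D M where DM: "\<forall>\<theta>\<in>{0, \<alpha>, 2 * \<alpha>}. 0 \<le> M \<theta> \<and>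
      (\<forall>x\<in>car (B (\<gamma> - \<theta>)). G x \<in> car (B (\<gamma> - \<sigma> - \<theta>)) \<and>
        has_frechet_derivative (B (\<gamma> - \<theta>)) (B (\<gamma> - \<sigma> - \<theta>)) G (D \<theta> x) x \<and>
        (\<forall>h\<in>car (B (\<gamma> - \<theta>)). nrm (B (\<gamma> - \<sigma> - \<theta>)) (D \<theta> x h) \<le> M \<theta> * nrm (B (\<gamma> - \<theta>)) h))"
    unfolding bchoice_iff by blast
  have M: "0 \<le> M \<theta>" if "\<theta> \<in> {0, \<alpha>, 2 * \<alpha>}" for \<theta>
    using DM that by blast
  have Gm: "G x \<in> car (B (\<gamma> - \<sigma> - \<theta>))"
    and D: "has_frechet_derivative (B (\<gamma> - \<theta>)) (B (\<gamma> - \<sigma> - \<theta>)) G (D \<theta> x) x"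
    if "\<theta> \<in> {0, \<alpha>, 2 * \<alpha>}" "x \<in> car (B (\<gamma> - \<theta>))" for \<theta> x
    using DM that by blast+
  have Db: "nrm (B (\<gamma> - \<sigma> - \<theta>)) (D \<theta> x h) \<le> M \<theta> * nrm (B (\<gamma> - \<theta>)) h"
    if "\<theta> \<in> {0, \<alpha>, 2 * \<alpha>}" "x \<in> car (B (\<gamma> - \<theta>))" "h \<in> car (B (\<gamma> - \<theta>))" for \<theta> x h
    using DM that by blast
  define M1 where "M1 = 1 + M 0 + M \<alpha> + M (2 * \<alpha>)"
  have M1: "M \<theta> \<le> M1" if "\<theta> \<in> {0, \<alpha>, 2 * \<alpha>}" for \<theta>
    using that M[of 0] M[of \<alpha>] M[of "2 * \<alpha>"] by (auto simp: M1_def)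
  have M1_pos: "M1 > 0"
    using M[of 0] M[of \<alpha>] M[of "2 * \<alpha>"] by (simp add: M1_def)
  have Db1: "nrm (B (\<gamma> - \<sigma> - \<theta>)) (D \<theta> x h) \<le> M1 * nrm (B (\<gamma> - \<theta>)) h"
    if "\<theta> \<in> {0, \<alpha>, 2 * \<alpha>}" "x \<in> car (B (\<gamma> - \<theta>))" "h \<in> car (B (\<gamma> - \<theta>))" for \<theta> x h
    using Db[OF that] mult_right_mono[OF M1[OF that(1)] ns_nonneg[OF that(3)]] by linarith
  have lip: "nrm (B (\<gamma> - \<sigma> - \<theta>)) (G y - G x) \<le> M1 * nrm (B (\<gamma> - \<theta>)) (y - x)"
    if "\<theta> \<in> {0, \<alpha>, 2 * \<alpha>}" "x \<in> car (B (\<gamma> - \<theta>))" "y \<in> car (B (\<gamma> - \<theta>))" for \<theta> x y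
    by (rule frechet_lipschitz[OF nsp nsp Gm[OF that(1)] D[OF that(1)] Db1[OF that(1)] that(2,3)])
  have in2: "x \<in> car (B (\<gamma> - 2 * \<alpha>))" if "x \<in> car (B (\<gamma> - \<alpha>))" for x
    using scale_mem[OF that, of "\<gamma> - 2 * \<alpha>"] \<alpha> by simp
  have Gin: "G x \<in> car (B (\<gamma> - 2 * \<alpha>))" if "x \<in> car (B (\<gamma> - \<alpha>))" for x
    using scale_mem[OF Gm[of \<alpha> x], of "\<gamma> - 2 * \<alpha>"] that \<sigma> by simp
  have DG: "?DG x = D (2 * \<alpha>) x (G x)" if "x \<in> car (B (\<gamma> - \<alpha>))" for x
    unfolding DGG_def idx by (rule frechet_deriv_eq[OF nsp nsp Gm D in2 Gin]) (use that in2 in auto)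
  obtain c0 where c0: "\<And>x. x \<in> car (B (\<gamma> - \<sigma> - \<alpha>)) \<Longrightarrow>
      nrm (B (\<gamma> - \<sigma> - 2 * \<alpha>)) x \<le> c0 * nrm (B (\<gamma> - \<sigma> - \<alpha>)) x"
    using scale_embedding[of "\<gamma> - \<sigma> - 2 * \<alpha>" "\<gamma> - \<sigma> - \<alpha>"] \<alpha> by auto
  have D_eq: "D \<alpha> x h = D (2 * \<alpha>) x h" if "x \<in> car (B (\<gamma> - \<alpha>))" "h \<in> car (B (\<gamma> - \<alpha>))" for x h
  proof (rule frechet_derivative_unique[OF nsp nsp nsp nsp,
        where f = G and ?L1.0 = "D \<alpha> x" and ?L2.0 = "D (2 * \<alpha>) x" and x = x and h = h and c = c0])
    show "car (B (\<gamma> - \<alpha>)) \<subseteq> car (B (\<gamma> - 2 * \<alpha>))" "car (B (\<gamma> - \<sigma> - \<alpha>)) \<subseteq> car (B (\<gamma> - \<sigma> - 2 * \<alpha>))"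
      using \<alpha> by (auto intro!: scale_subset)
  qed (use that in2 Gm D c0 in auto)
  obtain D' M' where D': "\<And>x. x \<in> car (B (\<gamma> - \<alpha>)) \<Longrightarrow>
        has_frechet_derivative (B (\<gamma> - \<alpha>)) (B (\<gamma> - \<sigma> - 2 * \<alpha>)) ?DG (D' x) x"
      and M': "\<And>x h. x \<in> car (B (\<gamma> - \<alpha>)) \<Longrightarrow> h \<in> car (B (\<gamma> - \<alpha>)) \<Longrightarrow>
        nrm (B (\<gamma> - \<sigma> - 2 * \<alpha>)) (D' x h) \<le> M' * nrm (B (\<gamma> - \<alpha>)) h"
    using G unfolding assumption_G_def idx by metis
  have lin2: "bounded_linear_between (B (\<gamma> - 2 * \<alpha>)) (B (\<gamma> - \<sigma> - 2 * \<alpha>)) (D (2 * \<alpha>) x)"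
    if "x \<in> car (B (\<gamma> - \<alpha>))" for x
    using D[of "2 * \<alpha>" x] in2[OF that] by (simp add: has_frechet_derivative_def)
  have DGm: "?DG x \<in> car (B (\<gamma> - \<sigma> - 2 * \<alpha>))" if "x \<in> car (B (\<gamma> - \<alpha>))" for x
    unfolding DG[OF that] by (rule bounded_linear_betweenD(1)[OF lin2[OF that] Gin[OF that]])
  have lipDG: "nrm (B (\<gamma> - \<sigma> - 2 * \<alpha>)) (?DG y - ?DG x) \<le> M' * nrm (B (\<gamma> - \<alpha>)) (y - x)"
    if "x \<in> car (B (\<gamma> - \<alpha>))" "y \<in> car (B (\<gamma> - \<alpha>))" for x y
    by (rule frechet_lipschitz[OF nsp nsp DGm D' M' that])
  obtain c1 where "c1 > 0" and c1: "\<And>x. x \<in> car (B (\<gamma> - \<sigma> - \<alpha>)) \<Longrightarrow>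
      nrm (B (\<gamma> - 2 * \<alpha>)) x \<le> c1 * nrm (B (\<gamma> - \<sigma> - \<alpha>)) x"
    using scale_embedding[of "\<gamma> - 2 * \<alpha>" "\<gamma> - \<sigma> - \<alpha>"] \<sigma> by auto
  define K where "K = \<bar>M'\<bar> + M1 * c1 * M1"
  have K: "K \<ge> 0"
    using \<open>c1 > 0\<close> M1_pos by (simp add: K_def)
  have taylor: "nrm (B (\<gamma> - \<sigma> - 2 * \<alpha>)) (G (x + h) - G x - c *\<^sub>R ?DG x)
      \<le> M1 * nrm (B (\<gamma> - 2 * \<alpha>)) (h - c *\<^sub>R G x) + \<bar>c\<bar> * (K * nrm (B (\<gamma> - \<alpha>)) h)"
    if x: "x \<in> car (B (\<gamma> - \<alpha>))" and h: "h \<in> car (B (\<gamma> - \<alpha>))" for x h c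
  proof (rule frechet_mean_value[OF nsp nsp Gm D in2[OF x] in2[OF h]])
    show "c *\<^sub>R ?DG x \<in> car (B (\<gamma> - \<sigma> - 2 * \<alpha>))"
      using DGm[OF x] by simp
    fix r :: real assume r: "r \<in> {0..1}"
    define z where "z = x + r *\<^sub>R h"
    have z: "z \<in> car (B (\<gamma> - \<alpha>))"
      using x h by (simp add: z_def)
    let ?E' = "B (\<gamma> - \<sigma> - 2 * \<alpha>)"
    note lin = lin2[OF z]
    have Gzx: "G z - G x \<in> car (B (\<gamma> - 2 * \<alpha>))"
      using Gin x z by simp
    have hc: "h - c *\<^sub>R G x \<in> car (B (\<gamma> - 2 * \<alpha>))"
      using Gin[OF x] in2[OF h] by simp
    have nz: "nrm (B (\<gamma> - \<alpha>)) (z - x) \<le> nrm (B (\<gamma> - \<alpha>)) h"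
      using r h by (simp add: z_def nrm_scaleR[OF nsp] mult_left_le_one_le)
    \<comment> \<open>The splitting that keeps the estimate linear.\<close>
    have "D (2 * \<alpha>) z h - c *\<^sub>R ?DG x
        = D (2 * \<alpha>) z (h - c *\<^sub>R G x) + c *\<^sub>R ((?DG z - ?DG x) - D (2 * \<alpha>) z (G z - G x))"
    proof -
      have e1: "D (2 * \<alpha>) z (h - c *\<^sub>R G x) = D (2 * \<alpha>) z h - c *\<^sub>R D (2 * \<alpha>) z (G x)"
        using linear_between_diff[OF lin nsp in2[OF h], of "c *\<^sub>R G x"] Gin[OF x]
          bounded_linear_betweenD(3)[OF lin Gin[OF x]] by simp
      have e2: "D (2 * \<alpha>) z (G z - G x) = ?DG z - D (2 * \<alpha>) z (G x)"
        using linear_between_diff[OF lin nsp Gin[OF z] Gin[OF x]] by (simp add: DG[OF z])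
      show ?thesis
        unfolding e1 e2 by (simp add: algebra_simps)
    qed
    moreover have m: "D (2 * \<alpha>) z (h - c *\<^sub>R G x) \<in> car ?E'" "?DG z - ?DG x \<in> car ?E'"
        "D (2 * \<alpha>) z (G z - G x) \<in> car ?E'"
      using bounded_linear_betweenD(1)[OF lin] hc Gzx DGm x z by auto
    moreover have "nrm ?E' (D (2 * \<alpha>) z (h - c *\<^sub>R G x)) \<le> M1 * nrm (B (\<gamma> - 2 * \<alpha>)) (h - c *\<^sub>R G x)"
      using Db1[of "2 * \<alpha>"] in2[OF z] hc by simp
    moreover have "nrm ?E' ((?DG z - ?DG x) - D (2 * \<alpha>) z (G z - G x)) \<le> K * nrm (B (\<gamma> - \<alpha>)) h"
    proof -
      have "nrm ?E' (?DG z - ?DG x) \<le> \<bar>M'\<bar> * nrm (B (\<gamma> - \<alpha>)) h"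
      proof -
        have "nrm ?E' (?DG z - ?DG x) \<le> M' * nrm (B (\<gamma> - \<alpha>)) (z - x)"
          by (rule lipDG[OF x z])
        also have "\<dots> \<le> \<bar>M'\<bar> * nrm (B (\<gamma> - \<alpha>)) h"
          using nz x z by (intro mult_mono) auto
        finally show ?thesis .
      qed
      moreover have "nrm ?E' (D (2 * \<alpha>) z (G z - G x)) \<le> M1 * c1 * M1 * nrm (B (\<gamma> - \<alpha>)) h"
      proof -
        have "nrm ?E' (D (2 * \<alpha>) z (G z - G x)) \<le> M1 * nrm (B (\<gamma> - 2 * \<alpha>)) (G z - G x)"
          using Db1[of "2 * \<alpha>"] in2[OF z] Gzx by simp
        also have "\<dots> \<le> M1 * (c1 * nrm (B (\<gamma> - \<sigma> - \<alpha>)) (G z - G x))"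
          using M1_pos Gm[of \<alpha>] x z by (intro mult_left_mono c1) auto
        also have "\<dots> \<le> M1 * (c1 * (M1 * nrm (B (\<gamma> - \<alpha>)) h))"
        proof -
          have "nrm (B (\<gamma> - \<sigma> - \<alpha>)) (G z - G x) \<le> M1 * nrm (B (\<gamma> - \<alpha>)) (z - x)"
            using lip[of \<alpha> x z] x z by simp
          also have "\<dots> \<le> M1 * nrm (B (\<gamma> - \<alpha>)) h"
            using nz M1_pos by simp
          finally show ?thesis
            using M1_pos \<open>c1 > 0\<close> by simp
        qed
        finally show ?thesis
          by (simp add: mult.assoc)
      qed
      ultimately show ?thesis
        using nrm_diff[OF nsp m(2,3)] by (simp add: K_def algebra_simps)
    qed
    ultimately show "nrm ?E' (D (2 * \<alpha>) (x + r *\<^sub>R h) h - c *\<^sub>R ?DG x)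
        \<le> M1 * nrm (B (\<gamma> - 2 * \<alpha>)) (h - c *\<^sub>R G x) + \<bar>c\<bar> * (K * nrm (B (\<gamma> - \<alpha>)) h)"
    proof -
      assume eq: "D (2 * \<alpha>) z h - c *\<^sub>R ?DG x
        = D (2 * \<alpha>) z (h - c *\<^sub>R G x) + c *\<^sub>R ((?DG z - ?DG x) - D (2 * \<alpha>) z (G z - G x))"
        and 1: "nrm ?E' (D (2 * \<alpha>) z (h - c *\<^sub>R G x)) \<le> M1 * nrm (B (\<gamma> - 2 * \<alpha>)) (h - c *\<^sub>R G x)"
        and 2: "nrm ?E' ((?DG z - ?DG x) - D (2 * \<alpha>) z (G z - G x)) \<le> K * nrm (B (\<gamma> - \<alpha>)) h"
      have "nrm ?E' (D (2 * \<alpha>) z h - c *\<^sub>R ?DG x) \<le> nrm ?E' (D (2 * \<alpha>) z (h - c *\<^sub>R G x))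
          + \<bar>c\<bar> * nrm ?E' ((?DG z - ?DG x) - D (2 * \<alpha>) z (G z - G x))"
        unfolding eq using nrm_add[OF nsp m(1) ns_scaleR[OF ns_diff[OF m(2,3)]], of c]
        by (simp add: nrm_scaleR[OF nsp ns_diff[OF m(2,3)]])
      then show ?thesis
        using 1 mult_left_mono[OF 2, of "\<bar>c\<bar>"] by (simp add: z_def)
    qed
  qed (use \<alpha> in auto)
  define L where "L = M1 + \<bar>M'\<bar> + K"
  have L: "M1 \<le> L" "\<bar>M'\<bar> \<le> L" "K \<le> L" "L > 0"
    using M1_pos K by (auto simp: L_def)
  show ?thesis
  proof (intro exI[of _ L] conjI ballI allI impI)
    show "L > 0"
      by (rule L)
  next
    fix \<theta> x assume \<theta>: "\<theta> \<in> {0, \<alpha>, 2 * \<alpha>}" and x: "x \<in> car (B (\<gamma> - \<theta>))"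
    show "G x \<in> car (B (\<gamma> - \<sigma> - \<theta>))"
      by (rule Gm[OF \<theta> x])
    show "nrm (B (\<gamma> - \<sigma> - \<theta>)) (G y - G x) \<le> L * nrm (B (\<gamma> - \<theta>)) (y - x)" if "y \<in> car (B (\<gamma> - \<theta>))" for y
      using lip[OF \<theta> x that] mult_right_mono[OF L(1) ns_nonneg[OF ns_diff[OF that x]]] by linarith
  next
    fix x assume x: "x \<in> car (B (\<gamma> - \<alpha>))" and Gx: "G x \<in> car (B (\<gamma> - \<alpha>))"
    have eq: "?DG x = D \<alpha> x (G x)"
      using DG[OF x] D_eq[OF x Gx] by simp
    show "?DG x \<in> car (B (\<gamma> - \<sigma> - \<alpha>))"
      using D[of \<alpha> x] x Gx bounded_linear_betweenD(1)[of _ _ "D \<alpha> x" "G x"]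
      by (auto simp: eq has_frechet_derivative_def)
    show "nrm (B (\<gamma> - \<sigma> - \<alpha>)) (?DG x) \<le> L * nrm (B (\<gamma> - \<alpha>)) (G x)"
      using Db1[of \<alpha> x "G x"] x Gx mult_right_mono[OF L(1) ns_nonneg[OF Gx]] by (simp add: eq)
  next
    fix x y assume x: "x \<in> car (B (\<gamma> - \<alpha>))" and y: "y \<in> car (B (\<gamma> - \<alpha>))"
    have "M' * nrm (B (\<gamma> - \<alpha>)) (y - x) \<le> L * nrm (B (\<gamma> - \<alpha>)) (y - x)"
      using x y L(2) by (intro mult_right_mono) auto
    then show "nrm (B (\<gamma> - \<sigma> - 2 * \<alpha>)) (?DG y - ?DG x) \<le> L * nrm (B (\<gamma> - \<alpha>)) (y - x)"
      using lipDG[OF x y] by linarith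
  next
    fix x h c assume x: "x \<in> car (B (\<gamma> - \<alpha>))" and h: "h \<in> car (B (\<gamma> - \<alpha>))"
    have "M1 * nrm (B (\<gamma> - 2 * \<alpha>)) (h - c *\<^sub>R G x) \<le> L * nrm (B (\<gamma> - 2 * \<alpha>)) (h - c *\<^sub>R G x)"
      using L(1) in2[OF h] Gin[OF x] by (intro mult_right_mono) auto
    moreover have "K * nrm (B (\<gamma> - \<alpha>)) h \<le> L * nrm (B (\<gamma> - \<alpha>)) h"
      using L(3) h by (intro mult_right_mono) auto
    then have "\<bar>c\<bar> * (K * nrm (B (\<gamma> - \<alpha>)) h) \<le> \<bar>c\<bar> * (L * nrm (B (\<gamma> - \<alpha>)) h)"
      by (rule mult_left_mono) simp
    ultimately show "nrm (B (\<gamma> - \<sigma> - 2 * \<alpha>)) (G (x + h) - G x - c *\<^sub>R ?DG x)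
         \<le> L * (nrm (B (\<gamma> - 2 * \<alpha>)) (h - c *\<^sub>R G x) + \<bar>c\<bar> * nrm (B (\<gamma> - \<alpha>)) h)"
      using taylor[OF x h, of c] by (simp add: algebra_simps)
  qed
qed

lemma controlled_increment_bound:
  assumes X: "rough_bounds \<alpha> r T X XX" and v: "controlled_bounds \<alpha> \<kappa> N T X v v'"
    and \<alpha>: "0 \<le> \<alpha>" and r: "0 \<le> r" and st: "0 \<le> s" "s < t" "t \<le> T"
    and N': "nrm (B (\<kappa> - \<alpha>)) (v' s) \<le> N'" and R: "nrm (B (\<kappa> - \<alpha>)) (remainder X v v' s t) \<le> M * (t - s) powr \<alpha>"
  shows "nrm (B (\<kappa> - \<alpha>)) (v t - v s) \<le> (M + r * N') * (t - s) powr \<alpha>"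
proof -
  have mem: "v u \<in> car (B (\<kappa> - \<alpha>))" "v' u \<in> car (B (\<kappa> - \<alpha>))" if "0 \<le> u" "u \<le> T" for u
    using v that \<alpha> scale_mem[of _ \<kappa> "\<kappa> - \<alpha>"] by (auto simp: controlled_bounds_def)
  have m: "remainder X v v' s t \<in> car (B (\<kappa> - \<alpha>))" "v' s \<in> car (B (\<kappa> - \<alpha>))"
    using mem[of s] mem[of t] st by (auto simp: remainder_def)
  have eq: "v t - v s = remainder X v v' s t + (X t - X s) *\<^sub>R v' s"
    by (simp add: remainder_def)
  have "nrm (B (\<kappa> - \<alpha>)) (v t - v s)
      \<le> nrm (B (\<kappa> - \<alpha>)) (remainder X v v' s t) + \<bar>X t - X s\<bar> * nrm (B (\<kappa> - \<alpha>)) (v' s)"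
    unfolding eq using nrm_add[OF nsp m(1) ns_scaleR[OF m(2)]] by (simp add: nrm_scaleR[OF nsp m(2)])
  also have "\<bar>X t - X s\<bar> * nrm (B (\<kappa> - \<alpha>)) (v' s) \<le> (r * (t - s) powr \<alpha>) * N'"
    using X st N' m r by (intro mult_mono) (auto simp: rough_bounds_def)
  finally show ?thesis
    using R by (simp add: algebra_simps)
qed

text \<open>
  Composition with \<open>G\<close> is of linear growth on paths of the form \<open>(y, G(y))\<close>, although for general
  controlled paths one only has a quadratic bound.
\<close>

lemma composition_controlled_bounds:
  assumes G: "assumption_G B \<alpha> \<gamma> \<sigma> G" and \<sigma>: "0 \<le> \<sigma>" "\<sigma> < \<alpha>" and r: "0 \<le> r"
  shows "\<exists>C>0. \<forall>T X XX N y. rough_bounds \<alpha> r T X XX \<and> 0 \<le> N \<and>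
    controlled_bounds \<alpha> \<gamma> N T X y (\<lambda>t. G (y t)) \<longrightarrow>
    controlled_bounds \<alpha> (\<gamma> - \<sigma>) (C * (1 + N)) T X (\<lambda>t. G (y t)) (\<lambda>t. DGG B \<alpha> \<gamma> \<sigma> G (y t))"
proof -
  let ?DG = "DGG B \<alpha> \<gamma> \<sigma> G"
  have \<alpha>: "0 < \<alpha>"
    using \<sigma> by simp
  obtain M where "M > 0" and
    ests: "\<forall>\<theta>\<in>{0, \<alpha>, 2 * \<alpha>}. \<forall>x\<in>car (B (\<gamma> - \<theta>)). G x \<in> car (B (\<gamma> - \<sigma> - \<theta>)) \<and>
       (\<forall>y\<in>car (B (\<gamma> - \<theta>)). nrm (B (\<gamma> - \<sigma> - \<theta>)) (G y - G x) \<le> M * nrm (B (\<gamma> - \<theta>)) (y - x))"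
    and DGb: "\<And>x. x \<in> car (B (\<gamma> - \<alpha>)) \<Longrightarrow> G x \<in> car (B (\<gamma> - \<alpha>)) \<Longrightarrow> ?DG x \<in> car (B (\<gamma> - \<sigma> - \<alpha>)) \<and>
       nrm (B (\<gamma> - \<sigma> - \<alpha>)) (?DG x) \<le> M * nrm (B (\<gamma> - \<alpha>)) (G x)"
    and DGlip: "\<And>x y. x \<in> car (B (\<gamma> - \<alpha>)) \<Longrightarrow> y \<in> car (B (\<gamma> - \<alpha>)) \<Longrightarrow>
       nrm (B (\<gamma> - \<sigma> - 2 * \<alpha>)) (?DG y - ?DG x) \<le> M * nrm (B (\<gamma> - \<alpha>)) (y - x)"
    and taylor: "\<And>x h c. x \<in> car (B (\<gamma> - \<alpha>)) \<Longrightarrow> h \<in> car (B (\<gamma> - \<alpha>)) \<Longrightarrow>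
       nrm (B (\<gamma> - \<sigma> - 2 * \<alpha>)) (G (x + h) - G x - c *\<^sub>R ?DG x)
         \<le> M * (nrm (B (\<gamma> - 2 * \<alpha>)) (h - c *\<^sub>R G x) + \<bar>c\<bar> * nrm (B (\<gamma> - \<alpha>)) h)"
    using assumption_G_estimates[OF G \<sigma>] by (elim exE conjE) blast
  have G0: "G x \<in> car (B (\<gamma> - \<sigma>))" "nrm (B (\<gamma> - \<sigma>)) (G y - G x) \<le> M * nrm (B \<gamma>) (y - x)"
    if "x \<in> car (B \<gamma>)" "y \<in> car (B \<gamma>)" for x y
    using ests[rule_format, of 0] that by auto
  have G1: "G x \<in> car (B (\<gamma> - \<sigma> - \<alpha>))" "nrm (B (\<gamma> - \<sigma> - \<alpha>)) (G y - G x) \<le> M * nrm (B (\<gamma> - \<alpha>)) (y - x)"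
    if "x \<in> car (B (\<gamma> - \<alpha>))" "y \<in> car (B (\<gamma> - \<alpha>))" for x y
    using ests[rule_format, of \<alpha>] that by auto
  define k where "k = nrm (B (\<gamma> - \<sigma>)) (G 0)"
  have k: "k \<ge> 0"
    using G0(1)[of 0 0] by (simp add: k_def)
  define C where "C = k + M * (1 + r) * (1 + r)"
  have C: "C > 0"
    using k \<open>M > 0\<close> r by (simp add: C_def add_nonneg_pos)
  have le_C: "A * N \<le> C * (1 + N)" if "A \<le> M * (1 + r) * (1 + r)" "0 \<le> N" for A N
  proof -
    have "A * N \<le> C * N"
      using that k by (intro mult_right_mono) (auto simp: C_def)
    also have "\<dots> \<le> C * (1 + N)"
      using C by simp
    finally show ?thesis .
  qed
  have M_le: "M \<le> M * (1 + r) * (1 + r)" "M * (1 + r) \<le> M * (1 + r) * (1 + r)"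
    "M * (1 + r) + r * M \<le> M * (1 + r) * (1 + r)" "M * (1 + r * (1 + r)) \<le> M * (1 + r) * (1 + r)"
    using \<open>M > 0\<close> r by (simp_all add: algebra_simps)
  have "controlled_bounds \<alpha> (\<gamma> - \<sigma>) (C * (1 + N)) T X (\<lambda>t. G (y t)) (\<lambda>t. ?DG (y t))"
    if X: "rough_bounds \<alpha> r T X XX" and N: "0 \<le> N"
    and y: "controlled_bounds \<alpha> \<gamma> N T X y (\<lambda>t. G (y t))" for T X XX N y
    unfolding controlled_bounds_def
  proof (intro conjI allI impI; elim conjE)
    have mem: "y t \<in> car (B \<gamma>)" "y t \<in> car (B (\<gamma> - \<alpha>))" "G (y t) \<in> car (B (\<gamma> - \<alpha>))"
      and nb: "nrm (B \<gamma>) (y t) \<le> N" "nrm (B (\<gamma> - \<alpha>)) (G (y t)) \<le> N" if "0 \<le> t" "t \<le> T" for t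
      using y that \<alpha> scale_mem[of _ \<gamma> "\<gamma> - \<alpha>"] by (auto simp: controlled_bounds_def)
    fix t assume t: "0 \<le> t" "t \<le> T"
    show "G (y t) \<in> car (B (\<gamma> - \<sigma>))" "?DG (y t) \<in> car (B (\<gamma> - \<sigma> - \<alpha>))"
      using G0(1)[of "y t" "y t"] DGb[of "y t"] mem[of t] t by auto
    show "nrm (B (\<gamma> - \<sigma>)) (G (y t)) \<le> C * (1 + N)"
    proof -
      have "nrm (B (\<gamma> - \<sigma>)) (G (y t)) \<le> nrm (B (\<gamma> - \<sigma>)) (G (y t) - G 0) + k"
        using nrm_add[OF nsp, of "G (y t) - G 0" "\<gamma> - \<sigma>" "G 0"] G0(1)[of "y t" 0] G0(1)[of 0 0] mem t
        by (simp add: k_def)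
      also have "nrm (B (\<gamma> - \<sigma>)) (G (y t) - G 0) \<le> M * N"
      proof -
        have "nrm (B (\<gamma> - \<sigma>)) (G (y t) - G 0) \<le> M * nrm (B \<gamma>) (y t)"
          using G0(2)[of 0 "y t"] mem(1)[OF t] by simp
        also have "\<dots> \<le> M * N"
          using nb(1)[OF t] \<open>M > 0\<close> by simp
        finally show ?thesis .
      qed
      also have "M * N + k \<le> C * (1 + N)"
        using mult_right_mono[OF M_le(1) N] k N \<open>M > 0\<close> r by (simp add: C_def algebra_simps)
      finally show ?thesis
        by simp
    qed
    show "nrm (B (\<gamma> - \<sigma> - \<alpha>)) (?DG (y t)) \<le> C * (1 + N)"
    proof -
      have "nrm (B (\<gamma> - \<sigma> - \<alpha>)) (?DG (y t)) \<le> M * nrm (B (\<gamma> - \<alpha>)) (G (y t))"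
        using DGb mem t by blast
      also have "\<dots> \<le> M * N"
        using nb(2)[OF t] \<open>M > 0\<close> by simp
      also have "\<dots> \<le> C * (1 + N)"
        by (rule le_C[OF M_le(1) N])
      finally show ?thesis .
    qed
  next
    have mem: "y t \<in> car (B \<gamma>)" "y t \<in> car (B (\<gamma> - \<alpha>))" "G (y t) \<in> car (B (\<gamma> - \<alpha>))"
      and nb: "nrm (B \<gamma>) (y t) \<le> N" "nrm (B (\<gamma> - \<alpha>)) (G (y t)) \<le> N" if "0 \<le> t" "t \<le> T" for t
      using y that \<alpha> scale_mem[of _ \<gamma> "\<gamma> - \<alpha>"] by (auto simp: controlled_bounds_def)
    fix s t assume st: "0 \<le> s" "s < t" "t \<le> T"
    define P where "P = (t - s) powr \<alpha>"
    have P: "P \<ge> 0" "(t - s) powr (2 * \<alpha>) = P * P"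
      by (simp_all add: P_def flip: powr_add)
    have m: "y s \<in> car (B (\<gamma> - \<alpha>))" "y t \<in> car (B (\<gamma> - \<alpha>))" "y t - y s \<in> car (B (\<gamma> - \<alpha>))"
      using mem st by auto
    have Xst: "\<bar>X t - X s\<bar> \<le> r * P"
      using X st by (simp add: rough_bounds_def P_def)
    have inc: "nrm (B (\<gamma> - \<alpha>)) (y t - y s) \<le> (1 + r) * N * P"
      using controlled_increment_bound[OF X y _ r st, of N N] nb(2)[of s] \<alpha> y st
      by (simp add: controlled_bounds_def P_def algebra_simps)
    have MN: "M * nrm (B (\<gamma> - \<alpha>)) (y t - y s) \<le> M * (1 + r) * N * P"
      using mult_left_mono[OF inc, of M] \<open>M > 0\<close> by (simp add: mult.assoc)
    show "nrm (B (\<gamma> - \<sigma> - 2 * \<alpha>)) (?DG (y t) - ?DG (y s)) \<le> C * (1 + N) * (t - s) powr \<alpha>"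
    proof -
      have "nrm (B (\<gamma> - \<sigma> - 2 * \<alpha>)) (?DG (y t) - ?DG (y s)) \<le> M * (1 + r) * N * P"
        using DGlip[OF m(1,2)] MN by simp
      also have "\<dots> \<le> C * (1 + N) * P"
        by (intro mult_right_mono le_C M_le N P)
      finally show ?thesis
        by (simp add: P_def)
    qed
    show "nrm (B (\<gamma> - \<sigma> - \<alpha>)) (remainder X (\<lambda>t. G (y t)) (\<lambda>t. ?DG (y t)) s t) \<le> C * (1 + N) * (t - s) powr \<alpha>"
    proof -
      let ?E = "B (\<gamma> - \<sigma> - \<alpha>)"
      have mm: "G (y t) - G (y s) \<in> car ?E" "?DG (y s) \<in> car ?E"
        using G1(1) m DGb mem(3)[of s] st by auto
      have "nrm ?E (remainder X (\<lambda>t. G (y t)) (\<lambda>t. ?DG (y t)) s t)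
          \<le> nrm ?E (G (y t) - G (y s)) + \<bar>X t - X s\<bar> * nrm ?E (?DG (y s))"
        using nrm_diff[OF nsp mm(1) ns_scaleR[OF mm(2)]] by (simp add: remainder_def nrm_scaleR[OF nsp mm(2)])
      also have "nrm ?E (G (y t) - G (y s)) \<le> M * (1 + r) * N * P"
        using G1(2)[OF m(1,2)] MN by simp
      also have "\<bar>X t - X s\<bar> * nrm ?E (?DG (y s)) \<le> (r * P) * (M * N)"
      proof (rule mult_mono[OF Xst])
        have "nrm ?E (?DG (y s)) \<le> M * nrm (B (\<gamma> - \<alpha>)) (G (y s))"
          using DGb[OF m(1) mem(3)[of s]] st by simp
        also have "\<dots> \<le> M * N"
          using nb(2)[of s] st \<open>M > 0\<close> by simp
        finally show "nrm ?E (?DG (y s)) \<le> M * N" .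
      qed (use r P mm in auto)
      also have "M * (1 + r) * N * P + (r * P) * (M * N) = (M * (1 + r) + r * M) * N * P"
        by (simp add: algebra_simps)
      also have "\<dots> \<le> C * (1 + N) * P"
        by (intro mult_right_mono le_C M_le N P)
      finally show ?thesis
        by (simp add: P_def)
    qed
    show "nrm (B (\<gamma> - \<sigma> - 2 * \<alpha>)) (remainder X (\<lambda>t. G (y t)) (\<lambda>t. ?DG (y t)) s t)
        \<le> C * (1 + N) * (t - s) powr (2 * \<alpha>)"
    proof -
      let ?E = "B (\<gamma> - \<sigma> - 2 * \<alpha>)"
      have "nrm ?E (remainder X (\<lambda>t. G (y t)) (\<lambda>t. ?DG (y t)) s t)
          \<le> M * (nrm (B (\<gamma> - 2 * \<alpha>)) (remainder X y (\<lambda>t. G (y t)) s t)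
              + \<bar>X t - X s\<bar> * nrm (B (\<gamma> - \<alpha>)) (y t - y s))"
        using taylor[OF m(1,3), of "X t - X s"] by (simp add: remainder_def)
      also have "\<dots> \<le> M * (N * (P * P) + (r * P) * ((1 + r) * N * P))"
        using y st Xst inc \<open>M > 0\<close> r P m unfolding P(2)[symmetric]
        by (intro mult_left_mono add_mono mult_mono) (auto simp: controlled_bounds_def)
      also have "\<dots> = (M * (1 + r * (1 + r))) * N * (P * P)"
        by (simp add: algebra_simps)
      also have "\<dots> \<le> C * (1 + N) * (P * P)"
        using P by (intro mult_right_mono le_C M_le N) auto
      finally show ?thesis
        by (simp add: P)
    qed
  qed
  then show ?thesis
    using C by blast
qed

end

section \<open>A priori bounds for mild solutions\<close>

lemma powr_le_const_powr:
  fixes h T\<^sub>0 :: real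
  assumes "0 \<le> h" "h \<le> T\<^sub>0" "p \<le> q"
  shows "h powr q \<le> (1 + T\<^sub>0) powr (q - p) * h powr p"
proof (cases "h = 0")
  case False
  then have "h powr q = h powr (q - p) * h powr p"
    by (simp flip: powr_add)
  also have "\<dots> \<le> (1 + T\<^sub>0) powr (q - p) * h powr p"
    using assms by (intro mult_right_mono powr_mono2) auto
  finally show ?thesis .
qed simp

lemma (in smoothing_scale) S_smoothing_le:
  assumes "0 \<le> e" "e \<le> 2" "0 < T" "\<theta>' \<le> \<theta> + e"
  shows "\<exists>C>0. \<forall>t\<in>{0<..T}. \<forall>x\<in>car (B \<theta>). S t x \<in> car (B \<theta>') \<and>
    nrm (B \<theta>') (S t x) \<le> C * t powr (- e) * nrm (B \<theta>) x"
proof -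
  obtain C1 where "C1 > 0" and C1: "\<And>t x. t \<in> {0<..T} \<Longrightarrow> x \<in> car (B \<theta>) \<Longrightarrow>
      S t x \<in> car (B (\<theta> + e)) \<and> nrm (B (\<theta> + e)) (S t x) \<le> C1 * t powr (- e) * nrm (B \<theta>) x"
    using S_smoothing[OF assms(1-3)] by meson
  obtain C2 where "C2 > 0" and C2: "\<And>x. x \<in> car (B (\<theta> + e)) \<Longrightarrow> nrm (B \<theta>') x \<le> C2 * nrm (B (\<theta> + e)) x"
    using scale_embedding[OF assms(4)] by blast
  have "S t x \<in> car (B \<theta>') \<and> nrm (B \<theta>') (S t x) \<le> C2 * C1 * t powr (- e) * nrm (B \<theta>) x"
    if "t \<in> {0<..T}" "x \<in> car (B \<theta>)" for t x
  proof -
    have m: "S t x \<in> car (B (\<theta> + e))"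
      using C1[OF that] by blast
    have "nrm (B \<theta>') (S t x) \<le> C2 * nrm (B (\<theta> + e)) (S t x)"
      by (rule C2[OF m])
    also have "\<dots> \<le> C2 * (C1 * t powr (- e) * nrm (B \<theta>) x)"
      using C1[OF that] \<open>C2 > 0\<close> by simp
    finally show ?thesis
      using scale_mem[OF m assms(4)] by (simp add: mult.assoc)
  qed
  moreover have "C2 * C1 > 0"
    using \<open>C1 > 0\<close> \<open>C2 > 0\<close> by simp
  ultimately show ?thesis
    by blast
qed

text \<open>
  All constants below may depend on the bound \<open>r\<close> for the rough path and on the bound \<open>T\<^sub>0\<close> for the length of the
  time interval, but not on the path, the interval or the solution.
\<close>

locale rough_equation = smoothing_scale +
  fixes \<alpha> \<gamma> \<delta> \<sigma> T\<^sub>0 r :: real and F G :: "'a \<Rightarrow> 'a"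
  assumes \<alpha>: "1 / 3 < \<alpha>" "\<alpha> < 1 / 2"
    and \<delta>: "0 \<le> \<delta>" "\<delta> < 1" and F: "assumption_F B \<gamma> \<delta> F"
    and \<sigma>: "0 \<le> \<sigma>" "\<sigma> < \<alpha>" and G: "assumption_G B \<alpha> \<gamma> \<sigma> G"
    and T\<^sub>0: "0 < T\<^sub>0" and r: "0 \<le> r"
begin

text \<open>
  A mild solution of norm at most \<open>N\<close>.  Its convolutions \<open>I\<close> with the drift and \<open>J\<close> with the noise are made
  explicit, and the mild formula is restarted at an arbitrary time \<open>s\<close>.
\<close>

definition solves where
  "solves T X XX N y I J \<longleftrightarrow> 0 < T \<and> T \<le> T\<^sub>0 \<and> rough_bounds \<alpha> r T X XX \<and> 0 \<le> N \<and>
     controlled_bounds \<alpha> \<gamma> N T X y (\<lambda>t. G (y t)) \<and>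
     drift_integral_of (\<gamma> - \<delta>) T (\<lambda>s. F (y s)) I \<and>
     (\<forall>t\<in>{0..T}. has_rough_integral (B (\<gamma> - \<sigma>
         - 2 * \<alpha>)) S X XX (\<lambda>s. G (y s)) (\<lambda>s. DGG B \<alpha> \<gamma> \<sigma> G (y s)) t (J t)) \<and>
     (\<forall>s t. 0 \<le> s \<and> s < t \<and> t \<le> T \<longrightarrow>
        y t = S (t - s) (y s) + (I t - S (t - s) (I s)) + (J t - S (t - s) (J s)))"

text \<open>
  The right-hand side of the a priori estimate up to the constant.
\<close>

definition data_bound where
  "data_bound T N x = 1 + nrm (B \<gamma>) x + T powr min (\<alpha> - \<sigma>) (1 - \<delta>) * N"

abbreviation rough_germ where
  "rough_germ X XX y \<equiv> compensated_increment X XX (\<lambda>t. G (y t)) (\<lambda>t. DGG B \<alpha> \<gamma> \<sigma> G (y t))"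

lemma solvesD:
  assumes "solves T X XX N y I J"
  shows "0 < T" "T \<le> T\<^sub>0" "rough_bounds \<alpha> r T X XX" "0 \<le> N"
    "controlled_bounds \<alpha> \<gamma> N T X y (\<lambda>t. G (y t))" "drift_integral_of (\<gamma> - \<delta>) T (\<lambda>s. F (y s)) I"
  using assms by (auto simp: solves_def)

lemma solves_mem:
  assumes "solves T X XX N y I J" "0 \<le> t" "t \<le> T"
  shows "y t \<in> car (B \<gamma>)" "nrm (B \<gamma>) (y t) \<le> N" "G (y t) \<in> car (B (\<gamma> - \<alpha>))"
  using assms by (auto simp: solves_def controlled_bounds_def)

lemma data_bound_ge:
  assumes "x \<in> car (B \<gamma>)" "0 \<le> N"
  shows "1 \<le> data_bound T N x" "nrm (B \<gamma>) x \<le> data_bound T N x"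
  using assms by (simp_all add: data_bound_def)

text \<open>
  Every term that contains the full norm \<open>N\<close> of the solution comes with a power \<open>h powr p\<close> of the length
  of a time interval, where \<open>p\<close> is at least the exponent \<open>\<eta>\<close> in the a priori estimate.  Since all times are at
  most \<open>T\<^sub>0\<close>, such a power is at most a multiple of \<open>T powr \<eta>\<close>.
\<close>

lemma small_power_bound:
  assumes "min (\<alpha> - \<sigma>) (1 - \<delta>) \<le> p"
  shows "\<exists>C>0. \<forall>T h N x. 0 < h \<and> h \<le> T \<and> T \<le> T\<^sub>0 \<and> 0 \<le> N \<and> x \<in> car (B \<gamma>) \<longrightarrow>
    (1 + N) * h powr p \<le> C * data_bound T N x"
proof -
  let ?\<eta> = "min (\<alpha> - \<sigma>) (1 - \<delta>)"
  have \<eta>: "0 < ?\<eta>"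
    using \<sigma> \<delta> by simp
  define C where "C = (1 + T\<^sub>0) powr (p - ?\<eta>) * ((1 + T\<^sub>0) powr ?\<eta> + 1)"
  have C: "C > 0"
    using T\<^sub>0 by (simp add: C_def add_pos_pos)
  have "(1 + N) * h powr p \<le> C * data_bound T N x"
    if h: "0 < h" "h \<le> T" "T \<le> T\<^sub>0" and N: "0 \<le> N" and x: "x \<in> car (B \<gamma>)" for T h N x
  proof -
    have "h powr p \<le> T powr p"
      using h assms \<eta> by (intro powr_mono2) auto
    also have "\<dots> \<le> (1 + T\<^sub>0) powr (p - ?\<eta>) * T powr ?\<eta>"
      using h assms by (intro powr_le_const_powr) auto
    finally have "(1 + N) * h powr p \<le> (1 + N) * ((1 + T\<^sub>0) powr (p - ?\<eta>) * T powr ?\<eta>)"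
      using N by (intro mult_left_mono) auto
    also have "\<dots> = (1 + T\<^sub>0) powr (p - ?\<eta>) * (T powr ?\<eta> + T powr ?\<eta> * N)"
      by (simp add: algebra_simps)
    also have "T powr ?\<eta> + T powr ?\<eta> * N \<le> ((1 + T\<^sub>0) powr ?\<eta> + 1) * data_bound T N x"
    proof -
      have "T powr ?\<eta> \<le> (1 + T\<^sub>0) powr ?\<eta> * 1"
        using h \<eta> powr_mono2[of ?\<eta> T "1 + T\<^sub>0"] by simp
      also have "\<dots> \<le> (1 + T\<^sub>0) powr ?\<eta> * data_bound T N x"
        using data_bound_ge(1)[OF x N] by (intro mult_left_mono) auto
      moreover have "T powr ?\<eta> * N \<le> data_bound T N x"
        using x by (simp add: data_bound_def)
      ultimately show ?thesis
        by (simp add: algebra_simps)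
    qed
    finally show ?thesis
      by (simp add: C_def mult.assoc mult_left_mono)
  qed
  then show ?thesis
    using C by blast
qed

lemma solves_composition:
  "\<exists>C>0. \<forall>T X XX N y I J. solves T X XX N y I J \<longrightarrow>
    controlled_bounds \<alpha> (\<gamma> - \<sigma>) (C * (1 + N)) T X (\<lambda>t. G (y t)) (\<lambda>t. DGG B \<alpha> \<gamma> \<sigma> G (y t))"
proof -
  obtain C where "C > 0" and C: "\<And>T X XX N y. rough_bounds \<alpha> r T X XX \<Longrightarrow> 0 \<le> N \<Longrightarrow>
    controlled_bounds \<alpha> \<gamma> N T X y (\<lambda>t. G (y t)) \<Longrightarrow>
    controlled_bounds \<alpha> (\<gamma> - \<sigma>) (C * (1 + N)) T X (\<lambda>t. G (y t)) (\<lambda>t. DGG B \<alpha> \<gamma> \<sigma> G (y t))"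
    using composition_controlled_bounds[OF G \<sigma> r] by meson
  show ?thesis
    using \<open>C > 0\<close> C[OF solvesD(3,4,5)] by (intro exI[of _ C] conjI allI impI)
qed

text \<open>
  Here \<open>K\<close> is only a bound for the supremum of \<open>y\<close>: with \<open>K = N\<close> the lemma gives the supremum bound, and with
  that bound in place of \<open>K\<close> it gives the Hoelder bounds, where \<open>p = a\<close> uses up the power of \<open>t - s\<close> and leaves
  no factor \<open>T powr \<eta>\<close>.
\<close>

lemma solves_drift:
  assumes a: "0 \<le> a" "p \<le> 1 - max 0 (\<delta> - a)"
  shows "\<exists>C>0. \<forall>T X XX N y I J K s t. solves T X XX N y I J \<and> 0 \<le> K \<and>
    (\<forall>u\<in>{0..T}. nrm (B \<gamma>) (y u) \<le> K) \<and> 0 \<le> s \<and> s < t \<and> t \<le> T \<longrightarrow>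
    I t - S (t - s) (I s) \<in> car (B (\<gamma> - a)) \<and>
    nrm (B (\<gamma> - a)) (I t - S (t - s) (I s)) \<le> C * (1 + K) * (t - s) powr p"
proof -
  define e where "e = max 0 (\<delta> - a)"
  have e: "0 \<le> e" "e < 1"
    using \<delta> a by (auto simp: e_def)
  obtain C1 where "C1 > 0" and C1: "\<And>T f I K s t. T \<le> T\<^sub>0 \<Longrightarrow> 0 \<le> K \<Longrightarrow>
    \<forall>u\<in>{0..T}. f u \<in> car (B (\<gamma> - \<delta>)) \<and> nrm (B (\<gamma> - \<delta>)) (f u) \<le> K \<Longrightarrow>
    drift_integral_of (\<gamma> - \<delta>) T f I \<Longrightarrow>
    0 \<le> s \<Longrightarrow> s < t \<Longrightarrow> t \<le> T \<Longrightarrow>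
    I t - S (t - s) (I s) \<in> car (B (\<gamma> - \<delta> + e)) \<and>
    nrm (B (\<gamma> - \<delta> + e)) (I t - S (t - s) (I s)) \<le> C1 * K * (t - s) powr (1 - e)"
    using drift_convolution_bound[OF e T\<^sub>0, of "\<gamma> - \<delta>"] by metis
  have le: "\<gamma> - a \<le> \<gamma> - \<delta> + e"
    by (simp add: e_def)
  obtain C2 where "C2 > 0" and C2: "\<And>x. x \<in> car (B (\<gamma> - \<delta> + e)) \<Longrightarrow>
      nrm (B (\<gamma> - a)) x \<le> C2 * nrm (B (\<gamma> - \<delta> + e)) x"
    using scale_embedding[OF le] by blast
  obtain C3 where C3: "\<And>x. x \<in> car (B \<gamma>) \<Longrightarrow> nrm (B (\<gamma> - \<delta>)) (F x) \<le> C3 * (1 + nrm (B \<gamma>) x)"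
    using F unfolding assumption_F_def by blast
  define C4 where "C4 = 1 + \<bar>C3\<bar>"
  define c where "c = (1 + T\<^sub>0) powr (1 - e - p)"
  have pos: "C4 > 0" "c > 0"
    using T\<^sub>0 by (auto simp: C4_def c_def)
  have "I t - S (t - s) (I s) \<in> car (B (\<gamma> - a)) \<and>
      nrm (B (\<gamma> - a)) (I t - S (t - s) (I s)) \<le> (C2 * C1 * C4 * c) * (1 + K) * (t - s) powr p"
    if sol: "solves T X XX N y I J" and K: "0 \<le> K" and yK: "\<forall>u\<in>{0..T}. nrm (B \<gamma>) (y u) \<le> K"
    and st: "0 \<le> s" "s < t" "t \<le> T" for T X XX N y I J K s t
  proof -
    have Fy: "\<forall>u\<in>{0..T}. F (y u) \<in> car (B (\<gamma> - \<delta>)) \<and> nrm (B (\<gamma> - \<delta>)) (F (y u)) \<le> C4 * (1 + K)"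
    proof
      fix u assume u: "u \<in> {0..T}"
      have yu: "y u \<in> car (B \<gamma>)"
        using solves_mem[OF sol] u by simp
      have "nrm (B (\<gamma> - \<delta>)) (F (y u)) \<le> C3 * (1 + nrm (B \<gamma>) (y u))"
        by (rule C3[OF yu])
      also have "\<dots> \<le> C4 * (1 + K)"
        using yK u yu by (intro mult_mono) (auto simp: C4_def)
      finally show "F (y u) \<in> car (B (\<gamma> - \<delta>)) \<and> nrm (B (\<gamma> - \<delta>)) (F (y u)) \<le> C4 * (1 + K)"
        using F yu by (simp add: assumption_F_def)
    qed
    have I: "I t - S (t - s) (I s) \<in> car (B (\<gamma> - \<delta> + e)) \<and>
        nrm (B (\<gamma> - \<delta> + e)) (I t - S (t - s) (I s)) \<le> C1 * (C4 * (1 + K)) * (t - s) powr (1 - e)"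
      using solvesD[OF sol] K pos st by (intro C1[OF _ _ Fy]) auto
    have "nrm (B (\<gamma> - a)) (I t - S (t - s) (I s)) \<le> C2 * nrm (B (\<gamma> - \<delta> + e)) (I t - S (t - s) (I s))"
      using I by (intro C2) auto
    also have "\<dots> \<le> C2 * (C1 * (C4 * (1 + K)) * (t - s) powr (1 - e))"
      using I \<open>C2 > 0\<close> by simp
    also have "\<dots> \<le> C2 * (C1 * (C4 * (1 + K)) * (c * (t - s) powr p))"
    proof -
      have "(t - s) powr (1 - e) \<le> c * (t - s) powr p"
        unfolding c_def using a st solvesD(2)[OF sol] by (intro powr_le_const_powr) (auto simp: e_def)
      then show ?thesis
        using \<open>C1 > 0\<close> \<open>C2 > 0\<close> pos K by (intro mult_left_mono) auto
    qed
    finally show ?thesis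
      using I scale_mem[OF _ le] by (simp add: algebra_simps)
  qed
  moreover have "C2 * C1 * C4 * c > 0"
    using \<open>C1 > 0\<close> \<open>C2 > 0\<close> pos by simp
  ultimately show ?thesis
    by (intro exI[of _ "C2 * C1 * C4 * c"]) auto
qed

lemma solves_rough_remainder:
  assumes a: "0 \<le> a" "a \<le> 2 * \<alpha>"
  shows "\<exists>C>0. \<forall>T X XX N y I J s t. solves T X XX N y I J \<and> 0 \<le> s \<and> s < t \<and> t \<le> T \<longrightarrow>
    J t - S (t - s) (J s) - S (t - s) (rough_germ X XX y s t) \<in> car (B (\<gamma> - a)) \<and>
    nrm (B (\<gamma> - a)) (J t - S (t - s) (J s) - S (t - s) (rough_germ X XX y s t))
      \<le> C * (1 + N) * (t - s) powr (a + (\<alpha> - \<sigma>))"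
proof -
  obtain C1 where "C1 > 0" and C1: "\<And>T X XX N y I J. solves T X XX N y I J \<Longrightarrow>
    controlled_bounds \<alpha> (\<gamma> - \<sigma>) (C1 * (1 + N)) T X (\<lambda>t. G (y t)) (\<lambda>t. DGG B \<alpha> \<gamma> \<sigma> G (y t))"
    using solves_composition by meson
  have e: "0 \<le> 2 * \<alpha> + \<sigma> - a" "2 * \<alpha> + \<sigma> - a < 3 * \<alpha>"
    using a \<sigma> by auto
  have idx: "\<gamma> - \<sigma> - 2 * \<alpha> + (2 * \<alpha> + \<sigma> - a) = \<gamma> - a" "3 * \<alpha> - (2 * \<alpha> + \<sigma> - a) = a + (\<alpha> - \<sigma>)"
    by auto
  obtain C2 where "C2 > 0" and C2: "\<And>T X XX v v' N J s t. T \<le> T\<^sub>0 \<Longrightarrow> rough_bounds \<alpha> r T X XX \<Longrightarrow> 0 \<le> N \<Longrightarrow>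
    controlled_bounds \<alpha> (\<gamma> - \<sigma>) N T X v v' \<Longrightarrow>
    \<forall>t\<in>{0..T}. has_rough_integral (B (\<gamma> - \<sigma> - 2 * \<alpha>)) S X XX v v' t (J t) \<Longrightarrow>
    0 \<le> s \<Longrightarrow> s < t \<Longrightarrow> t \<le> T \<Longrightarrow>
    J t - S (t - s) (J s) - S (t - s) (compensated_increment X XX v v' s t) \<in> car (B (\<gamma> - a)) \<and>
    nrm (B (\<gamma> - a)) (J t - S (t - s) (J s) - S (t - s) (compensated_increment X XX v v' s t))
      \<le> C2 * N * (t - s) powr (a + (\<alpha> - \<sigma>))"
    using rough_convolution_bound[OF \<alpha> r T\<^sub>0 e, of "\<gamma> - \<sigma>"] unfolding idx by metis
  have "J t - S (t - s) (J s) - S (t - s) (rough_germ X XX y s t) \<in> car (B (\<gamma> - a)) \<and>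
      nrm (B (\<gamma> - a)) (J t - S (t - s) (J s) - S (t - s) (rough_germ X XX y s t))
      \<le> C2 * C1 * (1 + N) * (t - s) powr (a + (\<alpha> - \<sigma>))"
    if sol: "solves T X XX N y I J" and st: "0 \<le> s" "s < t" "t \<le> T" for T X XX N y I J s t
    using C2[OF _ _ _ C1[OF sol] _ st, of XX J] sol \<open>C1 > 0\<close> by (simp add: solves_def mult.assoc)
  moreover have "C2 * C1 > 0"
    using \<open>C1 > 0\<close> \<open>C2 > 0\<close> by simp
  ultimately show ?thesis
    by (intro exI[of _ "C2 * C1"]) auto
qed

text \<open>
  The increment of the convolution with the noise is split into the sewing error and the germ.
\<close>

lemma solves_expansion:
  assumes "solves T X XX N y I J" "0 \<le> s" "s < t" "t \<le> T"
  shows "y t = S (t - s) (y s) + (I t - S (t - s) (I s))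
    + (J t - S (t - s) (J s) - S (t - s) (rough_germ X XX y s t))
    + ((X t - X s) *\<^sub>R S (t - s) (G (y s)) + XX s t *\<^sub>R S (t - s) (DGG B \<alpha> \<gamma> \<sigma> G (y s)))"
proof -
  obtain C where "controlled_bounds \<alpha> (\<gamma> - \<sigma>) (C * (1 + N)) T X (\<lambda>t. G (y t)) (\<lambda>t. DGG B \<alpha> \<gamma> \<sigma> G (y t))"
    using solves_composition assms(1) by meson
  then have "G (y s) \<in> car (B (\<gamma> - \<sigma>))" and D: "DGG B \<alpha> \<gamma> \<sigma> G (y s) \<in> car (B (\<gamma> - \<sigma> - \<alpha>))"
    using assms by (auto simp: controlled_bounds_def)
  then have "G (y s) \<in> car (B (\<gamma> - \<sigma> - \<alpha>))"
    using \<alpha> scale_mem[of _ "\<gamma> - \<sigma>" "\<gamma> - \<sigma> - \<alpha>"] by simp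
  then have "S (t - s) (rough_germ X XX y s t)
      = (X t - X s) *\<^sub>R S (t - s) (G (y s)) + XX s t *\<^sub>R S (t - s) (DGG B \<alpha> \<gamma> \<sigma> G (y s))"
    unfolding compensated_increment_def using assms D
    by (simp add: S_add[of _ _ "\<gamma> - \<sigma> - \<alpha>"] S_scaleR[of _ _ "\<gamma> - \<sigma> - \<alpha>"])
  moreover have "y t = S (t - s) (y s) + (I t - S (t - s) (I s)) + (J t - S (t - s) (J s))"
    using assms by (simp add: solves_def)
  ultimately show ?thesis
    by simp
qed

text \<open>
  The expansion is applied on \<open>[0, t]\<close>.  Smoothing from the index \<open>\<gamma> - \<sigma>\<close>, or \<open>\<gamma> - \<sigma> - \<alpha>\<close> for the
  second order term, up to \<open>\<gamma>\<close> uses up part of the order \<open>\<alpha>\<close>, or \<open>2 \<alpha>\<close>, of the noise and leaves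
  \<open>\<alpha> - \<sigma>\<close> in both cases.
\<close>

lemma solves_sup_bound:
  "\<exists>C>0. \<forall>T X XX N y I J t. solves T X XX N y I J \<and> 0 \<le> t \<and> t \<le> T \<longrightarrow>
    nrm (B \<gamma>) (y t) \<le> C * data_bound T N (y 0)"
proof -
  obtain C1 where "C1 > 0" and C1: "\<And>T X XX N y I J. solves T X XX N y I J \<Longrightarrow>
    controlled_bounds \<alpha> (\<gamma> - \<sigma>) (C1 * (1 + N)) T X (\<lambda>t. G (y t)) (\<lambda>t. DGG B \<alpha> \<gamma> \<sigma> G (y t))"
    using solves_composition by meson
  obtain C2 where "C2 > 0" and C2: "\<And>T X XX N y I J K s t. solves T X XX N y I J \<Longrightarrow> 0 \<le> K \<Longrightarrow>
    \<forall>u\<in>{0..T}. nrm (B \<gamma>) (y u) \<le> K \<Longrightarrow> 0 \<le> s \<Longrightarrow> s < t \<Longrightarrow> t \<le> T \<Longrightarrow>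
    I t - S (t - s) (I s) \<in> car (B \<gamma>) \<and>
    nrm (B \<gamma>) (I t - S (t - s) (I s)) \<le> C2 * (1 + K) * (t - s) powr (1 - \<delta>)"
  proof -
    have "1 - \<delta> \<le> 1 - max 0 (\<delta> - 0)"
      using \<delta> by simp
    from solves_drift[OF order_refl this, unfolded diff_zero] show thesis
      using that by metis
  qed
  obtain C3 where "C3 > 0" and C3: "\<And>T X XX N y I J s t. solves T X XX N y I J \<Longrightarrow> 0 \<le> s \<Longrightarrow> s < t \<Longrightarrow> t \<le> T \<Longrightarrow>
    J t - S (t - s) (J s) - S (t - s) (rough_germ X XX y s t) \<in> car (B \<gamma>) \<and>
    nrm (B \<gamma>) (J t - S (t - s) (J s) - S (t - s) (rough_germ X XX y s t))
      \<le> C3 * (1 + N) * (t - s) powr (\<alpha> - \<sigma>)"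
  proof -
    have "0 \<le> 2 * \<alpha>"
      using \<alpha> by simp
    from solves_rough_remainder[OF order_refl this, unfolded diff_zero add_0] show thesis
      using that by metis
  qed
  obtain c0 where "c0 > 0" and c0: "\<And>t x. t \<in> {0..T\<^sub>0} \<Longrightarrow> x \<in> car (B \<gamma>) \<Longrightarrow> nrm (B \<gamma>) (S t x) \<le> c0 * nrm (B \<gamma>) x"
    using S_bounded[OF T\<^sub>0] by meson
  obtain c1 where "c1 > 0" and c1: "\<And>t x. t \<in> {0<..T\<^sub>0} \<Longrightarrow> x \<in> car (B (\<gamma> - \<sigma>)) \<Longrightarrow>
      S t x \<in> car (B \<gamma>) \<and> nrm (B \<gamma>) (S t x) \<le> c1 * t powr (- \<sigma>) * nrm (B (\<gamma> - \<sigma>)) x"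
  proof -
    have "\<sigma> \<le> 2" "\<gamma> \<le> \<gamma> - \<sigma> + \<sigma>"
      using \<sigma> \<alpha> by auto
    from S_smoothing_le[OF \<sigma>(1) this(1) T\<^sub>0 this(2)] show thesis
      using that by meson
  qed
  obtain c2 where "c2 > 0" and c2: "\<And>t x. t \<in> {0<..T\<^sub>0} \<Longrightarrow> x \<in> car (B (\<gamma> - \<sigma> - \<alpha>)) \<Longrightarrow>
      S t x \<in> car (B \<gamma>) \<and> nrm (B \<gamma>) (S t x) \<le> c2 * t powr (- (\<sigma> + \<alpha>)) * nrm (B (\<gamma> - \<sigma> - \<alpha>)) x"
  proof -
    have "0 \<le> \<sigma> + \<alpha>" "\<sigma> + \<alpha> \<le> 2" "\<gamma> \<le> \<gamma> - \<sigma> - \<alpha> + (\<sigma> + \<alpha>)"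
      using \<sigma> \<alpha> by auto
    from S_smoothing_le[OF this(1,2) T\<^sub>0 this(3)] show thesis
      using that by meson
  qed
  obtain k1 where "k1 > 0" and k1: "\<And>T h N x. 0 < h \<Longrightarrow> h \<le> T \<Longrightarrow> T \<le> T\<^sub>0 \<Longrightarrow> 0 \<le> N \<Longrightarrow> x \<in> car (B \<gamma>) \<Longrightarrow>
      (1 + N) * h powr (1 - \<delta>) \<le> k1 * data_bound T N x"
    using small_power_bound[of "1 - \<delta>"] by (metis min.cobounded2)
  obtain k2 where "k2 > 0" and k2: "\<And>T h N x. 0 < h \<Longrightarrow> h \<le> T \<Longrightarrow> T \<le> T\<^sub>0 \<Longrightarrow> 0 \<le> N \<Longrightarrow> x \<in> car (B \<gamma>) \<Longrightarrow>
      (1 + N) * h powr (\<alpha> - \<sigma>) \<le> k2 * data_bound T N x"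
    using small_power_bound[of "\<alpha> - \<sigma>"] by (metis min.cobounded1)
  define C where "C = 1 + c0 + C2 * k1 + (C3 + r * c1 * C1 + r * c2 * C1) * k2"
  have "0 \<le> c0 + C2 * k1 + (C3 + r * c1 * C1 + r * c2 * C1) * k2"
    using \<open>c0 > 0\<close> \<open>c1 > 0\<close> \<open>c2 > 0\<close> \<open>C1 > 0\<close> \<open>C2 > 0\<close> \<open>C3 > 0\<close> \<open>k1 > 0\<close> \<open>k2 > 0\<close> r by simp
  then have C: "C \<ge> 1"
    by (simp add: C_def)
  have "nrm (B \<gamma>) (y t) \<le> C * data_bound T N (y 0)"
    if sol: "solves T X XX N y I J" and t: "0 \<le> t" "t \<le> T" for T X XX N y I J t
  proof -
    let ?Q = "data_bound T N (y 0)"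
    have y0: "y 0 \<in> car (B \<gamma>)" and N: "0 \<le> N" and T: "T \<le> T\<^sub>0" and X: "rough_bounds \<alpha> r T X XX"
      using sol solves_mem[OF sol, of 0] t by (auto simp: solves_def)
    have Q: "1 \<le> ?Q" "nrm (B \<gamma>) (y 0) \<le> ?Q"
      using data_bound_ge[OF y0 N] by auto
    show ?thesis
    proof (cases "t = 0")
      case True
      have "?Q \<le> C * ?Q"
        using C Q mult_right_mono[of 1 C ?Q] by simp
      then show ?thesis
        unfolding True using Q(2) by linarith
    next
      case False
      then have t: "0 < t" "t \<le> T" "t \<in> {0<..T\<^sub>0}"
        using t T by auto
      note cb = C1[OF sol]
      have Gy: "G (y 0) \<in> car (B (\<gamma> - \<sigma>))" "nrm (B (\<gamma> - \<sigma>)) (G (y 0)) \<le> C1 * (1 + N)"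
        and Dy: "DGG B \<alpha> \<gamma> \<sigma> G (y 0) \<in> car (B (\<gamma> - \<sigma> - \<alpha>))"
          "nrm (B (\<gamma> - \<sigma> - \<alpha>)) (DGG B \<alpha> \<gamma> \<sigma> G (y 0)) \<le> C1 * (1 + N)"
        using cb t by (auto simp: controlled_bounds_def)
      have x: "\<bar>X t - X 0\<bar> \<le> r * t powr \<alpha>" "\<bar>XX 0 t\<bar> \<le> r * t powr (2 * \<alpha>)"
        using X[unfolded rough_bounds_def, THEN conjunct1, rule_format, of 0 t] t by auto
      define e1 e2 e3 e4 e5 where "e1 = S t (y 0)" and "e2 = I t - S t (I 0)"
        and "e3 = J t - S t (J 0) - S t (rough_germ X XX y 0 t)"
        and "e4 = (X t - X 0) *\<^sub>R S t (G (y 0))" and "e5 = XX 0 t *\<^sub>R S t (DGG B \<alpha> \<gamma> \<sigma> G (y 0))"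
      have eq: "y t = e1 + e2 + e3 + (e4 + e5)"
        using solves_expansion[OF sol order_refl t(1,2)] by (simp add: e1_def e2_def e3_def e4_def e5_def)
      have b1: "e1 \<in> car (B \<gamma>)" "nrm (B \<gamma>) e1 \<le> c0 * ?Q"
      proof -
        have "nrm (B \<gamma>) e1 \<le> c0 * nrm (B \<gamma>) (y 0)"
          unfolding e1_def using t T y0 by (intro c0) auto
        also have "\<dots> \<le> c0 * ?Q"
          using Q \<open>c0 > 0\<close> by simp
        finally show "nrm (B \<gamma>) e1 \<le> c0 * ?Q" .
      qed (use t y0 in \<open>auto simp: e1_def\<close>)
      have b2: "e2 \<in> car (B \<gamma>)" "nrm (B \<gamma>) e2 \<le> C2 * k1 * ?Q"
      proof -
        have *: "e2 \<in> car (B \<gamma>) \<and> nrm (B \<gamma>) e2 \<le> C2 * (1 + N) * t powr (1 - \<delta>)"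
          using C2[OF sol N _ order_refl t(1,2)] solves_mem[OF sol] by (simp add: e2_def)
        note *[THEN conjunct2]
        also have "C2 * (1 + N) * t powr (1 - \<delta>) \<le> C2 * (k1 * ?Q)"
          using k1[OF t(1,2) T N y0] \<open>C2 > 0\<close> by (simp add: mult.assoc)
        finally show "nrm (B \<gamma>) e2 \<le> C2 * k1 * ?Q" "e2 \<in> car (B \<gamma>)"
          using * by (auto simp: mult.assoc)
      qed
      have b3: "e3 \<in> car (B \<gamma>)" "nrm (B \<gamma>) e3 \<le> C3 * k2 * ?Q"
      proof -
        have *: "e3 \<in> car (B \<gamma>) \<and> nrm (B \<gamma>) e3 \<le> C3 * (1 + N) * t powr (\<alpha> - \<sigma>)"
          using C3[OF sol order_refl t(1,2)] by (simp add: e3_def)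
        note *[THEN conjunct2]
        also have "C3 * (1 + N) * t powr (\<alpha> - \<sigma>) \<le> C3 * (k2 * ?Q)"
          using k2[OF t(1,2) T N y0] \<open>C3 > 0\<close> by (simp add: mult.assoc)
        finally show "nrm (B \<gamma>) e3 \<le> C3 * k2 * ?Q" "e3 \<in> car (B \<gamma>)"
          using * by (auto simp: mult.assoc)
      qed
      have b4: "e4 \<in> car (B \<gamma>)" "nrm (B \<gamma>) e4 \<le> r * c1 * C1 * k2 * ?Q"
      proof -
        have m: "S t (G (y 0)) \<in> car (B \<gamma>)"
            and "nrm (B \<gamma>) (S t (G (y 0))) \<le> c1 * t powr (- \<sigma>) * nrm (B (\<gamma> - \<sigma>)) (G (y 0))"
          using c1[OF t(3) Gy(1)] by auto
        note this(2)
        also have "c1 * t powr (- \<sigma>) * nrm (B (\<gamma> - \<sigma>)) (G (y 0)) \<le> c1 * t powr (- \<sigma>) * (C1 * (1 + N))"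
          using Gy \<open>c1 > 0\<close> by (intro mult_left_mono) auto
        finally have "nrm (B \<gamma>) e4 \<le> (r * t powr \<alpha>) * (c1 * t powr (- \<sigma>) * (C1 * (1 + N)))"
          unfolding e4_def using x m r by (auto simp: nrm_scaleR[OF nsp] intro!: mult_mono)
        also have "\<dots> = r * c1 * C1 * ((1 + N) * (t powr \<alpha> * t powr (- \<sigma>)))"
          by (simp add: algebra_simps)
        also have "t powr \<alpha> * t powr (- \<sigma>) = t powr (\<alpha> - \<sigma>)"
          by (simp flip: powr_add)
        also have "r * c1 * C1 * ((1 + N) * t powr (\<alpha> - \<sigma>)) \<le> r * c1 * C1 * (k2 * ?Q)"
          using k2[OF t(1,2) T N y0] r \<open>c1 > 0\<close> \<open>C1 > 0\<close> by (intro mult_left_mono) auto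
        finally show "nrm (B \<gamma>) e4 \<le> r * c1 * C1 * k2 * ?Q" "e4 \<in> car (B \<gamma>)"
          using m by (auto simp: mult.assoc e4_def)
      qed
      have b5: "e5 \<in> car (B \<gamma>)" "nrm (B \<gamma>) e5 \<le> r * c2 * C1 * k2 * ?Q"
      proof -
        let ?D = "DGG B \<alpha> \<gamma> \<sigma> G (y 0)"
        have m: "S t ?D \<in> car (B \<gamma>)" and "nrm (B \<gamma>) (S t ?D) \<le> c2 * t powr (- (\<sigma> + \<alpha>)) * nrm (B (\<gamma> - \<sigma> - \<alpha>)) ?D"
          using c2[OF t(3) Dy(1)] by auto
        note this(2)
        also have "c2 * t powr (- (\<sigma> + \<alpha>)) * nrm (B (\<gamma> - \<sigma> - \<alpha>)) ?D \<le> c2 * t powr (- (\<sigma> + \<alpha>)) * (C1 * (1 + N))"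
          using Dy \<open>c2 > 0\<close> by (intro mult_left_mono) auto
        finally have "nrm (B \<gamma>) e5 \<le> (r * t powr (2 * \<alpha>)) * (c2 * t powr (- (\<sigma> + \<alpha>)) * (C1 * (1 + N)))"
          unfolding e5_def using x m r by (auto simp: nrm_scaleR[OF nsp] intro!: mult_mono)
        also have "\<dots> = r * c2 * C1 * ((1 + N) * (t powr (2 * \<alpha>) * t powr (- (\<sigma> + \<alpha>))))"
          by (simp add: algebra_simps)
        also have "t powr (2 * \<alpha>) * t powr (- (\<sigma> + \<alpha>)) = t powr (\<alpha> - \<sigma>)"
          by (simp flip: powr_add)
        also have "r * c2 * C1 * ((1 + N) * t powr (\<alpha> - \<sigma>)) \<le> r * c2 * C1 * (k2 * ?Q)"
          using k2[OF t(1,2) T N y0] r \<open>c2 > 0\<close> \<open>C1 > 0\<close> by (intro mult_left_mono) auto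
        finally show "nrm (B \<gamma>) e5 \<le> r * c2 * C1 * k2 * ?Q" "e5 \<in> car (B \<gamma>)"
          using m by (auto simp: mult.assoc e5_def)
      qed
      have "nrm (B \<gamma>) (y t) \<le> nrm (B \<gamma>) e1 + nrm (B \<gamma>) e2 + nrm (B \<gamma>) e3 + (nrm (B \<gamma>) e4 + nrm (B \<gamma>) e5)"
        unfolding eq using b1(1) b2(1) b3(1) b4(1) b5(1)
        by (intro order_trans[OF nrm_add[OF nsp]] add_mono order_refl ns_add)
      also have "\<dots> \<le> 1 * ?Q + c0 * ?Q + C2 * k1 * ?Q + C3 * k2 * ?Q + (r * c1 * C1 * k2 * ?Q
          + r * c2 * C1 * k2 * ?Q)"
        using b1 b2 b3 b4 b5 Q by linarith
      also have "\<dots> = C * ?Q"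
        by (simp add: C_def algebra_simps)
      finally show ?thesis .
    qed
  qed
  then show ?thesis
    using C by (intro exI[of _ C]) auto
qed

text \<open>
  The order \<open>\<alpha>\<close> in the weak space and the order \<open>0\<close> in the strong space interpolate, with the
  weights \<open>(\<alpha> - \<sigma>) / \<alpha>\<close> and \<open>\<sigma> / \<alpha>\<close>, to the order \<open>\<alpha> - \<sigma>\<close>.
\<close>

lemma interpolation_bound:
  "\<exists>C>0. \<forall>x\<in>car (B (\<gamma> - \<sigma>)). \<forall>L\<ge>0. \<forall>t>0.
    nrm (B (\<gamma> - \<sigma> - \<alpha>)) x \<le> L * t powr \<alpha> \<and> nrm (B (\<gamma> - \<sigma>)) x \<le> L \<longrightarrow>
    nrm (B (\<gamma> - \<alpha>)) x \<le> C * L * t powr (\<alpha> - \<sigma>)"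
proof -
  have pos: "0 < \<alpha>"
    using \<alpha> by simp
  have "\<forall>\<theta> \<beta> \<kappa>. \<theta> \<le> \<beta> \<and> \<beta> \<le> \<kappa> \<longrightarrow> (\<exists>C. \<forall>x\<in>car (B \<kappa>).
      nrm (B \<beta>) x powr (\<kappa> - \<theta>) \<le> C * nrm (B \<theta>) x powr (\<kappa> - \<beta>) * nrm (B \<kappa>) x powr (\<beta> - \<theta>))"
    using scale unfolding interpolation_scale_def by blast
  from this[rule_format, of "\<gamma> - \<sigma> - \<alpha>" "\<gamma> - \<alpha>" "\<gamma> - \<sigma>"]
  obtain K where K: "\<And>x. x \<in> car (B (\<gamma> - \<sigma>)) \<Longrightarrow> nrm (B (\<gamma> - \<alpha>)) x powr \<alpha>
      \<le> K * nrm (B (\<gamma> - \<sigma> - \<alpha>)) x powr (\<alpha> - \<sigma>) * nrm (B (\<gamma> - \<sigma>)) x powr \<sigma>"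
    using \<sigma> by auto
  define K' where "K' = 1 + \<bar>K\<bar>"
  have "nrm (B (\<gamma> - \<alpha>)) x \<le> K' powr (1 / \<alpha>) * L * t powr (\<alpha> - \<sigma>)"
    if x: "x \<in> car (B (\<gamma> - \<sigma>))" and L: "0 \<le> L" and t: "0 < t"
    and b: "nrm (B (\<gamma> - \<sigma> - \<alpha>)) x \<le> L * t powr \<alpha>" "nrm (B (\<gamma> - \<sigma>)) x \<le> L" for x L t
  proof -
    have m: "x \<in> car (B (\<gamma> - \<sigma> - \<alpha>))" "x \<in> car (B (\<gamma> - \<alpha>))"
      using x pos \<sigma> scale_mem[OF x] by auto
    have "nrm (B (\<gamma> - \<alpha>)) x powr \<alpha>
        \<le> K * (nrm (B (\<gamma> - \<sigma> - \<alpha>)) x powr (\<alpha> - \<sigma>) * nrm (B (\<gamma> - \<sigma>)) x powr \<sigma>)"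
      using K[OF x] by (simp add: mult.assoc)
    also have "\<dots> \<le> K' * ((L * t powr \<alpha>) powr (\<alpha> - \<sigma>) * L powr \<sigma>)"
      using b \<sigma> x m L by (intro mult_mono powr_mono2) (auto simp: K'_def)
    also have "(L * t powr \<alpha>) powr (\<alpha> - \<sigma>) * L powr \<sigma> = (L powr (\<alpha> - \<sigma>) * L powr \<sigma>) * (t powr (\<alpha> - \<sigma>)) powr \<alpha>"
      using L t by (simp add: powr_mult powr_powr mult.commute)
    also have "L powr (\<alpha> - \<sigma>) * L powr \<sigma> = L powr \<alpha>"
      by (simp flip: powr_add)
    also have "K' * (L powr \<alpha> * (t powr (\<alpha> - \<sigma>)) powr \<alpha>) = (K' powr (1 / \<alpha>) * L * t powr (\<alpha> - \<sigma>)) powr \<alpha>"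
      using L t pos by (simp add: powr_mult powr_powr K'_def)
    finally have le: "nrm (B (\<gamma> - \<alpha>)) x powr \<alpha> \<le> (K' powr (1 / \<alpha>) * L * t powr (\<alpha> - \<sigma>)) powr \<alpha>" .
    show ?thesis
    proof (rule ccontr)
      assume "\<not> ?thesis"
      then have "(K' powr (1 / \<alpha>) * L * t powr (\<alpha> - \<sigma>)) powr \<alpha> < nrm (B (\<gamma> - \<alpha>)) x powr \<alpha>"
        using L pos by (intro powr_less_mono2) auto
      then show False
        using le by simp
    qed
  qed
  moreover have "K' powr (1 / \<alpha>) > 0"
    by (simp add: K'_def)
  ultimately show ?thesis
    by blast
qed

text \<open>
  \<open>G(y)\<close> takes values in the space of index \<open>\<gamma> - \<alpha>\<close>, but \<open>G\<close> is not assumed to be Lipschitz into that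
  space.  Its increment over \<open>[0, t]\<close> is of order \<open>\<alpha>\<close> in the space of index \<open>\<gamma> - \<sigma> - \<alpha>\<close> and bounded in that of
  index \<open>\<gamma> - \<sigma>\<close>, and interpolation yields the factor \<open>t powr (\<alpha> - \<sigma>)\<close>.
\<close>

lemma solves_G_bound:
  "\<exists>C>0. \<forall>T X XX N y I J t. solves T X XX N y I J \<and> 0 \<le> t \<and> t \<le> T \<longrightarrow>
    nrm (B (\<gamma> - \<alpha>)) (G (y t)) \<le> C * data_bound T N (y 0)"
proof -
  obtain C1 where "C1 > 0" and C1: "\<And>T X XX N y I J. solves T X XX N y I J \<Longrightarrow>
    controlled_bounds \<alpha> (\<gamma> - \<sigma>) (C1 * (1 + N)) T X (\<lambda>t. G (y t)) (\<lambda>t. DGG B \<alpha> \<gamma> \<sigma> G (y t))"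
    using solves_composition by meson
  obtain M where "M > 0" and "\<forall>\<theta>\<in>{0, \<alpha>, 2 * \<alpha>}. \<forall>x\<in>car (B (\<gamma> - \<theta>)). G x \<in> car (B (\<gamma> - \<sigma> - \<theta>)) \<and>
       (\<forall>y\<in>car (B (\<gamma> - \<theta>)). nrm (B (\<gamma> - \<sigma> - \<theta>)) (G y - G x) \<le> M * nrm (B (\<gamma> - \<theta>)) (y - x))"
    using assumption_G_estimates[OF G \<sigma>] by (elim exE conjE) blast
  from this(2)[rule_format, of 0]
  have G0: "G x \<in> car (B (\<gamma> - \<sigma>))" "nrm (B (\<gamma> - \<sigma>)) (G y - G x) \<le> M * nrm (B \<gamma>) (y - x)"
    if "x \<in> car (B \<gamma>)" "y \<in> car (B \<gamma>)" for x y
    using that by auto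
  define k where "k = nrm (B (\<gamma> - \<sigma>)) (G 0)"
  have k: "k \<ge> 0"
    using G0(1)[of 0 0] by (simp add: k_def)
  obtain c where "c > 0" and c: "\<And>x. x \<in> car (B (\<gamma> - \<sigma>)) \<Longrightarrow> nrm (B (\<gamma> - \<alpha>)) x \<le> c * nrm (B (\<gamma> - \<sigma>)) x"
    using scale_embedding[of "\<gamma> - \<alpha>" "\<gamma> - \<sigma>"] \<sigma> by auto
  obtain C2 where "C2 > 0" and C2: "\<And>x L t. x \<in> car (B (\<gamma> - \<sigma>)) \<Longrightarrow> L \<ge> 0 \<Longrightarrow> t > 0 \<Longrightarrow>
    nrm (B (\<gamma> - \<sigma> - \<alpha>)) x \<le> L * t powr \<alpha> \<Longrightarrow> nrm (B (\<gamma> - \<sigma>)) x \<le> L \<Longrightarrow>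
    nrm (B (\<gamma> - \<alpha>)) x \<le> C2 * L * t powr (\<alpha> - \<sigma>)"
    using interpolation_bound by meson
  obtain k2 where "k2 > 0" and k2: "\<And>T h N x. 0 < h \<Longrightarrow> h \<le> T \<Longrightarrow> T \<le> T\<^sub>0 \<Longrightarrow> 0 \<le> N \<Longrightarrow> x \<in> car (B \<gamma>) \<Longrightarrow>
      (1 + N) * h powr (\<alpha> - \<sigma>) \<le> k2 * data_bound T N x"
    using small_power_bound[of "\<alpha> - \<sigma>"] by (metis min.cobounded1)
  define C where "C = c * (k + M) + C2 * (2 + r) * C1 * k2"
  have C: "C > 0"
    using \<open>c > 0\<close> \<open>M > 0\<close> \<open>C1 > 0\<close> \<open>C2 > 0\<close> \<open>k2 > 0\<close> k r by (simp add: C_def add_pos_pos add_nonneg_pos)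
  have "nrm (B (\<gamma> - \<alpha>)) (G (y t)) \<le> C * data_bound T N (y 0)"
    if sol: "solves T X XX N y I J" and t: "0 \<le> t" "t \<le> T" for T X XX N y I J t
  proof -
    let ?Q = "data_bound T N (y 0)"
    have N: "0 \<le> N" and T: "T \<le> T\<^sub>0" and X: "rough_bounds \<alpha> r T X XX"
      using solvesD[OF sol] by auto
    have y0: "y 0 \<in> car (B \<gamma>)" and yt: "y t \<in> car (B \<gamma>)"
      using solves_mem[OF sol] t by auto
    have Q: "1 \<le> ?Q" "nrm (B \<gamma>) (y 0) \<le> ?Q"
      using data_bound_ge[OF y0 N] by auto
    have Gm: "G (y 0) \<in> car (B (\<gamma> - \<sigma>))" "G (y t) \<in> car (B (\<gamma> - \<sigma>))" "G 0 \<in> car (B (\<gamma> - \<sigma>))"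
      using G0(1)[OF y0 y0] G0(1)[OF yt yt] G0(1)[OF ns_zero ns_zero] by auto
    have Gma: "G (y 0) \<in> car (B (\<gamma> - \<alpha>))" "G (y t) \<in> car (B (\<gamma> - \<alpha>))"
      using solves_mem(3)[OF sol] t by auto
    have initial: "nrm (B (\<gamma> - \<alpha>)) (G (y 0)) \<le> c * (k + M) * ?Q"
    proof -
      have "nrm (B (\<gamma> - \<sigma>)) (G (y 0)) \<le> nrm (B (\<gamma> - \<sigma>)) (G (y 0) - G 0) + k"
        using nrm_add[OF nsp ns_diff[OF Gm(1,3)] Gm(3)] by (simp add: k_def)
      also have "\<dots> \<le> M * nrm (B \<gamma>) (y 0) + k"
        using G0(2)[OF ns_zero y0] by simp
      also have "\<dots> \<le> M * ?Q + k * ?Q"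
        using Q k \<open>M > 0\<close> by (intro add_mono mult_left_mono) (auto simp: mult_le_cancel_left1)
      finally have "nrm (B (\<gamma> - \<sigma>)) (G (y 0)) \<le> (k + M) * ?Q"
        by (simp add: algebra_simps)
      then have "c * nrm (B (\<gamma> - \<sigma>)) (G (y 0)) \<le> c * ((k + M) * ?Q)"
        using \<open>c > 0\<close> by simp
      then show ?thesis
        using c[OF Gm(1)] by (simp add: mult.assoc)
    qed
    show ?thesis
    proof (cases "t = 0")
      case True
      have "c * (k + M) * ?Q \<le> C * ?Q"
        using Q \<open>C1 > 0\<close> \<open>C2 > 0\<close> \<open>k2 > 0\<close> r by (intro mult_right_mono) (auto simp: C_def)
      then show ?thesis
        unfolding True using initial by linarith
    next
      case False
      then have t: "0 < t" "t \<le> T"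
        using t by auto
      let ?L = "(2 + r) * (C1 * (1 + N))"
      have CN: "C1 * (1 + N) \<ge> 0"
        using N \<open>C1 > 0\<close> by simp
      have cb: "controlled_bounds \<alpha> (\<gamma> - \<sigma>) (C1 * (1 + N)) T X (\<lambda>t. G (y t)) (\<lambda>t. DGG B \<alpha> \<gamma> \<sigma> G (y t))"
        by (rule C1[OF sol])
      have "nrm (B (\<gamma> - \<sigma> - \<alpha>)) (G (y t) - G (y 0)) \<le> (C1 * (1 + N) + r * (C1 * (1 + N))) * (t - 0) powr \<alpha>"
      proof (rule controlled_increment_bound[OF X cb])
        show "nrm (B (\<gamma> - \<sigma> - \<alpha>)) (DGG B \<alpha> \<gamma> \<sigma> G (y 0)) \<le> C1 * (1 + N)"
          using cb t by (simp add: controlled_bounds_def)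
        show "nrm (B (\<gamma> - \<sigma> - \<alpha>)) (remainder X (\<lambda>t. G (y t)) (\<lambda>t. DGG B \<alpha> \<gamma> \<sigma> G (y t)) 0 t)
            \<le> C1 * (1 + N) * (t - 0) powr \<alpha>"
          using cb[unfolded controlled_bounds_def, THEN conjunct2, rule_format, of 0 t] t by simp
      qed (use \<alpha> t r in auto)
      also have "\<dots> \<le> ?L * t powr \<alpha>"
        unfolding diff_zero
      proof (rule mult_right_mono)
        show "C1 * (1 + N) + r * (C1 * (1 + N)) \<le> ?L"
          using CN by (simp add: algebra_simps)
      qed simp
      finally have 1: "nrm (B (\<gamma> - \<sigma> - \<alpha>)) (G (y t) - G (y 0)) \<le> ?L * t powr \<alpha>" .
      have "nrm (B (\<gamma> - \<sigma>)) (G (y t)) \<le> C1 * (1 + N)" "nrm (B (\<gamma> - \<sigma>)) (G (y 0)) \<le> C1 * (1 + N)"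
        using cb t by (auto simp: controlled_bounds_def)
      then have "nrm (B (\<gamma> - \<sigma>)) (G (y t) - G (y 0)) \<le> 2 * (C1 * (1 + N))"
        using nrm_diff[OF nsp Gm(2,1)] by simp
      also have "\<dots> \<le> ?L"
        using CN r by (intro mult_right_mono) auto
      finally have 2: "nrm (B (\<gamma> - \<sigma>)) (G (y t) - G (y 0)) \<le> ?L" .
      have "nrm (B (\<gamma> - \<alpha>)) (G (y t) - G (y 0)) \<le> C2 * ?L * t powr (\<alpha> - \<sigma>)"
        using CN r t 1 2 Gm by (intro C2) auto
      also have "\<dots> = C2 * (2 + r) * C1 * ((1 + N) * t powr (\<alpha> - \<sigma>))"
        by simp
      also have "\<dots> \<le> C2 * (2 + r) * C1 * (k2 * ?Q)"
        using k2[OF t T N y0] \<open>C1 > 0\<close> \<open>C2 > 0\<close> r by (intro mult_left_mono) auto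
      finally have "nrm (B (\<gamma> - \<alpha>)) (G (y t) - G (y 0)) \<le> C2 * (2 + r) * C1 * (k2 * ?Q)" .
      then show ?thesis
        using nrm_add[OF nsp ns_diff[OF Gma(2,1)] Gma(1)] initial by (simp add: C_def algebra_simps)
    qed
  qed
  then show ?thesis
    using C by (intro exI[of _ C]) auto
qed

text \<open>
  The bound for \<open>G(y)\<close>, and not just \<open>N\<close>, is needed: in the remainder of order \<open>2 \<alpha>\<close> the second order term
  of the germ comes without any small factor.
\<close>

lemma solves_DGG_bound:
  "\<exists>C>0. \<forall>T X XX N y I J t. solves T X XX N y I J \<and> 0 \<le> t \<and> t \<le> T \<longrightarrow>
    DGG B \<alpha> \<gamma> \<sigma> G (y t) \<in> car (B (\<gamma> - \<sigma> - \<alpha>)) \<and>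
    nrm (B (\<gamma> - \<sigma> - \<alpha>)) (DGG B \<alpha> \<gamma> \<sigma> G (y t)) \<le> C * data_bound T N (y 0)"
proof -
  obtain M where "M > 0" and M: "\<And>x. x \<in> car (B (\<gamma> - \<alpha>)) \<Longrightarrow> G x \<in> car (B (\<gamma> - \<alpha>)) \<Longrightarrow>
       DGG B \<alpha> \<gamma> \<sigma> G x \<in> car (B (\<gamma> - \<sigma> - \<alpha>)) \<and>
       nrm (B (\<gamma> - \<sigma> - \<alpha>)) (DGG B \<alpha> \<gamma> \<sigma> G x) \<le> M * nrm (B (\<gamma> - \<alpha>)) (G x)"
    using assumption_G_estimates[OF G \<sigma>] by (elim exE conjE) blast
  obtain C1 where "C1 > 0" and C1: "\<And>T X XX N y I J t. solves T X XX N y I J \<Longrightarrow> 0 \<le> t \<Longrightarrow> t \<le> T \<Longrightarrow>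
    nrm (B (\<gamma> - \<alpha>)) (G (y t)) \<le> C1 * data_bound T N (y 0)"
    using solves_G_bound by meson
  have "DGG B \<alpha> \<gamma> \<sigma> G (y t) \<in> car (B (\<gamma> - \<sigma> - \<alpha>)) \<and>
      nrm (B (\<gamma> - \<sigma> - \<alpha>)) (DGG B \<alpha> \<gamma> \<sigma> G (y t)) \<le> M * C1 * data_bound T N (y 0)"
    if sol: "solves T X XX N y I J" and t: "0 \<le> t" "t \<le> T" for T X XX N y I J t
  proof -
    have y: "y t \<in> car (B (\<gamma> - \<alpha>))" "G (y t) \<in> car (B (\<gamma> - \<alpha>))"
      using solves_mem[OF sol t] scale_mem[of "y t" \<gamma> "\<gamma> - \<alpha>"] \<alpha> by auto
    have "nrm (B (\<gamma> - \<sigma> - \<alpha>)) (DGG B \<alpha> \<gamma> \<sigma> G (y t)) \<le> M * nrm (B (\<gamma> - \<alpha>)) (G (y t))"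
      using M[OF y] by simp
    also have "\<dots> \<le> M * (C1 * data_bound T N (y 0))"
      using C1[OF sol t] \<open>M > 0\<close> by simp
    finally show ?thesis
      using M[OF y] by (simp add: mult.assoc)
  qed
  moreover have "M * C1 > 0"
    using \<open>M > 0\<close> \<open>C1 > 0\<close> by simp
  ultimately show ?thesis
    by (intro exI[of _ "M * C1"]) auto
qed

text \<open>
  Subtracting \<open>G(y\<^sub>s)\<close> times the increment of \<open>X\<close> from the expansion leaves \<open>S (t - s) - Id\<close> applied to \<open>y\<^sub>s\<close>
  and to \<open>G(y\<^sub>s)\<close>, the drift, the sewing error and the second order term.  The term with \<open>y\<^sub>s\<close> and the
  drift are controlled by the supremum of \<open>y\<close>, the second order term by that of \<open>DG(y) G(y)\<close>; the term with
  \<open>G(y\<^sub>s)\<close> and the sewing error carry the extra factor \<open>(t - s) powr (\<alpha> - \<sigma>)\<close>.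
\<close>

lemma solves_remainder_bound:
  assumes a: "a \<in> {\<alpha>, 2 * \<alpha>}"
  shows "\<exists>C>0. \<forall>T X XX N y I J s t. solves T X XX N y I J \<and> 0 \<le> s \<and> s < t \<and> t \<le> T \<longrightarrow>
    nrm (B (\<gamma> - a)) (remainder X y (\<lambda>t. G (y t)) s t) \<le> C * data_bound T N (y 0) * (t - s) powr a"
proof -
  have a': "0 < a" "\<alpha> \<le> a" "a \<le> 2 * \<alpha>" "a < 1" "\<sigma> < a"
    using a \<alpha> \<sigma> by auto
  obtain C1 where "C1 > 0" and C1: "\<And>T X XX N y I J. solves T X XX N y I J \<Longrightarrow>
    controlled_bounds \<alpha> (\<gamma> - \<sigma>) (C1 * (1 + N)) T X (\<lambda>t. G (y t)) (\<lambda>t. DGG B \<alpha> \<gamma> \<sigma> G (y t))"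
    using solves_composition by meson
  obtain A1 where "A1 > 0" and A1: "\<And>T X XX N y I J t. solves T X XX N y I J \<Longrightarrow> 0 \<le> t \<Longrightarrow> t \<le> T \<Longrightarrow>
    nrm (B \<gamma>) (y t) \<le> A1 * data_bound T N (y 0)"
    using solves_sup_bound by meson
  obtain A2 where "A2 > 0" and A2: "\<And>T X XX N y I J t. solves T X XX N y I J \<Longrightarrow> 0 \<le> t \<Longrightarrow> t \<le> T \<Longrightarrow>
    DGG B \<alpha> \<gamma> \<sigma> G (y t) \<in> car (B (\<gamma> - \<sigma> - \<alpha>)) \<and>
    nrm (B (\<gamma> - \<sigma> - \<alpha>)) (DGG B \<alpha> \<gamma> \<sigma> G (y t)) \<le> A2 * data_bound T N (y 0)"
    using solves_DGG_bound by meson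
  obtain C2 where "C2 > 0" and C2: "\<And>T X XX N y I J K s t. solves T X XX N y I J \<Longrightarrow> 0 \<le> K \<Longrightarrow>
    \<forall>u\<in>{0..T}. nrm (B \<gamma>) (y u) \<le> K \<Longrightarrow> 0 \<le> s \<Longrightarrow> s < t \<Longrightarrow> t \<le> T \<Longrightarrow>
    I t - S (t - s) (I s) \<in> car (B (\<gamma> - a)) \<and>
    nrm (B (\<gamma> - a)) (I t - S (t - s) (I s)) \<le> C2 * (1 + K) * (t - s) powr a"
  proof -
    have "0 \<le> a" "a \<le> 1 - max 0 (\<delta> - a)"
      using a' \<delta> by auto
    from solves_drift[OF this] show thesis
      using that by metis
  qed
  obtain C3 where "C3 > 0" and C3: "\<And>T X XX N y I J s t. solves T X XX N y I J \<Longrightarrow> 0 \<le> s \<Longrightarrow> s < t \<Longrightarrow> t \<le> T \<Longrightarrow>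
    J t - S (t - s) (J s) - S (t - s) (rough_germ X XX y s t) \<in> car (B (\<gamma> - a)) \<and>
    nrm (B (\<gamma> - a)) (J t - S (t - s) (J s) - S (t - s) (rough_germ X XX y s t))
      \<le> C3 * (1 + N) * (t - s) powr (a + (\<alpha> - \<sigma>))"
  proof -
    have "0 \<le> a"
      using a' by simp
    from solves_rough_remainder[OF this a'(3)] show thesis
      using that by metis
  qed
  obtain c0 where "c0 > 0" and c0: "\<And>t x. t \<in> {0<..T\<^sub>0} \<Longrightarrow> x \<in> car (B \<gamma>) \<Longrightarrow>
      nrm (B (\<gamma> - a)) (S t x - x) \<le> c0 * t powr a * nrm (B \<gamma>) x"
    using S_minus_id_bound[OF _ _ T\<^sub>0, of a "\<gamma> - a"] a' by auto
  obtain c1 where "c1 > 0" and c1: "\<And>t x. t \<in> {0<..T\<^sub>0} \<Longrightarrow> x \<in> car (B (\<gamma> - \<sigma>)) \<Longrightarrow>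
      nrm (B (\<gamma> - a)) (S t x - x) \<le> c1 * t powr (a - \<sigma>) * nrm (B (\<gamma> - \<sigma>)) x"
  proof -
    have "0 \<le> a - \<sigma>" "a - \<sigma> \<le> 1"
      using a' \<sigma> by auto
    moreover have "\<gamma> - a + (a - \<sigma>) = \<gamma> - \<sigma>"
      by simp
    ultimately show thesis
      using S_minus_id_bound[OF _ _ T\<^sub>0, of "a - \<sigma>" "\<gamma> - a"] that by metis
  qed
  obtain c2 where "c2 > 0" and c2: "\<And>t x. t \<in> {0<..T\<^sub>0} \<Longrightarrow> x \<in> car (B (\<gamma> - \<sigma> - \<alpha>)) \<Longrightarrow>
      S t x \<in> car (B (\<gamma> - a)) \<and> nrm (B (\<gamma> - a)) (S t x) \<le> c2 * t powr (- (2 * \<alpha> - a)) * nrm (B (\<gamma> - \<sigma> - \<alpha>)) x"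
  proof -
    have "0 \<le> 2 * \<alpha> - a" "2 * \<alpha> - a \<le> 2" "\<gamma> - a \<le> \<gamma> - \<sigma> - \<alpha> + (2 * \<alpha> - a)"
      using a' \<alpha> \<sigma> by auto
    from S_smoothing_le[OF this(1,2) T\<^sub>0 this(3)] show thesis
      using that by meson
  qed
  obtain k2 where "k2 > 0" and k2: "\<And>T h N x. 0 < h \<Longrightarrow> h \<le> T \<Longrightarrow> T \<le> T\<^sub>0 \<Longrightarrow> 0 \<le> N \<Longrightarrow> x \<in> car (B \<gamma>) \<Longrightarrow>
      (1 + N) * h powr (\<alpha> - \<sigma>) \<le> k2 * data_bound T N x"
    using small_power_bound[of "\<alpha> - \<sigma>"] by (metis min.cobounded1)
  define C where "C = c0 * A1 + C2 * (1 + A1) + C3 * k2 + r * c1 * C1 * k2 + r * c2 * A2"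
  have C: "C > 0"
    using \<open>c0 > 0\<close> \<open>c1 > 0\<close> \<open>c2 > 0\<close> \<open>C1 > 0\<close> \<open>C2 > 0\<close> \<open>C3 > 0\<close> \<open>A1 > 0\<close> \<open>A2 > 0\<close> \<open>k2 > 0\<close> r
    by (simp add: C_def add_pos_nonneg)
  have "nrm (B (\<gamma> - a)) (remainder X y (\<lambda>t. G (y t)) s t) \<le> C * data_bound T N (y 0) * (t - s) powr a"
    if sol: "solves T X XX N y I J" and st: "0 \<le> s" "s < t" "t \<le> T" for T X XX N y I J s t
  proof -
    let ?Q = "data_bound T N (y 0)" and ?D = "DGG B \<alpha> \<gamma> \<sigma> G (y s)" and ?E = "B (\<gamma> - a)"
    define h where "h = t - s"
    have N: "0 \<le> N" and T: "T \<le> T\<^sub>0" and X: "rough_bounds \<alpha> r T X XX"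
      using solvesD[OF sol] by auto
    have h: "0 < h" "h \<le> T" "h \<in> {0<..T\<^sub>0}"
      using st T by (auto simp: h_def)
    have y0: "y 0 \<in> car (B \<gamma>)" and ys: "y s \<in> car (B \<gamma>)" "nrm (B \<gamma>) (y s) \<le> A1 * ?Q"
      using solves_mem[OF sol] A1[OF sol] st by auto
    have Q: "1 \<le> ?Q"
      using data_bound_ge[OF y0 N] by auto
    have Ds: "?D \<in> car (B (\<gamma> - \<sigma> - \<alpha>))" "nrm (B (\<gamma> - \<sigma> - \<alpha>)) ?D \<le> A2 * ?Q"
      using A2[OF sol, of s] st by auto
    have Gy: "G (y s) \<in> car (B (\<gamma> - \<sigma>))" "nrm (B (\<gamma> - \<sigma>)) (G (y s)) \<le> C1 * (1 + N)"
      using C1[OF sol] st by (auto simp: controlled_bounds_def)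
    have Gm: "G (y s) \<in> car ?E" and ym: "y s \<in> car ?E"
      using scale_mem[OF Gy(1), of "\<gamma> - a"] scale_mem[OF ys(1), of "\<gamma> - a"] a' by auto
    have x: "\<bar>X t - X s\<bar> \<le> r * h powr \<alpha>" "\<bar>XX s t\<bar> \<le> r * h powr (2 * \<alpha>)"
      using X[unfolded rough_bounds_def, THEN conjunct1, rule_format, of s t] st by (auto simp: h_def)
    have small: "(1 + N) * h powr (\<alpha> - \<sigma>) \<le> k2 * ?Q"
      by (rule k2[OF h(1,2) T N y0])
    define e1 e2 e3 e4 e5 where "e1 = S h (y s) - y s" and "e2 = I t - S h (I s)"
      and "e3 = J t - S h (J s) - S h (rough_germ X XX y s t)"
      and "e4 = (X t - X s) *\<^sub>R (S h (G (y s)) - G (y s))" and "e5 = XX s t *\<^sub>R S h ?D"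
    have eq: "remainder X y (\<lambda>t. G (y t)) s t = e1 + e2 + e3 + (e4 + e5)"
      using solves_expansion[OF sol st]
      by (simp add: remainder_def e1_def e2_def e3_def e4_def e5_def h_def scaleR_diff_right)
    have b1: "e1 \<in> car ?E" "nrm ?E e1 \<le> c0 * A1 * ?Q * h powr a"
    proof -
      have "nrm ?E e1 \<le> c0 * h powr a * nrm (B \<gamma>) (y s)"
        unfolding e1_def by (rule c0[OF h(3) ys(1)])
      also have "\<dots> \<le> c0 * h powr a * (A1 * ?Q)"
        using ys \<open>c0 > 0\<close> by (intro mult_left_mono) auto
      finally show "nrm ?E e1 \<le> c0 * A1 * ?Q * h powr a"
        by (simp add: algebra_simps)
    qed (use h ym in \<open>auto simp: e1_def\<close>)
    have b2: "e2 \<in> car ?E" "nrm ?E e2 \<le> C2 * (1 + A1) * ?Q * h powr a"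
    proof -
      have *: "e2 \<in> car ?E \<and> nrm ?E e2 \<le> C2 * (1 + A1 * ?Q) * h powr a"
        unfolding e2_def h_def using A1[OF sol] Q \<open>A1 > 0\<close> by (intro C2[OF sol _ _ st]) auto
      note *[THEN conjunct2]
      also have "C2 * (1 + A1 * ?Q) * h powr a \<le> C2 * ((1 + A1) * ?Q) * h powr a"
        using Q \<open>C2 > 0\<close> by (intro mult_right_mono mult_left_mono) (auto simp: algebra_simps)
      finally show "nrm ?E e2 \<le> C2 * (1 + A1) * ?Q * h powr a" "e2 \<in> car ?E"
        using * by (auto simp: mult.assoc)
    qed
    have b3: "e3 \<in> car ?E" "nrm ?E e3 \<le> C3 * k2 * ?Q * h powr a"
    proof -
      have *: "e3 \<in> car ?E \<and> nrm ?E e3 \<le> C3 * (1 + N) * h powr (a + (\<alpha> - \<sigma>))"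
        unfolding e3_def h_def by (rule C3[OF sol st])
      note *[THEN conjunct2]
      also have "C3 * (1 + N) * h powr (a + (\<alpha> - \<sigma>)) = C3 * ((1 + N) * h powr (\<alpha> - \<sigma>)) * h powr a"
      proof -
        have "h powr (a + (\<alpha> - \<sigma>)) = h powr (\<alpha> - \<sigma>) * h powr a"
          by (simp add: powr_add mult.commute)
        then show ?thesis
          by (simp add: mult.assoc)
      qed
      also have "\<dots> \<le> C3 * (k2 * ?Q) * h powr a"
        using small \<open>C3 > 0\<close> by (intro mult_right_mono mult_left_mono) auto
      finally show "nrm ?E e3 \<le> C3 * k2 * ?Q * h powr a" "e3 \<in> car ?E"
        using * by (auto simp: mult.assoc)
    qed
    have b4: "e4 \<in> car ?E" "nrm ?E e4 \<le> r * c1 * C1 * k2 * ?Q * h powr a"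
    proof -
      have m: "S h (G (y s)) - G (y s) \<in> car ?E"
        using Gm h by auto
      have "nrm ?E (S h (G (y s)) - G (y s)) \<le> c1 * h powr (a - \<sigma>) * nrm (B (\<gamma> - \<sigma>)) (G (y s))"
        by (rule c1[OF h(3) Gy(1)])
      also have "\<dots> \<le> c1 * h powr (a - \<sigma>) * (C1 * (1 + N))"
        using Gy \<open>c1 > 0\<close> by (intro mult_left_mono) auto
      finally have "nrm ?E e4 \<le> (r * h powr \<alpha>) * (c1 * h powr (a - \<sigma>) * (C1 * (1 + N)))"
        unfolding e4_def nrm_scaleR[OF nsp m] using x m r by (intro mult_mono) auto
      also have "\<dots> = r * c1 * C1 * ((1 + N) * (h powr \<alpha> * h powr (a - \<sigma>)))"
        by (simp add: algebra_simps)
      also have "h powr \<alpha> * h powr (a - \<sigma>) = h powr (\<alpha> - \<sigma>) * h powr a"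
        by (simp add: algebra_simps flip: powr_add)
      also have "r * c1 * C1 * ((1 + N) * (h powr (\<alpha> - \<sigma>) * h powr a))
          = r * c1 * C1 * ((1 + N) * h powr (\<alpha> - \<sigma>)) * h powr a"
        by (simp add: mult.assoc)
      also have "\<dots> \<le> r * c1 * C1 * (k2 * ?Q) * h powr a"
        using small r \<open>c1 > 0\<close> \<open>C1 > 0\<close> by (intro mult_right_mono mult_left_mono) auto
      finally show "nrm ?E e4 \<le> r * c1 * C1 * k2 * ?Q * h powr a" "e4 \<in> car ?E"
        using m by (auto simp: mult.assoc e4_def)
    qed
    have b5: "e5 \<in> car ?E" "nrm ?E e5 \<le> r * c2 * A2 * ?Q * h powr a"
    proof -
      have m: "S h ?D \<in> car ?E" and "nrm ?E (S h ?D) \<le> c2 * h powr (- (2 * \<alpha> - a)) * nrm (B (\<gamma> - \<sigma> - \<alpha>)) ?D"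
        using c2[OF h(3) Ds(1)] by auto
      note this(2)
      also have "c2 * h powr (- (2 * \<alpha> - a)) * nrm (B (\<gamma> - \<sigma> - \<alpha>)) ?D \<le> c2 * h powr (- (2 * \<alpha> - a)) * (A2 * ?Q)"
        using Ds \<open>c2 > 0\<close> by (intro mult_left_mono) auto
      finally have "nrm ?E e5 \<le> (r * h powr (2 * \<alpha>)) * (c2 * h powr (- (2 * \<alpha> - a)) * (A2 * ?Q))"
        unfolding e5_def nrm_scaleR[OF nsp m] using x m r by (intro mult_mono) auto
      also have "\<dots> = r * c2 * A2 * ?Q * (h powr (2 * \<alpha>) * h powr (- (2 * \<alpha> - a)))"
        by (simp add: algebra_simps)
      also have "h powr (2 * \<alpha>) * h powr (- (2 * \<alpha> - a)) = h powr a"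
        by (simp flip: powr_add)
      finally show "nrm ?E e5 \<le> r * c2 * A2 * ?Q * h powr a" "e5 \<in> car ?E"
        using m by (auto simp: e5_def)
    qed
    have "nrm ?E (remainder X y (\<lambda>t. G (y t)) s t)
        \<le> nrm ?E e1 + nrm ?E e2 + nrm ?E e3 + (nrm ?E e4 + nrm ?E e5)"
      unfolding eq using b1(1) b2(1) b3(1) b4(1) b5(1)
      by (intro order_trans[OF nrm_add[OF nsp]] add_mono order_refl ns_add)
    also have "\<dots> \<le> c0 * A1 * ?Q * h powr a + C2 * (1 + A1) * ?Q * h powr a + C3 * k2 * ?Q * h powr a
        + (r * c1 * C1 * k2 * ?Q * h powr a + r * c2 * A2 * ?Q * h powr a)"
      using b1 b2 b3 b4 b5 by (intro add_mono) auto
    also have "\<dots> = C * ?Q * (t - s) powr a"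
      by (simp add: C_def h_def algebra_simps)
    finally show ?thesis .
  qed
  then show ?thesis
    using C by (intro exI[of _ C]) auto
qed

lemma solves_controlled_bounds:
  "\<exists>C>0. \<forall>T X XX N y I J. solves T X XX N y I J \<longrightarrow>
    controlled_bounds \<alpha> \<gamma> (C * data_bound T N (y 0)) T X y (\<lambda>t. G (y t))"
proof -
  obtain A1 where "A1 > 0" and A1: "\<And>T X XX N y I J t. solves T X XX N y I J \<Longrightarrow> 0 \<le> t \<Longrightarrow> t \<le> T \<Longrightarrow>
    nrm (B \<gamma>) (y t) \<le> A1 * data_bound T N (y 0)"
    using solves_sup_bound by meson
  obtain A2 where "A2 > 0" and A2: "\<And>T X XX N y I J t. solves T X XX N y I J \<Longrightarrow> 0 \<le> t \<Longrightarrow> t \<le> T \<Longrightarrow>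
    nrm (B (\<gamma> - \<alpha>)) (G (y t)) \<le> A2 * data_bound T N (y 0)"
    using solves_G_bound by meson
  obtain A3 where "A3 > 0" and A3: "\<And>T X XX N y I J s t. solves T X XX N y I J \<Longrightarrow> 0 \<le> s \<Longrightarrow> s < t \<Longrightarrow> t \<le> T \<Longrightarrow>
    nrm (B (\<gamma> - \<alpha>)) (remainder X y (\<lambda>t. G (y t)) s t) \<le> A3 * data_bound T N (y 0) * (t - s) powr \<alpha>"
    using solves_remainder_bound[of \<alpha>] by (auto simp only: insert_iff) meson
  obtain A4 where "A4 > 0" and A4: "\<And>T X XX N y I J s t. solves T X XX N y I J \<Longrightarrow> 0 \<le> s \<Longrightarrow> s < t \<Longrightarrow> t \<le> T \<Longrightarrow>
    nrm (B (\<gamma> - 2 * \<alpha>)) (remainder X y (\<lambda>t. G (y t)) s t) \<le> A4 * data_bound T N (y 0) * (t - s) powr (2 * \<alpha>)"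
    using solves_remainder_bound[of "2 * \<alpha>"] by (auto simp only: insert_iff) meson
  obtain M where "M > 0" and "\<forall>\<theta>\<in>{0, \<alpha>, 2 * \<alpha>}. \<forall>x\<in>car (B (\<gamma> - \<theta>)). G x \<in> car (B (\<gamma> - \<sigma> - \<theta>)) \<and>
       (\<forall>y\<in>car (B (\<gamma> - \<theta>)). nrm (B (\<gamma> - \<sigma> - \<theta>)) (G y - G x) \<le> M * nrm (B (\<gamma> - \<theta>)) (y - x))"
    using assumption_G_estimates[OF G \<sigma>] by (elim exE conjE) blast
  from this(2)[rule_format, of \<alpha>]
  have Gl: "G x \<in> car (B (\<gamma> - \<sigma> - \<alpha>))" "nrm (B (\<gamma> - \<sigma> - \<alpha>)) (G y - G x) \<le> M * nrm (B (\<gamma> - \<alpha>)) (y - x)"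
    if "x \<in> car (B (\<gamma> - \<alpha>))" "y \<in> car (B (\<gamma> - \<alpha>))" for x y
    using that by auto
  obtain c where "c > 0" and c: "\<And>x. x \<in> car (B (\<gamma> - \<sigma> - \<alpha>)) \<Longrightarrow>
      nrm (B (\<gamma> - 2 * \<alpha>)) x \<le> c * nrm (B (\<gamma> - \<sigma> - \<alpha>)) x"
    using scale_embedding[of "\<gamma> - 2 * \<alpha>" "\<gamma> - \<sigma> - \<alpha>"] \<sigma> by auto
  define C where "C = A1 + A2 + A3 + A4 + c * M * (A3 + r * A2)"
  have pos: "0 \<le> c * M * (A3 + r * A2)"
    using \<open>c > 0\<close> \<open>M > 0\<close> \<open>A2 > 0\<close> \<open>A3 > 0\<close> r by simp
  have le: "A1 \<le> C" "A2 \<le> C" "A3 \<le> C" "A4 \<le> C" "c * M * (A3 + r * A2) \<le> C" "C > 0"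
    using \<open>A1 > 0\<close> \<open>A2 > 0\<close> \<open>A3 > 0\<close> \<open>A4 > 0\<close> pos by (auto simp: C_def)
  have "controlled_bounds \<alpha> \<gamma> (C * data_bound T N (y 0)) T X y (\<lambda>t. G (y t))"
    if sol: "solves T X XX N y I J" for T X XX N y I J
    unfolding controlled_bounds_def
  proof (intro conjI allI impI; elim conjE)
    let ?Q = "data_bound T N (y 0)"
    have Q: "0 \<le> ?Q"
      using data_bound_ge(1)[of "y 0" N T] solves_mem[OF sol, of 0] solvesD[OF sol] by simp
    have grow: "A * ?Q \<le> C * ?Q" if "A \<le> C" for A
      using that Q by (rule mult_right_mono)
    fix t assume t: "0 \<le> t" "t \<le> T"
    show "y t \<in> car (B \<gamma>)" "G (y t) \<in> car (B (\<gamma> - \<alpha>))"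
      using solves_mem[OF sol t] by auto
    show "nrm (B \<gamma>) (y t) \<le> C * ?Q"
      using A1[OF sol t] grow[OF le(1)] by linarith
    show "nrm (B (\<gamma> - \<alpha>)) (G (y t)) \<le> C * ?Q"
      using A2[OF sol t] grow[OF le(2)] by linarith
  next
    let ?Q = "data_bound T N (y 0)"
    have Q: "0 \<le> ?Q"
      using data_bound_ge(1)[of "y 0" N T] solves_mem[OF sol, of 0] solvesD[OF sol] by simp
    fix s t assume st: "0 \<le> s" "s < t" "t \<le> T"
    have grow: "A * ?Q * (t - s) powr p \<le> C * ?Q * (t - s) powr p" if "A \<le> C" for A p
      using that Q by (intro mult_right_mono) auto
    show "nrm (B (\<gamma> - \<alpha>)) (remainder X y (\<lambda>t. G (y t)) s t) \<le> C * ?Q * (t - s) powr \<alpha>"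
      using A3[OF sol st] grow[OF le(3), of \<alpha>] by linarith
    show "nrm (B (\<gamma> - 2 * \<alpha>)) (remainder X y (\<lambda>t. G (y t)) s t) \<le> C * ?Q * (t - s) powr (2 * \<alpha>)"
      using A4[OF sol st] grow[OF le(4), of "2 * \<alpha>"] by linarith
    have ym: "y s \<in> car (B (\<gamma> - \<alpha>))" "y t \<in> car (B (\<gamma> - \<alpha>))"
      using solves_mem[OF sol] scale_mem[of _ \<gamma> "\<gamma> - \<alpha>"] \<alpha> st by auto
    have "nrm (B (\<gamma> - 2 * \<alpha>)) (G (y t) - G (y s)) \<le> c * nrm (B (\<gamma> - \<sigma> - \<alpha>)) (G (y t) - G (y s))"
      using Gl(1)[OF ym(1,1)] Gl(1)[OF ym(2,2)] by (intro c) auto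
    also have "\<dots> \<le> c * (M * nrm (B (\<gamma> - \<alpha>)) (y t - y s))"
      using Gl(2)[OF ym] \<open>c > 0\<close> by simp
    also have "\<dots> \<le> c * (M * ((A3 * ?Q + r * (A2 * ?Q)) * (t - s) powr \<alpha>))"
    proof -
      have "nrm (B (\<gamma> - \<alpha>)) (y t - y s) \<le> (A3 * ?Q + r * (A2 * ?Q)) * (t - s) powr \<alpha>"
        using solvesD[OF sol] \<alpha> r st A2[OF sol] A3[OF sol st]
        by (intro controlled_increment_bound[where v' = "\<lambda>t. G (y t)"]) auto
      then show ?thesis
        using \<open>c > 0\<close> \<open>M > 0\<close> by simp
    qed
    also have "\<dots> = c * M * (A3 + r * A2) * ?Q * (t - s) powr \<alpha>"
      by (simp add: algebra_simps)
    also have "\<dots> \<le> C * ?Q * (t - s) powr \<alpha>"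
      by (rule grow[OF le(5)])
    finally show "nrm (B (\<gamma> - 2 * \<alpha>)) (G (y t) - G (y s)) \<le> C * ?Q * (t - s) powr \<alpha>" .
  qed
  then show ?thesis
    using le(6) by (intro exI[of _ C]) auto
qed

end

section \<open>Norms of controlled paths\<close>

lemma hoelder2_leI:
  assumes "0 \<le> N" "\<And>s t. 0 \<le> s \<Longrightarrow> s < t \<Longrightarrow> t \<le> T \<Longrightarrow> nrm E (R s t) \<le> N * (t - s) powr \<beta>"
  shows "hoelder2 E \<beta> T R \<le> ennreal N"
  unfolding hoelder2_def
proof (rule SUP_least; clarify)
  fix s t :: real assume st: "0 \<le> s" "s < t" "t \<le> T"
  then have "nrm E (R s t) / (t - s) powr \<beta> \<le> N"
    using assms(2)[OF st] by (simp add: divide_le_eq)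
  then show "ennreal (nrm E (R s t) / (t - s) powr \<beta>) \<le> ennreal N"
    by (rule ennreal_leI)
qed

lemma hoelder2_leD:
  assumes "hoelder2 E \<beta> T R \<le> ennreal N" "0 \<le> N" "0 \<le> s" "s < t" "t \<le> T"
  shows "nrm E (R s t) \<le> N * (t - s) powr \<beta>"
proof -
  have "ennreal (nrm E (R s t) / (t - s) powr \<beta>) \<le> hoelder2 E \<beta> T R"
    unfolding hoelder2_def using assms(3-5) by (intro SUP_upper2[of "(s, t)"]) auto
  then have "ennreal (nrm E (R s t) / (t - s) powr \<beta>) \<le> ennreal N"
    using assms(1) by (rule order_trans)
  then have "nrm E (R s t) / (t - s) powr \<beta> \<le> N"
    using assms(2) by (simp add: ennreal_le_iff)
  then show ?thesis
    using assms(4) by (simp add: divide_le_eq)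
qed

lemma rough_path_rough_bounds:
  assumes X: "rough_path \<alpha> T X XX" and norm: "rough_norm \<alpha> T X XX \<le> ennreal \<rho>"
  shows "rough_bounds \<alpha> (max 0 \<rho>) T X XX"
proof -
  have "ennreal \<rho> = ennreal (max 0 \<rho>)"
    by (simp add: max_def ennreal_neg)
  then have sum: "hoelder real_nspace \<alpha> T X + hoelder2 real_nspace (2 * \<alpha>) T XX \<le> ennreal (max 0 \<rho>)"
    using norm by (simp add: rough_norm_def)
  have "hoelder2 real_nspace \<alpha> T (\<lambda>s t. X t - X s) \<le> ennreal (max 0 \<rho>)"
    using sum by (simp add: hoelder_def add_increasing2 order_trans[rotated])
  moreover have "hoelder2 real_nspace (2 * \<alpha>) T XX \<le> ennreal (max 0 \<rho>)"
    using sum by (meson add_increasing order_refl order_trans zero_le)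
  ultimately show ?thesis
    using X hoelder2_leD[of real_nspace] by (force simp: rough_bounds_def rough_path_def real_nspace_def)
qed

context smoothing_scale
begin

lemma crp_norm_le:
  assumes N: "0 \<le> N" and v: "controlled_bounds \<alpha> \<kappa> N T X v v'"
  shows "crp_norm B \<alpha> T X \<kappa> v v' \<le> ennreal (5 * N)"
proof -
  have "crp_norm B \<alpha> T X \<kappa> v v' \<le> ennreal N + ennreal N + ennreal N + ennreal N + ennreal N"
    unfolding crp_norm_def sup_norm_def hoelder_def using v N
    by (intro add_mono SUP_least ennreal_leI hoelder2_leI) (auto simp: controlled_bounds_def)
  also have "\<dots> = ennreal (5 * N)"
    using N by (simp flip: ennreal_plus)
  finally show ?thesis .
qed

lemma controlled_controlled_bounds:
  assumes v: "controlled B \<alpha> T X \<kappa> v v'"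
  shows "controlled_bounds \<alpha> \<kappa> (enn2real (crp_norm B \<alpha> T X \<kappa> v v')) T X v v'"
proof -
  define N where "N = enn2real (crp_norm B \<alpha> T X \<kappa> v v')"
  have N0: "0 \<le> N"
    by (simp add: N_def)
  have "crp_norm B \<alpha> T X \<kappa> v v' = ennreal N"
    using v by (simp add: N_def controlled_def)
  then have total: "ennreal N = sup_norm (B \<kappa>) T v + sup_norm (B (\<kappa> - \<alpha>)) T v'
      + hoelder2 (B (\<kappa> - 2 * \<alpha>)) \<alpha> T (\<lambda>s t. v' t - v' s)
      + hoelder2 (B (\<kappa> - \<alpha>)) \<alpha> T (remainder X v v')
      + hoelder2 (B (\<kappa> - 2 * \<alpha>)) (2 * \<alpha>) T (remainder X v v')"
    by (simp add: crp_norm_def hoelder_def)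
  have sums: "sup_norm (B \<kappa>) T v \<le> ennreal N" "sup_norm (B (\<kappa> - \<alpha>)) T v' \<le> ennreal N"
    "hoelder2 (B (\<kappa> - 2 * \<alpha>)) \<alpha> T (\<lambda>s t. v' t - v' s) \<le> ennreal N"
    "hoelder2 (B (\<kappa> - \<alpha>)) \<alpha> T (remainder X v v') \<le> ennreal N"
    "hoelder2 (B (\<kappa> - 2 * \<alpha>)) (2 * \<alpha>) T (remainder X v v') \<le> ennreal N"
    unfolding total by (simp_all add: add_increasing add_increasing2)
  have "continuous_map (top_of_set {0..T}) (ntop (B \<kappa>)) v"
    "continuous_map (top_of_set {0..T}) (ntop (B (\<kappa> - \<alpha>))) v'"
    using v by (auto simp: controlled_def)
  then have mem: "v t \<in> car (B \<kappa>)" "v' t \<in> car (B (\<kappa> - \<alpha>))" if "0 \<le> t" "t \<le> T" for t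
    using that by (auto simp: continuous_map_def topspace_ntop[OF nsp] Pi_iff)
  have sup: "nrm (B \<kappa>) (v t) \<le> N" "nrm (B (\<kappa> - \<alpha>)) (v' t) \<le> N" if "0 \<le> t" "t \<le> T" for t
  proof -
    have "ennreal (nrm (B \<kappa>) (v t)) \<le> ennreal N" "ennreal (nrm (B (\<kappa> - \<alpha>)) (v' t)) \<le> ennreal N"
      using sums(1,2) that unfolding sup_norm_def by (auto simp: SUP_le_iff)
    then show "nrm (B \<kappa>) (v t) \<le> N" "nrm (B (\<kappa> - \<alpha>)) (v' t) \<le> N"
      using N0 by (simp_all add: ennreal_le_iff)
  qed
  show ?thesis
    unfolding controlled_bounds_def N_def[symmetric]
    using mem sup hoelder2_leD[OF sums(3) N0] hoelder2_leD[OF sums(4) N0] hoelder2_leD[OF sums(5) N0] by simp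
qed

end

context rough_equation
begin

text \<open>
  Restarting at time \<open>s\<close>: the mild formulas at \<open>s\<close> and at \<open>t\<close> are combined by the semigroup property.
\<close>

lemma mild_solution_solves:
  assumes T: "0 < T" "T \<le> T\<^sub>0" and X: "rough_bounds \<alpha> r T X XX"
    and sol: "mild_solution B S \<alpha> \<gamma> \<delta> \<sigma> F G T X XX y0 y"
  shows "\<exists>I J. solves T X XX (enn2real (crp_norm B \<alpha> T X \<gamma> y (\<lambda>t. G (y t)))) y I J"
proof -
  have y: "y 0 = y0" "controlled B \<alpha> T X \<gamma> y (\<lambda>t. G (y t))"
    and ex: "\<forall>t\<in>{0..T}. \<exists>I J.
        has_bochner_integral_in (B (\<gamma> - \<delta>)) (restrict_space lborel {0..t}) (\<lambda>s. S (t - s) (F (y s))) I \<and>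
        has_rough_integral (B (\<gamma> - \<sigma> - 2 * \<alpha>)) S X XX (\<lambda>s. G (y s)) (\<lambda>s. DGG B \<alpha> \<gamma> \<sigma> G (y s)) t J \<and>
        y t = S t y0 + I + J"
    using sol by (simp_all add: mild_solution_def)
  note cb = controlled_controlled_bounds[OF y(2)]
  have y0: "y0 \<in> car (B \<gamma>)"
    using cb y(1) T by (auto simp: controlled_bounds_def)
  obtain I J where IJ: "\<forall>t\<in>{0..T}.
        has_bochner_integral_in (B (\<gamma> - \<delta>)) (restrict_space lborel {0..t}) (\<lambda>s. S (t - s) (F (y s))) (I t) \<and>
        has_rough_integral (B (\<gamma> - \<sigma> - 2 * \<alpha>)) S X XX (\<lambda>s. G (y s)) (\<lambda>s. DGG B \<alpha> \<gamma> \<sigma> G (y s)) t (J t) \<and>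
        y t = S t y0 + I t + J t"
    using ex unfolding bchoice_iff by blast
  \<comment> \<open>A space that contains all terms of the mild formula.\<close>
  let ?\<theta> = "\<gamma> - \<delta> - \<sigma> - 2 * \<alpha>"
  have mem: "I t \<in> car (B ?\<theta>)" "J t \<in> car (B ?\<theta>)" if "t \<in> {0..T}" for t
  proof -
    have "I t \<in> car (B (\<gamma> - \<delta>))" "J t \<in> car (B (\<gamma> - \<sigma> - 2 * \<alpha>))"
      using IJ that by (auto simp: has_bochner_integral_in_def limitin_ntop[OF nsp] has_rough_integral_def[of "B _"])
    then show "I t \<in> car (B ?\<theta>)" "J t \<in> car (B ?\<theta>)"
      using \<alpha> \<sigma> \<delta> by (auto elim!: scale_mem)
  qed
  have y0\<theta>: "y0 \<in> car (B ?\<theta>)"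
    using \<alpha> \<sigma> \<delta> by (intro scale_mem[OF y0]) simp
  have "y t = S (t - s) (y s) + (I t - S (t - s) (I s)) + (J t - S (t - s) (J s))"
    if st: "0 \<le> s" "s < t" "t \<le> T" for s t
  proof -
    have m: "S s y0 \<in> car (B ?\<theta>)" "I s \<in> car (B ?\<theta>)" "J s \<in> car (B ?\<theta>)"
      using st y0\<theta> mem[of s] by auto
    have "S (t - s) (y s) = S (t - s) (S s y0 + I s + J s)"
      using IJ st by simp
    also have "\<dots> = S (t - s) (S s y0) + S (t - s) (I s) + S (t - s) (J s)"
      using st m by (simp add: S_add[of _ _ ?\<theta>])
    also have "S (t - s) (S s y0) = S t y0"
      using st by (intro S_comp[OF _ _ _ y0]) auto
    finally have "S (t - s) (y s) = S t y0 + S (t - s) (I s) + S (t - s) (J s)" .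
    then show ?thesis
      using IJ st by simp
  qed
  then have "solves T X XX (enn2real (crp_norm B \<alpha> T X \<gamma> y (\<lambda>t. G (y t)))) y I J"
    unfolding solves_def drift_integral_of_def using T X cb IJ by simp
  then show ?thesis
    by blast
qed

end

section \<open>The a priori estimate\<close>

theorem corollary3p7:
  fixes B :: "real \<Rightarrow> 'b::real_vector nspace"
    and domA :: "real \<Rightarrow> 'b set" and A :: "'b \<Rightarrow> 'b" and S :: "real \<Rightarrow> 'b \<Rightarrow> 'b"
    and F G :: "'b \<Rightarrow> 'b"
    and \<alpha> \<gamma> \<delta> \<sigma> T\<^sub>0 \<rho> :: real
  assumes "1 / 3 < \<alpha>" "\<alpha> < 1 / 2"
    and "interpolation_scale B"
    and "scale_semigroup B domA A S"
    and "0 \<le> \<delta>" "\<delta> < 1" "assumption_F B \<gamma> \<delta> F"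
    and "0 \<le> \<sigma>" "\<sigma> < \<alpha>" "assumption_G B \<alpha> \<gamma> \<sigma> G"
    and "0 < T\<^sub>0"
  shows "\<exists>C>0. \<forall>T X XX y0 y.
           0 < T \<and> T \<le> T\<^sub>0 \<and>
           rough_path \<alpha> T X XX \<and> rough_norm \<alpha> T X XX \<le> ennreal \<rho> \<and>
           y0 \<in> car (B \<gamma>) \<and> mild_solution B S \<alpha> \<gamma> \<delta> \<sigma> F G T X XX y0 y \<longrightarrow>
           crp_norm B \<alpha> T X \<gamma> y (\<lambda>t. G (y t))
             \<le> ennreal C * (1 + ennreal (nrm (B \<gamma>) y0)
                 + ennreal (T powr min (\<alpha> - \<sigma>) (1 - \<delta>)) * crp_norm B \<alpha> T X \<gamma> y (\<lambda>t. G (y t)))"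
proof -
  interpret rough_equation B domA A S \<alpha> \<gamma> \<delta> \<sigma> T\<^sub>0 "max 0 \<rho>" F G
    using assms by unfold_locales auto
  obtain C where "C > 0" and C: "\<And>T X XX N y I J. solves T X XX N y I J \<Longrightarrow>
    controlled_bounds \<alpha> \<gamma> (C * data_bound T N (y 0)) T X y (\<lambda>t. G (y t))"
    using solves_controlled_bounds by meson
  have "crp_norm B \<alpha> T X \<gamma> y (\<lambda>t. G (y t))
      \<le> ennreal (5 * C) * (1 + ennreal (nrm (B \<gamma>) y0)
          + ennreal (T powr min (\<alpha> - \<sigma>) (1 - \<delta>)) * crp_norm B \<alpha> T X \<gamma> y (\<lambda>t. G (y t)))"
    if T: "0 < T" "T \<le> T\<^sub>0" and X: "rough_path \<alpha> T X XX" "rough_norm \<alpha> T X XX \<le> ennreal \<rho>"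
    and y0: "y0 \<in> car (B \<gamma>)" and sol: "mild_solution B S \<alpha> \<gamma> \<delta> \<sigma> F G T X XX y0 y" for T X XX y0 y
  proof -
    define N where "N = enn2real (crp_norm B \<alpha> T X \<gamma> y (\<lambda>t. G (y t)))"
    have N: "crp_norm B \<alpha> T X \<gamma> y (\<lambda>t. G (y t)) = ennreal N" "0 \<le> N" and y: "y 0 = y0"
      using sol by (auto simp: N_def mild_solution_def controlled_def)
    obtain I J where "solves T X XX N y I J"
      using mild_solution_solves[OF T rough_path_rough_bounds[OF X] sol] unfolding N_def by blast
    from C[OF this] have "controlled_bounds \<alpha> \<gamma> (C * data_bound T N y0) T X y (\<lambda>t. G (y t))"
      by (simp add: y)
    moreover have Q: "0 \<le> data_bound T N y0"
      using data_bound_ge(1)[OF y0 N(2), of T] by simp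
    ultimately have "crp_norm B \<alpha> T X \<gamma> y (\<lambda>t. G (y t)) \<le> ennreal (5 * (C * data_bound T N y0))"
      using \<open>C > 0\<close> by (intro crp_norm_le) auto
    also have "\<dots> = ennreal (5 * C) * ennreal (data_bound T N y0)"
      using \<open>C > 0\<close> Q by (simp add: mult.assoc flip: ennreal_mult)
    also have "ennreal (data_bound T N y0) = 1 + ennreal (nrm (B \<gamma>) y0)
        + ennreal (T powr min (\<alpha> - \<sigma>) (1 - \<delta>)) * ennreal N"
      using y0 N(2) by (simp add: data_bound_def ennreal_plus ennreal_mult)
    finally show ?thesis
      by (simp only: N(1))
  qed
  then show ?thesis
    using \<open>C > 0\<close> by (intro exI[of _ "5 * C"]) auto
qed

end
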